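(* Let $1\le p_1,p_2,q\le\infty$ and $s>1$. Define $p$ by $\frac1p:=\frac1{p_1}+\frac1{p_2}$ and suppose $p\ge1$. Assume that $f\in\mathcal{GM}^s_{p_1,q}(\mathbb{R}^n)$ and $g\in\mathcal{GM}^s_{p_2,q}(\mathbb{R}^n)$. Then $f\cdot g\in\mathcal{GM}^s_{p,q}(\mathbb{R}^n)$ and $$\|f\cdot g\|_{\mathcal{GM}^s_{p,q}}\le C\,\|f\|_{\mathcal{GM}^s_{p_1,q}}\|g\|_{\mathcal{GM}^s_{p_2,q}}$$ with a positive constant $C$ which depends only on the choice of the frequency-uniform decomposition $(\sigma_k)_k$, the dimension $n$ and the parameters $s$ and $q$.
   Context: The Fourier transform is $\mathcal{F}f(\xi)=(2\pi)^{-n/2}\int_{\mathbb{R}^n}f(x)e^{-ix\cdot\xi}\,dx$, extended to tempered distributions. Fix a function $\rho\in C_0^\infty(\mathbb{R}^n)$ with $\rho:\mathbb{R}^n\to[0,1]$, $\operatorname{supp}\rho\subset[-1,1]^n$ and $\rho=1$ on $[-\tfrac12,\tfrac12]^n$. For $k\in\mathbb{Z}^n$ put $\rho_k(\xi)=\rho(\xi-k)$, $\sigma_k=\rho_k\big(\sum_{m\in\mathbb{Z}^n}\rho_m\big)^{-1}$ (the frequency-uniform decomposition) and $\Box_k f=\mathcal{F}^{-1}(\sigma_k\mathcal{F}f)$. For $1\le p,q\le\infty$ and $s>0$ the Gevrey-modulation space $\mathcal{GM}^s_{p,q}(\mathbb{R}^n)$ is the set of all $f\in L^p(\mathbb{R}^n)$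 (complex-valued functions) with $$\|f\|_{\mathcal{GM}^s_{p,q}}=\Big(\sum_{k\in\mathbb{Z}^n}e^{q|k|^{1/s}}\|\Box_kf\|_{L^p}^q\Big)^{1/q}<\infty$$ (for $q=\infty$: $\sup_{k}e^{|k|^{1/s}}\|\Box_kf\|_{L^p}$), where $|k|$ is the Euclidean norm. *)

theory Defs
  imports "HOL-Probability.Probability"
begin

section \<open>Smooth functions and Schwartz functions\<close>

definition partial_deriv :: "'n::finite \<Rightarrow> (real^'n \<Rightarrow> 'b::real_normed_vector) \<Rightarrow> real^'n \<Rightarrow> 'b" where
  "partial_deriv i f x = frechet_derivative f (at x) (axis i 1)"

text \<open>Multi-indices are rendered as lists of coordinates to differentiate in.\<close>

fun partial_derivs :: "'n::finite list \<Rightarrow> (real^'n \<Rightarrow> 'b::real_normed_vector) \<Rightarrow> real^'n \<Rightarrow> 'b" where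
  "partial_derivs [] f = f"
| "partial_derivs (i # is) f = partial_deriv i (partial_derivs is f)"

definition smooth :: "(real^'n::finite \<Rightarrow> 'b::real_normed_vector) \<Rightarrow> bool" where
  "smooth f \<longleftrightarrow> (\<forall>is. partial_derivs is f differentiable_on UNIV)"

definition schwartz :: "(real^'n::finite \<Rightarrow> complex) set" where
  "schwartz = {\<phi>. smooth \<phi> \<and>
     (\<forall>is N. bounded (range (\<lambda>x. (1 + norm x) ^ N *\<^sub>R partial_derivs is \<phi> x)))}"


section \<open>Fourier transform\<close>

definition fourier :: "(real^'n::finite \<Rightarrow> complex) \<Rightarrow> real^'n \<Rightarrow> complex" where
  "fourier f \<xi> = of_real ((2 * pi) powr (- real CARD('n) / 2)) *
     (LINT x|lebesgue. f x * exp (- \<i> * of_real (x \<bullet> \<xi>)))"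

definition inv_fourier :: "(real^'n::finite \<Rightarrow> complex) \<Rightarrow> real^'n \<Rightarrow> complex" where
  "inv_fourier f x = of_real ((2 * pi) powr (- real CARD('n) / 2)) *
     (LINT \<xi>|lebesgue. f \<xi> * exp (\<i> * of_real (x \<bullet> \<xi>)))"

text \<open>
  A tempered distribution is represented by its values on test functions; only the values on
  \<^const>\<open>schwartz\<close> are meaningful. The operations below extend those on functions by transposition.
\<close>

type_synonym 'n distr = "(real^'n \<Rightarrow> complex) \<Rightarrow> complex"

definition distr_of_fun :: "(real^'n::finite \<Rightarrow> complex) \<Rightarrow> 'n distr" where
  "distr_of_fun f \<phi> = (LINT x|lebesgue. f x * \<phi> x)"

definition distr_fourier :: "'n::finite distr \<Rightarrow> 'n distr" where
  "distr_fourier T \<phi> = T (fourier \<phi>)"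

definition distr_inv_fourier :: "'n::finite distr \<Rightarrow> 'n distr" where
  "distr_inv_fourier T \<phi> = T (inv_fourier \<phi>)"

definition distr_mult :: "(real^'n::finite \<Rightarrow> complex) \<Rightarrow> 'n distr \<Rightarrow> 'n distr" where
  "distr_mult a T \<phi> = T (\<lambda>x. a x * \<phi> x)"


section \<open>Lebesgue spaces\<close>

text \<open>Powers of extended nonnegative reals; used for exponents \<open>r > 0\<close> only.\<close>

definition ennreal_powr :: "ennreal \<Rightarrow> real \<Rightarrow> ennreal" where
  "ennreal_powr x r = (if x = \<infinity> then \<infinity> else ennreal (enn2real x powr r))"

definition Lp_norm :: "ennreal \<Rightarrow> (real^'n::finite \<Rightarrow> complex) \<Rightarrow> ennreal" where
  "Lp_norm p f =
     (if p = \<infinity> then esssup lebesgue (\<lambda>x. ennreal (norm (f x)))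
      else ennreal_powr (\<integral>\<^sup>+ x. ennreal (norm (f x) powr enn2real p) \<partial>lebesgue) (1 / enn2real p))"

definition Lp_space :: "ennreal \<Rightarrow> (real^'n::finite \<Rightarrow> complex) set" where
  "Lp_space p = {f \<in> borel_measurable lebesgue. Lp_norm p f < \<infinity>}"

text \<open>
  The \<open>L\<^sup>p\<close> norm of a tempered distribution is the norm of the (almost everywhere unique)
  \<open>L\<^sup>p\<close> function inducing it, and \<open>\<infinity>\<close> if there is none (infimum of the empty set).
\<close>

definition distr_Lp_norm :: "ennreal \<Rightarrow> 'n::finite distr \<Rightarrow> ennreal" where
  "distr_Lp_norm p T =
     (INF h\<in>{h \<in> Lp_space p. \<forall>\<phi>\<in>schwartz. T \<phi> = distr_of_fun h \<phi>}. Lp_norm p h)"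


section \<open>Frequency-uniform decomposition and Gevrey-modulation spaces\<close>

definition decomposition_window :: "(real^'n::finite \<Rightarrow> real) \<Rightarrow> bool" where
  "decomposition_window \<rho> \<longleftrightarrow>
     smooth \<rho> \<and> range \<rho> \<subseteq> {0..1} \<and>
     closure {\<xi>. \<rho> \<xi> \<noteq> 0} \<subseteq> cbox (\<chi> i. - 1) (\<chi> i. 1) \<and>
     (\<forall>\<xi>\<in>cbox (\<chi> i. - (1/2)) (\<chi> i. 1/2). \<rho> \<xi> = 1)"

definition lattice_point :: "int^'n \<Rightarrow> real^'n" where
  "lattice_point k = (\<chi> i. of_int (k $ i))"

definition window_shift :: "(real^'n::finite \<Rightarrow> real) \<Rightarrow> int^'n \<Rightarrow> real^'n \<Rightarrow> real" where
  "window_shift \<rho> k \<xi> = \<rho> (\<xi> - lattice_point k)"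

text \<open>At each point only finitely many terms of the sum over the lattice are nonzero.\<close>

definition freq_decomp :: "(real^'n::finite \<Rightarrow> real) \<Rightarrow> int^'n \<Rightarrow> real^'n \<Rightarrow> real" where
  "freq_decomp \<rho> k \<xi> = window_shift \<rho> k \<xi> * inverse (\<Sum>\<^sub>\<infinity>m\<in>UNIV. window_shift \<rho> m \<xi>)"

definition box_op :: "(real^'n::finite \<Rightarrow> real) \<Rightarrow> int^'n \<Rightarrow> (real^'n \<Rightarrow> complex) \<Rightarrow> 'n distr" where
  "box_op \<rho> k f =
     distr_inv_fourier (distr_mult (\<lambda>\<xi>. of_real (freq_decomp \<rho> k \<xi>)) (distr_fourier (distr_of_fun f)))"

definition GM_norm ::
  "(real^'n::finite \<Rightarrow> real) \<Rightarrow> real \<Rightarrow> ennreal \<Rightarrow> ennreal \<Rightarrow> (real^'n \<Rightarrow> complex) \<Rightarrow> ennreal" where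
  "GM_norm \<rho> s p q f =
     (if q = \<infinity>
      then (SUP k. ennreal (exp (norm (lattice_point k) powr (1/s))) * distr_Lp_norm p (box_op \<rho> k f))
      else ennreal_powr
        (\<Sum>\<^sub>\<infinity>k\<in>UNIV. ennreal (exp (enn2real q * norm (lattice_point k) powr (1/s))) *
            ennreal_powr (distr_Lp_norm p (box_op \<rho> k f)) (enn2real q))
        (1 / enn2real q))"

definition GM_space ::
  "(real^'n::finite \<Rightarrow> real) \<Rightarrow> real \<Rightarrow> ennreal \<Rightarrow> ennreal \<Rightarrow> (real^'n \<Rightarrow> complex) set" where
  "GM_space \<rho> s p q = {f \<in> Lp_space p. GM_norm \<rho> s p q f < \<infinity>}"

end

theory Submission
  imports Defs
begin

text \<open>
  The piece \<open>\<box>\<^sub>k f\<close> is the convolution of \<open>f\<close> with a rapidly decreasing kernel, the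
  inverse Fourier transform of \<open>\<sigma>\<^sub>k\<close>, and all these kernels are modulations of a single one, so they have the
  same \<open>L\<^sup>1\<close> norm. A function in a Gevrey-modulation space has absolutely summable pieces and is almost everywhere
  their sum. Hence \<open>\<box>\<^sub>k (f g)\<close> is the sum of \<open>\<box>\<^sub>k (\<box>\<^sub>l f \<box>\<^sub>m g)\<close>,
  which vanishes unless \<open>k - l - m\<close> is bounded, and the inequalities of Young and Hoelder bound each term by
  \<open>\<parallel>\<box>\<^sub>l f\<parallel> \<parallel>\<box>\<^sub>m g\<parallel>\<close>. Because \<open>s > 1\<close>, for such indices the weight at
  \<open>k\<close> is at most the product of the weights at \<open>l\<close> and \<open>m\<close> times \<open>exp (- \<delta> (min |l| |m|) powr (1/s))\<close>
  up to a constant; this summable gain turns the double sum into a discrete convolution of an \<open>\<ell>\<^sup>1\<close> with an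
  \<open>\<ell>\<^sup>q\<close> sequence.
\<close>

section \<open>Lebesgue norms of extended nonnegative functions\<close>

text \<open>Infinite exponents are allowed, so density of nice functions in the Lebesgue spaces is
  out of reach, and identities between functions are proved by duality: a function integrable
  against a polynomial weight is determined by its integrals against the translated dilates of one
  fixed kernel with nonzero integral. The dilates of \<open>\<rho>\<close> are Schwartz functions
  and show that the infimum in \<open>distr_Lp_norm\<close> is attained by the convolution; the
  dilates of \<open>kap 0\<close> have compactly supported transforms and show that the pieces add
  up to \<open>f\<close>. The spectrum of a product is controlled without transforming a
  distribution: only decaying functions are transformed, and the factors enter as superpositions of
  kernels. Sums over the lattice are integrals over counting measure, so that Young's inequality,
  its discrete form and Minkowski's inequality come from one inequality, and sums are exchanged with
  integrals by Fubini's theorem. The constant does not see \<open>p1\<close>, \<open>p2\<close> and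
  \<open>p\<close>, because these exponents enter only through the inequalities of Young, Hoelder
  and Minkowski, none of which brings in a factor depending on the exponent.\<close>

lemma ennreal_powr_ennreal [simp]: "0 \<le> x \<Longrightarrow> ennreal_powr (ennreal x) r = ennreal (x powr r)"
  by (simp add: ennreal_powr_def)

lemma ennreal_powr_top [simp]: "ennreal_powr top r = top"
  by (simp add: ennreal_powr_def)

lemma ennreal_powr_0 [simp]: "ennreal_powr 0 r = 0"
  by (simp add: ennreal_powr_def)

lemma ennreal_powr_1 [simp]: "ennreal_powr x 1 = x"
  by (cases x rule: ennreal_cases) auto

lemma ennreal_powr_one [simp]: "ennreal_powr 1 r = 1"
  by (simp add: ennreal_powr_def)

lemma ennreal_powr_mono: "0 \<le> r \<Longrightarrow> x \<le> y \<Longrightarrow> ennreal_powr x r \<le> ennreal_powr y r"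
  by (cases x rule: ennreal_cases; cases y rule: ennreal_cases)
     (auto intro!: ennreal_leI powr_mono2 simp: top_unique)

lemma ennreal_powr_mult:
  assumes "0 < r"
  shows "ennreal_powr (x * y) r = ennreal_powr x r * ennreal_powr y r"
proof (cases "x = 0 \<or> y = 0")
  case True then show ?thesis by auto
next
  case False
  then show ?thesis
  proof (cases x rule: ennreal_cases)
    case (real a)
    with False have a: "0 < a" by (auto simp: order_less_le)
    show ?thesis
    proof (cases y rule: ennreal_cases)
      case (real b)
      then show ?thesis using a \<open>x = ennreal a\<close>
        by (simp add: powr_mult flip: ennreal_mult)
    next
      case top
      then show ?thesis using a \<open>x = ennreal a\<close> by (simp add: ennreal_mult_top)
    qed
  next
    case top
    from False have "ennreal_powr y r \<noteq> 0"
      by (cases y rule: ennreal_cases) auto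
    then show ?thesis using False top by (simp add: ennreal_top_mult)
  qed
qed

lemma ennreal_powr_powr: "ennreal_powr (ennreal_powr x r) t = ennreal_powr x (r * t)"
  by (cases x rule: ennreal_cases) (auto simp: powr_powr)

lemma ennreal_powr_eq_0_iff [simp]: "ennreal_powr x r = 0 \<longleftrightarrow> x = 0"
  by (cases x rule: ennreal_cases) auto

lemma ennreal_powr_eq_top_iff [simp]: "ennreal_powr x r = top \<longleftrightarrow> x = top"
  by (cases x rule: ennreal_cases) auto

lemma measurable_ennreal_powr [measurable (raw)]:
  assumes [measurable]: "f \<in> borel_measurable M"
  shows "(\<lambda>x. ennreal_powr (f x) r) \<in> borel_measurable M"
  unfolding ennreal_powr_def infinity_ennreal_def by measurable

lemma ennreal_powr_le_iff: "0 < r \<Longrightarrow> ennreal_powr x r \<le> ennreal_powr y r \<longleftrightarrow> x \<le> y"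
  using ennreal_powr_mono[of r x y] ennreal_powr_mono[of "1/r" "ennreal_powr x r" "ennreal_powr y r"]
  by (auto simp: ennreal_powr_powr)

text \<open>The tangent line of \<open>t powr r / r\<close> at \<open>\<theta>\<close>, rearranged
  without subtraction so that it makes sense for extended values. It is Young's inequality for
  \<open>t powr r\<close> and \<open>\<theta> powr r\<close> with weights \<open>1/r\<close> and
  \<open>1 - 1/r\<close>.\<close>

lemma ennreal_powr_tangent:
  assumes "1 \<le> r" "0 < \<theta>"
  shows "t * ennreal (\<theta> powr (r - 1)) \<le> ennreal (1/r) * ennreal_powr t r + ennreal ((1 - 1/r) * \<theta> powr r)"
proof (cases t rule: ennreal_cases)
  case (real x)
  have "x * \<theta> powr (r - 1) \<le> 1/r * x powr r + (1 - 1/r) * \<theta> powr r"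
  proof (cases "x = 0")
    case True
    then show ?thesis using assms by simp
  next
    case False
    then have "(x powr r) powr (1/r) * (\<theta> powr r) powr (1 - 1/r) \<le> 1/r * x powr r + (1 - 1/r) * \<theta> powr r"
      using assms real by (intro Youngs_inequality_0) auto
    moreover have "r * (1 - 1/r) = r - 1"
      using assms by (simp add: field_simps)
    ultimately show ?thesis
      using assms real by (simp add: powr_powr)
  qed
  then have "ennreal (x * \<theta> powr (r - 1)) \<le> ennreal (1/r * x powr r + (1 - 1/r) * \<theta> powr r)"
    by (rule ennreal_leI)
  then show ?thesis
    using assms real by (simp add: ennreal_mult flip: ennreal_mult ennreal_plus)
next
  case top
  then show ?thesis using assms by (simp add: ennreal_mult_top)
qed

text \<open>Integrate the tangent inequality; the constant term keeps its bound because the total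
  mass is at most one. The claim follows by taking the left integral itself as the point of
  tangency.\<close>

lemma ennreal_powr_Jensen:
  assumes [measurable]: "w \<in> borel_measurable N" "u \<in> borel_measurable N"
    and w: "(\<integral>\<^sup>+z. w z \<partial>N) \<le> 1" and r: "1 \<le> r"
  shows "ennreal_powr (\<integral>\<^sup>+z. w z * u z \<partial>N) r \<le> (\<integral>\<^sup>+z. w z * ennreal_powr (u z) r \<partial>N)"
    (is "ennreal_powr ?S r \<le> ?R")
proof -
  have tangent: "?S * ennreal (\<theta> powr (r - 1)) \<le> ennreal (1/r) * ?R + ennreal ((1 - 1/r) * \<theta> powr r)"
    if "0 < \<theta>" for \<theta>
  proof -
    have "?S * ennreal (\<theta> powr (r - 1)) = (\<integral>\<^sup>+z. w z * (u z * ennreal (\<theta> powr (r - 1))) \<partial>N)"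
      by (simp add: mult.assoc flip: nn_integral_multc)
    also have "\<dots> \<le> (\<integral>\<^sup>+z. w z * (ennreal (1/r) * ennreal_powr (u z) r + ennreal ((1 - 1/r) * \<theta> powr r)) \<partial>N)"
      by (intro nn_integral_mono mult_left_mono ennreal_powr_tangent r that) auto
    also have "\<dots> = (\<integral>\<^sup>+z. ennreal (1/r) * (w z * ennreal_powr (u z) r) + w z * ennreal ((1 - 1/r) * \<theta> powr r) \<partial>N)"
      by (simp add: algebra_simps)
    also have "\<dots> = ennreal (1/r) * ?R + (\<integral>\<^sup>+z. w z \<partial>N) * ennreal ((1 - 1/r) * \<theta> powr r)"
      by (simp add: nn_integral_add nn_integral_cmult nn_integral_multc)
    also have "\<dots> \<le> ennreal (1/r) * ?R + 1 * ennreal ((1 - 1/r) * \<theta> powr r)"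
      by (intro add_left_mono mult_right_mono w) auto
    finally show ?thesis by simp
  qed
  show ?thesis
  proof (cases ?R rule: ennreal_cases)
    case (real R)
    \<comment> \<open>With a finite right-hand side, tangency at 1 already bounds \<open>?S\<close>,
      so a nonzero \<open>?S\<close> is a legitimate point of tangency below.\<close>
    have "?S \<noteq> top"
    proof
      assume "?S = top"
      with tangent[of 1] real r show False
        by (simp add: top_unique flip: ennreal_mult ennreal_plus)
    qed
    then obtain S where S: "?S = ennreal S" "0 \<le> S"
      by (cases ?S rule: ennreal_cases) auto
    show ?thesis
    proof (cases "S = 0")
      case True
      with S show ?thesis by simp
    next
      case False
      with S have S0: "0 < S" by simp
      have "ennreal (S * S powr (r - 1)) \<le> ennreal (1/r * R + (1 - 1/r) * S powr r)"
        using tangent[OF S0] S real r by (simp add: ennreal_mult ennreal_plus del: times_divide_eq_left)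
      moreover have "S * S powr (r - 1) = S powr r"
        using S0 by (simp add: powr_diff)
      ultimately have "S powr r \<le> 1/r * R + (1 - 1/r) * S powr r"
        using real r S by (subst (asm) ennreal_le_iff) auto
      then have "(1/r) * S powr r \<le> (1/r) * R"
        by (simp add: algebra_simps)
      then have "S powr r \<le> R"
        using r by (simp add: field_simps)
      then show ?thesis
        using S real by (auto intro: ennreal_leI)
    qed
  qed simp
qed

section \<open>Lebesgue norms over a general measure; the inequalities of Young, Minkowski and
  Hoelder\<close>

lemma ennreal_inverse_mult_self:
  assumes "x \<noteq> 0" "x \<noteq> (\<infinity>::ennreal)" shows "inverse x * x = 1"
  using assms by (cases x rule: ennreal_cases) (auto simp: inverse_ennreal simp flip: ennreal_mult)

text \<open>The measure is a parameter and the functions are extended nonnegative, so the same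
  lemmas serve Euclidean space, counting measure on the lattice (the sequence spaces), and integrals
  or sums that may be infinite.\<close>

definition Lnorm :: "'a measure \<Rightarrow> ennreal \<Rightarrow> ('a \<Rightarrow> ennreal) \<Rightarrow> ennreal" where
  "Lnorm M p u =
     (if p = \<infinity> then esssup M u
      else ennreal_powr (\<integral>\<^sup>+ x. ennreal_powr (u x) (enn2real p) \<partial>M) (1 / enn2real p))"

lemma enn2real_ge_1:
  assumes "1 \<le> p" "p \<noteq> (top::ennreal)" shows "1 \<le> enn2real p"
  using assms by (cases p rule: ennreal_cases) auto

lemma Lnorm_mono_AE:
  assumes "1 \<le> p" "u \<in> borel_measurable M" "AE x in M. u x \<le> v x"
  shows "Lnorm M p u \<le> Lnorm M p v"
  using assms enn2real_ge_1[of p] unfolding Lnorm_def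
  by (auto intro!: esssup_AE_mono ennreal_powr_mono nn_integral_mono_AE)

lemma Lnorm_cong_AE:
  assumes "u \<in> borel_measurable M" "v \<in> borel_measurable M" "AE x in M. u x = v x"
  shows "Lnorm M p u = Lnorm M p v"
proof -
  have "AE x in M. ennreal_powr (u x) r = ennreal_powr (v x) r" for r
    using assms(3) by eventually_elim simp
  then show ?thesis
    using assms unfolding Lnorm_def
    by (auto intro!: esssup_AE_cong arg_cong2[where f=ennreal_powr] nn_integral_cong_AE)
qed

lemma Lnorm_cmult_le:
  assumes "1 \<le> p" and u[measurable]: "u \<in> borel_measurable M"
  shows "Lnorm M p (\<lambda>x. c * u x) \<le> c * Lnorm M p u"
proof (cases "p = \<infinity>")
  case True
  have "esssup M (\<lambda>x. c * u x) \<le> c * esssup M u"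
    using esssup_AE[of u M] by (intro esssup_I) (auto elim!: eventually_mono intro: mult_left_mono)
  with True show ?thesis by (simp add: Lnorm_def)
next
  case False
  with assms have "1 \<le> enn2real p" by (auto intro: enn2real_ge_1)
  with False show ?thesis
    by (simp add: Lnorm_def ennreal_powr_mult nn_integral_cmult ennreal_powr_powr)
qed

lemma Lnorm_eq_0_AE:
  assumes "1 \<le> p" and u[measurable]: "u \<in> borel_measurable M" and "Lnorm M p u = 0"
  shows "AE x in M. u x = 0"
proof (cases "p = \<infinity>")
  case True
  with assms esssup_AE[of u M] show ?thesis by (simp add: Lnorm_def)
next
  case False
  with assms have "(\<integral>\<^sup>+ x. ennreal_powr (u x) (enn2real p) \<partial>M) = 0"
    by (simp add: Lnorm_def)
  then show ?thesis
    by (subst (asm) nn_integral_0_iff_AE) auto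
qed

text \<open>The common source of Young's inequality (\<open>w\<close> the modulus of a kernel), of its discrete analogue, and of
  Minkowski's inequality for series (\<open>w\<close> the norms of the terms).\<close>

lemma Lnorm_weighted_le:
  assumes "sigma_finite_measure M" "sigma_finite_measure N"
    and [measurable]: "case_prod u \<in> borel_measurable (M \<Otimes>\<^sub>M N)" "w \<in> borel_measurable N"
    and W: "(\<integral>\<^sup>+z. w z \<partial>N) < \<infinity>" and p: "1 \<le> p"
    and E: "\<And>z. z \<in> space N \<Longrightarrow> Lnorm M p (\<lambda>x. u x z) \<le> E"
  shows "Lnorm M p (\<lambda>x. \<integral>\<^sup>+z. w z * u x z \<partial>N) \<le> (\<integral>\<^sup>+z. w z \<partial>N) * E"
proof -
  interpret M: sigma_finite_measure M by fact
  interpret N: sigma_finite_measure N by fact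
  interpret P: pair_sigma_finite M N ..
  show ?thesis
  proof (cases "p = \<infinity>")
    case True
    have "AE z in N. AE x in M. u x z \<le> E"
    proof (rule AE_I2)
      fix z assume z: "z \<in> space N"
      then have "esssup M (\<lambda>x. u x z) \<le> E" using E[OF z] True by (simp add: Lnorm_def)
      with esssup_AE[of "\<lambda>x. u x z" M] show "AE x in M. u x z \<le> E"
        by (auto elim!: eventually_mono)
    qed
    then have *: "AE x in M. AE z in N. u x z \<le> E"
      by (subst P.AE_commute) auto
    have "AE x in M. (\<integral>\<^sup>+z. w z * u x z \<partial>N) \<le> (\<integral>\<^sup>+z. w z \<partial>N) * E"
      using *
    proof eventually_elim
      case (elim x)
      then have "(\<integral>\<^sup>+z. w z * u x z \<partial>N) \<le> (\<integral>\<^sup>+z. w z * E \<partial>N)"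
        by (intro nn_integral_mono_AE) (auto intro: mult_left_mono elim!: eventually_mono)
      then show ?case by (simp add: nn_integral_multc)
    qed
    then show ?thesis
      unfolding Lnorm_def using True by (auto intro!: esssup_I)
  next
    case False
    define r where "r = enn2real p"
    have r: "1 \<le> r" using p False by (auto simp: r_def intro: enn2real_ge_1)
    obtain W where W': "(\<integral>\<^sup>+z. w z \<partial>N) = ennreal W" "0 \<le> W"
      using W by (cases "\<integral>\<^sup>+z. w z \<partial>N" rule: ennreal_cases) auto
    show ?thesis
    proof (cases "W = 0")
      case True
      then have w0: "AE z in N. w z = 0"
        using W' by (simp add: nn_integral_0_iff_AE)
      have "(\<integral>\<^sup>+z. w z * u x z \<partial>N) = (\<integral>\<^sup>+z. 0 \<partial>N)" for x
        using w0 by (intro nn_integral_cong_AE) auto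
      then show ?thesis using False by (simp add: Lnorm_def)
    next
      case W0: False
      with W' have Wpos: "0 < W" by simp
      \<comment> \<open>Total mass one puts \<open>w'\<close> within reach of
        \<open>ennreal_powr_Jensen\<close>; Tonelli then exchanges the integrals, and the bound
        \<open>E\<close> applies for each fixed \<open>z\<close>.\<close>
      define w' where "w' z = ennreal (1 / W) * w z" for z
      have [measurable]: "w' \<in> borel_measurable N" by (simp add: w'_def[abs_def])
      have w'1: "(\<integral>\<^sup>+z. w' z \<partial>N) \<le> 1"
        using Wpos W' by (simp add: w'_def nn_integral_cmult flip: ennreal_mult)
      have w_w': "w z = ennreal W * w' z" for z
        using Wpos by (simp add: w'_def flip: ennreal_mult mult.assoc)
      have E': "(\<integral>\<^sup>+x. ennreal_powr (u x z) r \<partial>M) \<le> ennreal_powr E r" if "z \<in> space N" for z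
      proof -
        have "ennreal_powr (ennreal_powr (\<integral>\<^sup>+x. ennreal_powr (u x z) r \<partial>M) (1/r)) r \<le> ennreal_powr E r"
          using E[OF that] False r by (intro ennreal_powr_mono) (auto simp: Lnorm_def r_def)
        then show ?thesis using r by (simp add: ennreal_powr_powr)
      qed
      have "(\<integral>\<^sup>+x. ennreal_powr (\<integral>\<^sup>+z. w z * u x z \<partial>N) r \<partial>M)
          = (\<integral>\<^sup>+x. ennreal_powr W r * ennreal_powr (\<integral>\<^sup>+z. w' z * u x z \<partial>N) r \<partial>M)"
        using r W' by (intro nn_integral_cong)
          (simp add: w_w' mult.assoc nn_integral_cmult ennreal_powr_mult)
      also have "\<dots> = ennreal_powr W r * (\<integral>\<^sup>+x. ennreal_powr (\<integral>\<^sup>+z. w' z * u x z \<partial>N) r \<partial>M)"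
        by (rule nn_integral_cmult) measurable
      also have "\<dots> \<le> ennreal_powr W r * (\<integral>\<^sup>+x. (\<integral>\<^sup>+z. w' z * ennreal_powr (u x z) r \<partial>N) \<partial>M)"
        by (intro mult_left_mono nn_integral_mono ennreal_powr_Jensen w'1 r) auto
      also have "(\<integral>\<^sup>+x. (\<integral>\<^sup>+z. w' z * ennreal_powr (u x z) r \<partial>N) \<partial>M)
          = (\<integral>\<^sup>+z. (\<integral>\<^sup>+x. w' z * ennreal_powr (u x z) r \<partial>M) \<partial>N)"
        by (rule P.Fubini'[symmetric]) measurable
      also have "\<dots> = (\<integral>\<^sup>+z. w' z * (\<integral>\<^sup>+x. ennreal_powr (u x z) r \<partial>M) \<partial>N)"
        by (intro nn_integral_cong nn_integral_cmult) measurable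
      also have "\<dots> \<le> (\<integral>\<^sup>+z. w' z * ennreal_powr E r \<partial>N)"
        by (intro nn_integral_mono mult_left_mono E') auto
      also have "\<dots> = (\<integral>\<^sup>+z. w' z \<partial>N) * ennreal_powr E r"
        by (rule nn_integral_multc) measurable
      also have "\<dots> \<le> 1 * ennreal_powr E r"
        by (intro mult_right_mono w'1) auto
      finally have "(\<integral>\<^sup>+x. ennreal_powr (\<integral>\<^sup>+z. w z * u x z \<partial>N) r \<partial>M) \<le> ennreal_powr (W * E) r"
        using r by (simp add: ennreal_powr_mult mult_left_mono)
      then have "ennreal_powr (\<integral>\<^sup>+x. ennreal_powr (\<integral>\<^sup>+z. w z * u x z \<partial>N) r \<partial>M) (1/r)
          \<le> ennreal_powr (ennreal_powr (W * E) r) (1/r)"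
        using r by (intro ennreal_powr_mono) auto
      then show ?thesis
        using False r W' by (simp add: Lnorm_def ennreal_powr_powr flip: r_def)
    qed
  qed
qed

text \<open>Written as an integral over counting measure, a sum is accessible to Tonelli, monotone
  convergence and \<open>Lnorm_weighted_le\<close>.\<close>

abbreviation csum :: "('j \<Rightarrow> ennreal) \<Rightarrow> ennreal" where
  "csum f \<equiv> (\<integral>\<^sup>+j. f j \<partial>count_space UNIV)"

text \<open>Provides the joint measurability that exchanging a countable sum with an integral
  requires; a preimage splits into countably many sections.\<close>

lemma measurable_count_pair:
  fixes f :: "'a \<times> 'j::countable \<Rightarrow> 'b"
  assumes "\<And>j. (\<lambda>x. f (x, j)) \<in> M \<rightarrow>\<^sub>M N"
  shows "f \<in> M \<Otimes>\<^sub>M count_space UNIV \<rightarrow>\<^sub>M N"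
proof -
  have "(\<lambda>z. (\<lambda>j x. f (fst x, j)) (snd z) z) \<in> M \<Otimes>\<^sub>M count_space UNIV \<rightarrow>\<^sub>M N"
    by (rule measurable_compose_countable[where f="\<lambda>j x. f (fst x, j)"])
       (auto intro: measurable_compose[OF measurable_fst assms])
  then show ?thesis by simp
qed

text \<open>Factor each term into its norm and a function of norm at most one, and apply
  \<open>Lnorm_weighted_le\<close> over counting measure. If the right-hand side is infinite there
  is nothing to show, so all norms may be taken finite.\<close>

lemma Lnorm_sum_le:
  fixes u :: "'j::countable \<Rightarrow> 'a \<Rightarrow> ennreal"
  assumes M: "sigma_finite_measure M" and p: "1 \<le> p"
    and [measurable]: "\<And>j. u j \<in> borel_measurable M"
  shows "Lnorm M p (\<lambda>x. \<integral>\<^sup>+j. u j x \<partial>count_space UNIV) \<le> (csum (\<lambda>j. Lnorm M p (u j)))"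
proof (cases "(csum (\<lambda>j. Lnorm M p (u j))) = \<infinity>")
  case False
  interpret M: sigma_finite_measure M by fact
  interpret N: sigma_finite_measure "count_space (UNIV :: 'j set)"
    by (simp add: sigma_finite_measure_count_space_countable)
  interpret P: pair_sigma_finite M "count_space (UNIV :: 'j set)" ..
  let ?A = "\<lambda>j. Lnorm M p (u j)"
  have A_fin: "?A j \<noteq> \<infinity>" for j
    using nn_integral_PInf_AE[OF _ False] by (auto simp: AE_count_space)
  define v where "v x j = inverse (?A j) * u j x" for x j
  have [measurable]: "(\<lambda>x. v x j) \<in> borel_measurable M" for j
    by (simp add: v_def)
  have v: "case_prod v \<in> borel_measurable (M \<Otimes>\<^sub>M count_space UNIV)"
    by (rule measurable_count_pair) auto
  have v1: "Lnorm M p (\<lambda>x. v x j) \<le> 1" if "?A j \<noteq> 0" for j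
  proof -
    have "Lnorm M p (\<lambda>x. v x j) \<le> inverse (?A j) * ?A j"
      unfolding v_def by (rule Lnorm_cmult_le) (use p in auto)
    also have "\<dots> = 1" using that A_fin[of j] by (rule ennreal_inverse_mult_self)
    finally show ?thesis .
  qed
  \<comment> \<open>Since \<open>inverse 0\<close> is infinite, terms of norm zero are replaced by
    the zero function; they vanish almost everywhere, so the factorisation survives outside a null
    set.\<close>
  define v' where "v' x j = (if ?A j = 0 then 0 else v x j)" for x j
  have [measurable]: "(\<lambda>x. v' x j) \<in> borel_measurable M" for j
    by (simp add: v'_def)
  have v'[measurable]: "case_prod v' \<in> borel_measurable (M \<Otimes>\<^sub>M count_space UNIV)"
    by (rule measurable_count_pair) auto
  have zero: "Lnorm M p (\<lambda>x. 0) = 0"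
    using Lnorm_cmult_le[OF p, of "\<lambda>_. 0" M 0] by simp
  have v'1: "Lnorm M p (\<lambda>x. v' x j) \<le> 1" for j
    using v1[of j] by (cases "?A j = 0") (auto simp: v'_def zero)
  have "AE x in M. u j x = ?A j * v' x j" for j
  proof (cases "?A j = 0")
    case True
    with Lnorm_eq_0_AE[OF p, of "u j" M] show ?thesis by (auto simp: v'_def)
  next
    case False
    then have "?A j * inverse (?A j) = 1"
      using A_fin[of j] ennreal_inverse_mult_self[of "?A j"] by (simp add: mult.commute)
    then show ?thesis using False by (simp add: v'_def v_def flip: mult.assoc)
  qed
  then have ae: "AE x in M. \<forall>j. u j x = ?A j * v' x j"
    by (simp add: AE_all_countable)
  have mu: "(\<lambda>(x, j). u j x) \<in> borel_measurable (M \<Otimes>\<^sub>M count_space UNIV)"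
    by (rule measurable_count_pair) auto
  have "Lnorm M p (\<lambda>x. \<integral>\<^sup>+j. u j x \<partial>count_space UNIV) = Lnorm M p (\<lambda>x. \<integral>\<^sup>+j. ?A j * v' x j \<partial>count_space UNIV)"
    using ae mu by (intro Lnorm_cong_AE N.borel_measurable_nn_integral) (auto elim!: eventually_mono)
  also have "\<dots> \<le> (csum (\<lambda>j. ?A j)) * 1"
    using False p v'1 M N.sigma_finite_measure_axioms
    by (intro Lnorm_weighted_le) (auto simp: less_top)
  finally show ?thesis by simp
qed simp

text \<open>For finite exponents both functions are divided by their norms and Young's inequality is
  integrated; finiteness of the norms makes the division possible. If one exponent is infinite, then
  \<open>1 / \<infinity> = 0\<close> forces \<open>p\<close> to be the other exponent, and the
  essential supremum is pulled out.\<close>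

lemma Lnorm_Holder:
  assumes p1: "1 \<le> p1" and p2: "1 \<le> p2" and p: "1 \<le> p" and eq: "1 / p = 1 / p1 + 1 / p2"
    and [measurable]: "u \<in> borel_measurable M" "v \<in> borel_measurable M"
    and fin: "Lnorm M p1 u < \<infinity>" "Lnorm M p2 v < \<infinity>"
  shows "Lnorm M p (\<lambda>x. u x * v x) \<le> Lnorm M p1 u * Lnorm M p2 v"
proof -
  have same: "p = p2" if "p1 = \<infinity>" "1 / p = 1 / p1 + 1 / p2" "1 \<le> p2" for p1 p2 :: ennreal
  proof -
    have "inverse p = inverse p2" using that by (simp add: divide_ennreal_def)
    then show ?thesis using \<open>1 \<le> p2\<close> p
      by (cases p rule: ennreal_cases; cases p2 rule: ennreal_cases) (auto simp: inverse_ennreal)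
  qed
  have infty: "Lnorm M p (\<lambda>x. u x * v x) \<le> esssup M u * Lnorm M p v"
    if [measurable]: "u \<in> borel_measurable M" "v \<in> borel_measurable M" for u v
  proof -
    have "Lnorm M p (\<lambda>x. u x * v x) \<le> Lnorm M p (\<lambda>x. esssup M u * v x)"
      using esssup_AE[of u M] p
      by (intro Lnorm_mono_AE) (auto elim!: eventually_mono intro: mult_right_mono)
    also have "\<dots> \<le> esssup M u * Lnorm M p v"
      using p by (intro Lnorm_cmult_le) auto
    finally show ?thesis .
  qed
  consider "p1 = \<infinity>" | "p2 = \<infinity>" | "p1 \<noteq> \<infinity>" "p2 \<noteq> \<infinity>" by blast
  then show ?thesis
  proof cases
    case 1
    then show ?thesis using infty[of u v] same[of p1 p2] eq p2 by (auto simp: Lnorm_def)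
  next
    case 2
    then show ?thesis using infty[of v u] same[of p2 p1] eq p1
      by (auto simp: Lnorm_def add.commute mult.commute)
  next
    case 3
    have inv0: "inverse p1 \<noteq> 0" using 3 by simp
    \<comment> \<open>An infinite \<open>p\<close> would make \<open>1 / p\<close> zero although
      \<open>1 / p1\<close> is not.\<close>
    have "p \<noteq> \<infinity>"
      using eq inv0 by (auto simp: divide_ennreal_def)
    define r r1 r2 where "r = enn2real p" and "r1 = enn2real p1" and "r2 = enn2real p2"
    have r: "1 \<le> r" "1 \<le> r1" "1 \<le> r2"
      using p p1 p2 3 \<open>p \<noteq> \<infinity>\<close> by (auto simp: r_def r1_def r2_def intro: enn2real_ge_1)
    have "p = ennreal r" "p1 = ennreal r1" "p2 = ennreal r2"
      using 3 \<open>p \<noteq> \<infinity>\<close> by (auto simp: r_def r1_def r2_def less_top)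
    then have "ennreal (1 / r) = ennreal (1 / r1 + 1 / r2)"
      using eq r by (simp add: divide_ennreal flip: ennreal_1)
    then have conj: "1 / r = 1 / r1 + 1 / r2"
      using r by (subst (asm) ennreal_inj) auto
    \<comment> \<open>Weights for Young's inequality: they sum to one by the relation between the
      exponents, and they turn the powers \<open>r1\<close> and \<open>r2\<close> into the common
      power \<open>r\<close>.\<close>
    define \<alpha> \<beta> where "\<alpha> = r / r1" and "\<beta> = r / r2"
    have ab: "0 < \<alpha>" "0 < \<beta>" "\<alpha> + \<beta> = 1" "r1 * \<alpha> = r" "r2 * \<beta> = r"
      using r conj by (auto simp: \<alpha>_def \<beta>_def field_simps)
    have Young: "ennreal_powr (x * y) r \<le> ennreal \<alpha> * ennreal_powr x r1 + ennreal \<beta> * ennreal_powr y r2" for x y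
    proof (cases "x = 0 \<or> y = 0 \<or> x = \<infinity> \<or> y = \<infinity>")
      case True
      then show ?thesis using ab r by (auto simp: ennreal_mult_top)
    next
      case False
      then obtain a b where xy: "x = ennreal a" "y = ennreal b" "0 < a" "0 < b"
        by (cases x rule: ennreal_cases; cases y rule: ennreal_cases) (auto simp: order_less_le)
      have "(a powr r1) powr \<alpha> * (b powr r2) powr \<beta> \<le> \<alpha> * a powr r1 + \<beta> * b powr r2"
        using ab xy by (intro Youngs_inequality_0) auto
      then have "(a * b) powr r \<le> \<alpha> * a powr r1 + \<beta> * b powr r2"
        using xy ab by (simp add: powr_powr powr_mult)
      then have "ennreal ((a * b) powr r) \<le> ennreal (\<alpha> * a powr r1 + \<beta> * b powr r2)"
        by (rule ennreal_leI)
      then show ?thesis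
        using xy ab by (simp add: ennreal_mult flip: ennreal_mult)
    qed
    have zero: "Lnorm M p (\<lambda>x. u x * v x) = 0" if "AE x in M. u x * v x = 0"
    proof -
      have "Lnorm M p (\<lambda>x. u x * v x) = Lnorm M p (\<lambda>x. 0)"
        using that by (intro Lnorm_cong_AE) auto
      also have "\<dots> = 0" using \<open>p \<noteq> \<infinity>\<close> by (simp add: Lnorm_def)
      finally show ?thesis .
    qed
    show ?thesis
    proof (cases "Lnorm M p1 u = 0 \<or> Lnorm M p2 v = 0")
      case True
      then have "AE x in M. u x * v x = 0"
        using Lnorm_eq_0_AE[OF p1, of u M] Lnorm_eq_0_AE[OF p2, of v M]
        by (auto elim!: eventually_mono)
      then show ?thesis by (simp add: zero)
    next
      case False
      define A B where "A = Lnorm M p1 u" and "B = Lnorm M p2 v"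
      have AB: "A \<noteq> 0" "B \<noteq> 0" "A \<noteq> \<infinity>" "B \<noteq> \<infinity>"
        using False fin by (auto simp: A_def B_def)
      have inv: "inverse A * A = 1" "inverse B * B = 1" "A * inverse A = 1" "B * inverse B = 1"
        using AB ennreal_inverse_mult_self[of A] ennreal_inverse_mult_self[of B] by (simp_all add: mult.commute)
      have norm_le_1: "(\<integral>\<^sup>+x. ennreal_powr (inverse a * f x) t \<partial>M) \<le> 1"
        if t: "1 \<le> t" "t = enn2real P" "P \<noteq> \<infinity>" and a: "a = Lnorm M P f" "inverse a * a = 1"
          and [measurable]: "f \<in> borel_measurable M" for a f t P
      proof -
        have "1 \<le> P" using t by (cases P rule: ennreal_cases) auto
        then have "Lnorm M P (\<lambda>x. inverse a * f x) \<le> 1"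
          using Lnorm_cmult_le[of P f M "inverse a"] a by simp
        then have "ennreal_powr (\<integral>\<^sup>+x. ennreal_powr (inverse a * f x) t \<partial>M) (1 / t) \<le> ennreal_powr 1 (1 / t)"
          using t by (simp add: Lnorm_def)
        then show ?thesis
          using t by (subst (asm) ennreal_powr_le_iff) auto
      qed
      have "(\<integral>\<^sup>+x. ennreal_powr ((inverse A * u x) * (inverse B * v x)) r \<partial>M)
          \<le> (\<integral>\<^sup>+x. ennreal \<alpha> * ennreal_powr (inverse A * u x) r1 + ennreal \<beta> * ennreal_powr (inverse B * v x) r2 \<partial>M)"
        by (intro nn_integral_mono Young)
      also have "\<dots> = ennreal \<alpha> * (\<integral>\<^sup>+x. ennreal_powr (inverse A * u x) r1 \<partial>M)
          + ennreal \<beta> * (\<integral>\<^sup>+x. ennreal_powr (inverse B * v x) r2 \<partial>M)"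
        by (simp add: nn_integral_add nn_integral_cmult)
      also have "\<dots> \<le> ennreal \<alpha> * 1 + ennreal \<beta> * 1"
        using 3 r inv
        by (intro add_mono mult_left_mono norm_le_1[OF _ r1_def] norm_le_1[OF _ r2_def]) (auto simp: A_def B_def)
      also have "\<dots> = 1" using ab by (simp flip: ennreal_plus)
      finally have "ennreal_powr (\<integral>\<^sup>+x. ennreal_powr ((inverse A * u x) * (inverse B * v x)) r \<partial>M) (1 / r) \<le> ennreal_powr 1 (1 / r)"
        using r by (intro ennreal_powr_mono) auto
      then have le1: "Lnorm M p (\<lambda>x. (inverse A * u x) * (inverse B * v x)) \<le> 1"
        using \<open>p \<noteq> \<infinity>\<close> by (simp add: Lnorm_def r_def)
      have "u x * v x = (A * inverse A) * (B * inverse B) * (u x * v x)" for x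
        by (simp add: inv)
      then have "u x * v x = (A * B) * ((inverse A * u x) * (inverse B * v x))" for x
        by (simp add: ac_simps)
      then have "Lnorm M p (\<lambda>x. u x * v x) = Lnorm M p (\<lambda>x. (A * B) * ((inverse A * u x) * (inverse B * v x)))"
        by presburger
      also have "\<dots> \<le> (A * B) * Lnorm M p (\<lambda>x. (inverse A * u x) * (inverse B * v x))"
        by (rule Lnorm_cmult_le[OF p]) measurable
      also have "\<dots> \<le> A * B * 1"
        by (intro mult_left_mono le1) auto
      finally show ?thesis by (simp add: A_def B_def)
    qed
  qed
qed

section \<open>Polynomial weights and approximate identities\<close>

definition wt :: "nat \<Rightarrow> 'a::real_normed_vector \<Rightarrow> real" where
  "wt m x = 1 / (1 + norm x) ^ m"

lemma one_plus_norm_pos [simp]: "0 < 1 + norm x" "0 \<le> 1 + norm x" "1 + norm x \<noteq> 0"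
  using norm_ge_zero[of x] by linarith+

lemma wt_pos [simp]: "0 < wt m x" "0 \<le> wt m x" "wt m x \<noteq> 0"
  by (auto simp: wt_def zero_less_divide_iff less_imp_neq)

lemma wt_le_1 [simp]: "wt m x \<le> 1"
  by (simp add: wt_def one_le_power)

lemma wt_add: "wt (m + k) x = wt m x * wt k x"
  by (simp add: wt_def power_add)

lemma wt_antimono: "m \<le> k \<Longrightarrow> wt k x \<le> wt m x"
  unfolding wt_def by (intro divide_left_mono power_increasing) auto

lemma measurable_wt [measurable]: "wt m \<in> borel_measurable borel"
  unfolding wt_def[abs_def] by measurable

text \<open>Peetre's inequality, from
  \<open>1 + norm x \<le> (1 + norm y) * (1 + norm (x - y))\<close>. It moves a weight centred at
  \<open>y\<close> to the origin at a polynomial cost in \<open>y\<close>, which the decay of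
  another factor then pays.\<close>

lemma wt_Peetre: "wt m (x - y) \<le> (1 + norm y) ^ m * wt m x"
proof -
  have "norm x \<le> norm (x - y) + norm y" by norm
  then have "1 + norm x \<le> (1 + norm y) * (1 + norm (x - y))"
    using mult_nonneg_nonneg[OF norm_ge_zero norm_ge_zero, of y "x - y"] unfolding ring_distribs by linarith
  then have "(1 + norm x) ^ m \<le> (1 + norm y) ^ m * (1 + norm (x - y)) ^ m"
    by (subst power_mult_distrib[symmetric], intro power_mono) auto
  then show ?thesis
    by (simp add: wt_def field_simps)
qed

lemma power_mult_wt: "(1 + norm x) ^ m * wt (m + k) x = wt k x"
  by (simp add: wt_add) (simp add: wt_def)

lemma set_integrable_UNIV_inverse_1_plus_square: "integrable lborel (\<lambda>x::real. inverse (1 + x\<^sup>2))"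
  using integrable_inverse_1_plus_square by (simp add: set_integrable_def)

text \<open>With twice the dimension as exponent there is a factor \<open>(1 + norm x)^2\<close> for
  each coordinate; it dominates \<open>1 + (x \<bullet> b)^2\<close>, so the integral is bounded by
  a product of one-dimensional integrals of \<open>1 / (1 + t^2)\<close>.\<close>

lemma integrable_wt:
  assumes "2 * DIM('a) \<le> m"
  shows "integrable lborel (wt m :: 'a::euclidean_space \<Rightarrow> real)"
proof (rule integrableI_bounded)
  let ?n = "DIM('a)"
  have le: "wt m x \<le> (\<Prod>b\<in>Basis. inverse (1 + (x \<bullet> b)\<^sup>2))" for x :: 'a
  proof -
    have "wt m x \<le> wt (2 * ?n) x" using assms by (rule wt_antimono)
    also have "\<dots> = (\<Prod>b\<in>(Basis::'a set). inverse ((1 + norm x)\<^sup>2))"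
      by (simp add: wt_def power_mult inverse_eq_divide power_divide)
    also have "\<dots> \<le> (\<Prod>b\<in>Basis. inverse (1 + (x \<bullet> b)\<^sup>2))"
    proof (intro prod_mono conjI le_imp_inverse_le)
      fix b :: 'a assume "b \<in> Basis"
      then have "\<bar>x \<bullet> b\<bar> \<le> norm x" by (rule Basis_le_norm)
      then have "(x \<bullet> b)\<^sup>2 \<le> (norm x)\<^sup>2" by (simp add: abs_le_square_iff[symmetric])
      then show "1 + (x \<bullet> b)\<^sup>2 \<le> (1 + norm x)\<^sup>2"
        using norm_ge_zero[of x] by (simp add: power2_sum del: norm_ge_zero)
    qed (auto simp: add_pos_nonneg)
    finally show ?thesis .
  qed
  have "(\<integral>\<^sup>+x. ennreal (norm (wt m x)) \<partial>(lborel :: 'a measure)) \<le> (\<integral>\<^sup>+x. (\<Prod>b\<in>Basis. ennreal (inverse (1 + (x \<bullet> b)\<^sup>2))) \<partial>(lborel :: 'a measure))"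
    using le by (intro nn_integral_mono) (auto simp: prod_ennreal intro!: ennreal_leI)
  also have "\<dots> = (\<Prod>b\<in>(Basis::'a set). \<integral>\<^sup>+x. ennreal (inverse (1 + x\<^sup>2)) \<partial>lborel)"
    by (rule nn_integral_lborel_prod[where f="\<lambda>b x. ennreal (inverse (1 + x\<^sup>2))"]) auto
  also have "\<dots> < \<infinity>"
    using set_integrable_UNIV_inverse_1_plus_square
    by (simp add: integrable_iff_bounded ennreal_prod_eq_top less_top[symmetric] del: prod_constant)
  finally show "(\<integral>\<^sup>+x. ennreal (norm (wt m x)) \<partial>(lborel :: 'a measure)) < \<infinity>" .
qed simp

text \<open>The kernel estimates below deliver majorants of product form, whose double integral
  factors by Tonelli; this is how they give access to Fubini's theorem.\<close>

lemma (in pair_sigma_finite) integrable_pair_bound: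
  fixes F :: "'a \<times> 'b \<Rightarrow> 'c::{banach, second_countable_topology}"
  assumes [measurable]: "F \<in> borel_measurable (M1 \<Otimes>\<^sub>M M2)"
    and g: "integrable M1 g" and h: "integrable M2 h"
    and le: "\<And>x y. norm (F (x, y)) \<le> g x * h y"
  shows "integrable (M1 \<Otimes>\<^sub>M M2) F"
proof (rule integrableI_bounded)
  note [measurable] = borel_measurable_integrable[OF g] borel_measurable_integrable[OF h]
  have "(\<integral>\<^sup>+z. ennreal (norm (F z)) \<partial>(M1 \<Otimes>\<^sub>M M2)) \<le> (\<integral>\<^sup>+z. ennreal (norm (g (fst z))) * ennreal (norm (h (snd z))) \<partial>(M1 \<Otimes>\<^sub>M M2))"
  proof (intro nn_integral_mono)
    fix z :: "'a \<times> 'b"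
    have "norm (F z) \<le> g (fst z) * h (snd z)" using le[of "fst z" "snd z"] by simp
    also have "\<dots> \<le> norm (g (fst z)) * norm (h (snd z))"
      by (metis abs_ge_self abs_mult real_norm_def)
    finally show "ennreal (norm (F z)) \<le> ennreal (norm (g (fst z))) * ennreal (norm (h (snd z)))"
      by (simp add: ennreal_leI flip: ennreal_mult)
  qed
  also have "\<dots> = (\<integral>\<^sup>+x. (\<integral>\<^sup>+y. ennreal (norm (g x)) * ennreal (norm (h y)) \<partial>M2) \<partial>M1)"
    by (subst M2.nn_integral_fst[symmetric]) auto
  also have "\<dots> = (\<integral>\<^sup>+x. ennreal (norm (g x)) \<partial>M1) * (\<integral>\<^sup>+y. ennreal (norm (h y)) \<partial>M2)"
    by (simp add: nn_integral_cmult nn_integral_multc)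
  also have "\<dots> < \<infinity>"
    using g h by (simp add: integrable_iff_bounded ennreal_mult_less_top)
  finally show "(\<integral>\<^sup>+z. ennreal (norm (F z)) \<partial>(M1 \<Otimes>\<^sub>M M2)) < \<infinity>" .
qed simp

section \<open>Affine changes of variables and translation invariance\<close>

lemma nn_integral_affine_euclidean:
  fixes f :: "'a::euclidean_space \<Rightarrow> ennreal"
  assumes [measurable]: "f \<in> borel_measurable borel" and "c \<noteq> 0"
  shows "(\<integral>\<^sup>+x. f x \<partial>lborel) = ennreal (\<bar>c\<bar> ^ DIM('a)) * (\<integral>\<^sup>+x. f (t + c *\<^sub>R x) \<partial>lborel)"
  using assms
  by (subst lborel_affine[of c t]) (auto simp: nn_integral_density nn_integral_distr nn_integral_cmult)

lemma integral_affine_euclidean: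
  fixes f :: "'a::euclidean_space \<Rightarrow> 'b::{banach, second_countable_topology}"
  assumes [measurable]: "f \<in> borel_measurable borel" and "c \<noteq> 0"
  shows "(LINT x|lborel. f x) = \<bar>c\<bar> ^ DIM('a) *\<^sub>R (LINT x|lborel. f (t + c *\<^sub>R x))"
  using assms
  by (subst lborel_affine[of c t]) (auto simp: integral_density integral_distr)

lemma integrable_affine_euclidean:
  fixes f :: "'a::euclidean_space \<Rightarrow> 'b::{banach, second_countable_topology}"
  assumes f: "integrable lborel f" and "c \<noteq> 0"
  shows "integrable lborel (\<lambda>x. f (t + c *\<^sub>R x))"
proof (rule integrableI_bounded)
  note [measurable] = borel_measurable_integrable[OF f]
  show "(\<lambda>x. f (t + c *\<^sub>R x)) \<in> borel_measurable lborel" by measurable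
  have "ennreal (\<bar>c\<bar> ^ DIM('a)) * (\<integral>\<^sup>+x. ennreal (norm (f (t + c *\<^sub>R x))) \<partial>lborel) < \<infinity>"
    using f assms by (subst nn_integral_affine_euclidean[symmetric]) (auto simp: integrable_iff_bounded)
  then show "(\<integral>\<^sup>+x. ennreal (norm (f (t + c *\<^sub>R x))) \<partial>lborel) < \<infinity>"
    using assms by (auto simp: ennreal_mult_less_top)
qed

lemma Lnorm_shift:
  fixes u :: "'a::euclidean_space \<Rightarrow> ennreal"
  assumes [measurable]: "u \<in> borel_measurable borel"
  shows "Lnorm lborel p (\<lambda>x. u (x + z)) = Lnorm lborel p u"
proof -
  have d: "distr lborel borel ((+) z) = (lborel :: 'a measure)" by (rule lborel_distr_plus)
  have "esssup lborel (\<lambda>x. u (x + z)) = esssup lborel u"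
  proof -
    have ae: "(AE x in lborel. u x \<le> c) \<longleftrightarrow> (AE x in lborel. u (x + z) \<le> c)" for c
      by (subst d[symmetric], subst AE_distr_iff) (auto simp: add.commute)
    show ?thesis by (simp add: esssup_eq_AE ae)
  qed
  moreover have "(\<integral>\<^sup>+x. ennreal_powr (u (x + z)) r \<partial>lborel) = (\<integral>\<^sup>+x. ennreal_powr (u x) r \<partial>lborel)" for r
    using nn_integral_affine_euclidean[of "\<lambda>x. ennreal_powr (u x) r" 1 z] by (simp add: add.commute)
  ultimately show ?thesis by (simp add: Lnorm_def)
qed

text \<open>Boxes form an intersection-stable generator of the Borel sets, so vanishing of the
  integral passes from boxes to all Borel sets by a Dynkin induction. This is run inside one box at
  a time, because integrability is assumed only on boxes; countably many boxes exhaust the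
  space.\<close>

lemma AE_zero_boxes:
  fixes u :: "'a::euclidean_space \<Rightarrow> complex"
  assumes [measurable]: "u \<in> borel_measurable borel"
    and int: "\<And>a b. integrable lborel (\<lambda>x. indicator (box a b) x *\<^sub>R u x)"
    and 0: "\<And>a b. (LINT x|lborel. indicator (box a b) x *\<^sub>R u x) = 0"
  shows "AE x in lborel. u x = 0"
proof -
  have "AE x in lborel. indicator (box a b) x *\<^sub>R u x = 0" for a b
  proof (rule sigma_finite_measure.density_unique_banach[OF lborel.sigma_finite_measure_axioms])
    let ?v = "\<lambda>x. indicator (box a b) x *\<^sub>R u x"
    let ?E = "range (\<lambda>(a, b). box a b :: 'a set)"
    show v: "integrable lborel ?v" by (rule int)
    show "integrable lborel (\<lambda>x. 0 :: complex)" by simp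
    fix A :: "'a set" assume "A \<in> sets lborel"
    then have A: "A \<in> sigma_sets UNIV ?E" by (simp add: borel_eq_box)
    have sets: "sigma_sets UNIV ?E = sets borel" by (simp add: borel_eq_box)
    have set_int: "set_integrable lborel B ?v" if "B \<in> sets borel" for B
      using v that unfolding set_integrable_def by (rule_tac integrable_mult_indicator) simp_all
    have "Int_stable ?E" by (auto simp: Int_stable_def box_Int_box)
    moreover have "?E \<subseteq> Pow UNIV" by auto
    ultimately have "(LINT x:A|lborel. ?v x) = 0"
      using A
    proof (induction rule: sigma_sets_induct_disjoint)
      case (basic A)
      then obtain c d where A: "A = box c d" by auto
      obtain e f where "box c d \<inter> box a b = box e f" using box_Int_box by blast
      then have "(\<lambda>x. indicator A x *\<^sub>R ?v x) = (\<lambda>x. indicator (box e f) x *\<^sub>R u x)"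
        unfolding A by (auto simp: fun_eq_iff indicator_def split: if_splits)
      then show ?case using 0 by (simp add: set_lebesgue_integral_def)
    next
      case empty
      show ?case by (simp add: set_lebesgue_integral_def)
    next
      case (compl A)
      then have A: "A \<in> sets borel" by (simp add: sets)
      have "(\<lambda>x. indicator (UNIV - A) x *\<^sub>R ?v x) = (\<lambda>x. ?v x - indicator A x *\<^sub>R ?v x)"
        by (auto simp: fun_eq_iff split: split_indicator)
      then have "(LINT x:(UNIV - A)|lborel. ?v x) = (LINT x|lborel. ?v x) - (LINT x:A|lborel. ?v x)"
        using v set_int[OF A] unfolding set_lebesgue_integral_def set_integrable_def by simp
      then show ?case using compl 0 by simp
    next
      case (union A)
      then have A: "A i \<in> sets borel" for i by (auto simp: sets)
      then have "(LINT x:(\<Union>i. A i)|lborel. ?v x) = (\<Sum>i. (LINT x:(A i)|lborel. ?v x))"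
        using union by (intro lebesgue_integral_countable_add set_int) (auto simp: disjoint_family_on_def)
      then show ?case using union by simp
    qed
    then show "(LINT x:A|lborel. ?v x) = (LINT x:A|lborel. 0)" by (simp add: set_lebesgue_integral_def)
  qed
  then have "AE x in lborel. \<forall>n::nat. indicator (box (- real n *\<^sub>R One) (real n *\<^sub>R One)) x *\<^sub>R u x = 0"
    unfolding AE_all_countable by blast
  then show ?thesis
  proof eventually_elim
    case (elim x)
    have "x \<in> (\<Union>n. box (- real n *\<^sub>R One) (real n *\<^sub>R One))"
      using UN_box_eq_UNIV by auto
    then obtain n where "x \<in> box (- real n *\<^sub>R One) (real n *\<^sub>R One)" by auto
    then show ?case using elim[rule_format, of n] by simp
  qed
qed

text \<open>By Fubini \<open>u\<close> annihilates the smoothings of a test function by the dilates of \<open>K\<close>, and these converge to a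
  nonzero multiple of the test function.\<close>

lemma AE_zero_dilates:
  fixes u K :: "'a::euclidean_space \<Rightarrow> complex"
  defines "N \<equiv> 2 * DIM('a)"
  assumes [measurable]: "u \<in> borel_measurable borel" "K \<in> borel_measurable borel"
    and u: "integrable lborel (\<lambda>x. norm (u x) * wt N x)"
    and K: "\<And>x. norm (K x) \<le> C * wt (2 * N) x" and K0: "(LINT x|lborel. K x) \<noteq> 0"
    and 0: "\<And>b y. 1 \<le> b \<Longrightarrow> (LINT x|lborel. u x * K (b *\<^sub>R (x - y))) = 0"
  shows "AE x in lborel. u x = 0"
proof -
  have C: "0 \<le> C" using K[of 0] by (simp add: wt_def order_trans[OF norm_ge_zero])
  have wtN: "integrable lborel (wt N :: 'a \<Rightarrow> real)" "integrable lborel (wt (2 * N) :: 'a \<Rightarrow> real)"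
    by (auto intro!: integrable_wt simp: N_def)
  have intK: "integrable lborel K"
    by (rule Bochner_Integration.integrable_bound[of _ "\<lambda>x. C * wt (2 * N) x"])
       (use wtN K C in \<open>auto intro!: AE_I2 simp: abs_mult\<close>)
  \<comment> \<open>Decaying continuous \<open>h\<close> serve as test functions. The function
    \<open>F b\<close> below smooths \<open>h\<close> by the dilated kernel, scaled so as to
    converge to \<open>h\<close> times the integral of \<open>K\<close>.\<close>
  have test: "(LINT x|lborel. u x * complex_of_real (h x)) = 0"
    if h: "continuous_on UNIV h" and D: "\<And>x. \<bar>h x\<bar> \<le> D * wt (2 * N) x" for h :: "'a \<Rightarrow> real" and D
  proof -
    have [measurable]: "h \<in> borel_measurable borel"
      using h by (rule borel_measurable_continuous_onI)
    have D0: "0 \<le> D" using D[of 0] by (simp add: wt_def order_trans[OF abs_ge_zero])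
    define F where "F b x = (LINT t|lborel. complex_of_real (h (x - t /\<^sub>R b)) * K t)" for b x
    have zero: "(LINT x|lborel. u x * F b x) = 0" if b: "1 \<le> b" for b :: real
    proof -
      have inner: "(LINT y|lborel. complex_of_real (h y) * (u x * K (b *\<^sub>R (x - y))))
          = inverse b ^ DIM('a) *\<^sub>R (u x * F b x)" for x
      proof -
        have "(LINT y|lborel. complex_of_real (h y) * (u x * K (b *\<^sub>R (x - y))))
            = u x * (LINT y|lborel. complex_of_real (h y) * K (b *\<^sub>R (x - y)))"
          by (simp add: mult.left_commute)
        also have "(LINT y|lborel. complex_of_real (h y) * K (b *\<^sub>R (x - y)))
           = \<bar>- inverse b\<bar> ^ DIM('a) *\<^sub>R (LINT t|lborel. complex_of_real (h (x + (- inverse b) *\<^sub>R t)) * K (b *\<^sub>R (x - (x + (- inverse b) *\<^sub>R t))))"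
          using b by (intro integral_affine_euclidean) auto
        also have "\<dots> = inverse b ^ DIM('a) *\<^sub>R F b x"
          using b by (simp add: F_def)
        finally show ?thesis by simp
      qed
      \<comment> \<open>The decay of \<open>h\<close> has order \<open>2 * N\<close>: half of it
        pays the factor \<open>(1 + norm y) ^ N\<close> from Peetre's inequality, and the remaining
        \<open>wt N y\<close> is integrable.\<close>
      have "integrable (lborel \<Otimes>\<^sub>M lborel) (\<lambda>(y, x). complex_of_real (h y) * (u x * K (b *\<^sub>R (x - y))))"
      proof (rule lborel_pair.integrable_pair_bound)
        show "integrable lborel (\<lambda>y::'a. D * C * wt N y)" using wtN by auto
        show "integrable lborel (\<lambda>x. norm (u x) * wt N x)" by (rule u)
        fix y x :: 'a
        have "norm (x - y) \<le> norm (b *\<^sub>R (x - y))"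
          using b mult_right_mono[of 1 b "norm (x - y)"] by simp
        then have "wt (2 * N) (b *\<^sub>R (x - y)) \<le> wt (2 * N) (x - y)"
          unfolding wt_def by (intro divide_left_mono power_mono mult_pos_pos zero_less_power) (auto simp del: norm_scaleR)
        also have "\<dots> \<le> wt N (x - y)" by (rule wt_antimono) auto
        also have "\<dots> \<le> (1 + norm y) ^ N * wt N x" by (rule wt_Peetre)
        finally have "norm (K (b *\<^sub>R (x - y))) \<le> C * ((1 + norm y) ^ N * wt N x)"
          using C K[of "b *\<^sub>R (x - y)"] by (meson mult_left_mono order_trans)
        then have "\<bar>h y\<bar> * (norm (u x) * norm (K (b *\<^sub>R (x - y))))
            \<le> (D * wt (2 * N) y) * (norm (u x) * (C * ((1 + norm y) ^ N * wt N x)))"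
          using D[of y] D0 by (intro mult_mono) auto
        also have "\<dots> = D * C * ((1 + norm y) ^ N * wt (N + N) y) * (norm (u x) * wt N x)"
          by (simp add: mult_2)
        also have "\<dots> = D * C * wt N y * (norm (u x) * wt N x)"
          by (simp only: power_mult_wt)
        finally show "norm (case (y, x) of (y, x) \<Rightarrow> complex_of_real (h y) * (u x * K (b *\<^sub>R (x - y))))
            \<le> D * C * wt N y * (norm (u x) * wt N x)"
          by (simp add: norm_mult)
      qed measurable
      from lborel_pair.Fubini_integral[OF this]
      have "(LINT x|lborel. inverse b ^ DIM('a) *\<^sub>R (u x * F b x))
          = (LINT y|lborel. complex_of_real (h y) * (LINT x|lborel. u x * K (b *\<^sub>R (x - y))))"
        by (simp add: inner)
      also have "\<dots> = 0" using 0[OF b] by simp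
      finally show ?thesis using b by simp
    qed
    have F_lim: "(\<lambda>j. F (real (Suc j)) x) \<longlonglongrightarrow> complex_of_real (h x) * (LINT t|lborel. K t)" for x
    proof -
      have "(\<lambda>j. \<integral>t. complex_of_real (h (x - t /\<^sub>R real (Suc j))) * K t \<partial>lborel)
          \<longlonglongrightarrow> (LINT t|lborel. complex_of_real (h x) * K t)"
      proof (rule integral_dominated_convergence[where w="\<lambda>t. D * norm (K t)"])
        show "AE t in lborel. (\<lambda>j. complex_of_real (h (x - t /\<^sub>R real (Suc j))) * K t) \<longlonglongrightarrow> complex_of_real (h x) * K t"
        proof (rule AE_I2)
          fix t :: 'a
          have "(\<lambda>j. x - inverse (real (Suc j)) *\<^sub>R t) \<longlonglongrightarrow> x - 0 *\<^sub>R t"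
            by (intro tendsto_intros LIMSEQ_inverse_real_of_nat)
          then have "(\<lambda>j. h (x - t /\<^sub>R real (Suc j))) \<longlonglongrightarrow> h x"
            using h by (intro continuous_on_tendsto_compose[OF h]) auto
          then show "(\<lambda>j. complex_of_real (h (x - t /\<^sub>R real (Suc j))) * K t) \<longlonglongrightarrow> complex_of_real (h x) * K t"
            by (intro tendsto_intros)
        qed
        show "AE t in lborel. norm (complex_of_real (h (x - t /\<^sub>R real (Suc j))) * K t) \<le> D * norm (K t)" for j
        proof (rule AE_I2)
          fix t
          have "\<bar>h (x - t /\<^sub>R real (Suc j))\<bar> \<le> D * 1"
            using D D0 by (meson mult_left_mono order_trans wt_le_1)
          then show "norm (complex_of_real (h (x - t /\<^sub>R real (Suc j))) * K t) \<le> D * norm (K t)"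
            by (simp add: norm_mult mult_right_mono)
        qed
        show "integrable lborel (\<lambda>t. D * norm (K t))" using intK by simp
      qed measurable
      then show ?thesis by (simp add: F_def)
    qed
    \<comment> \<open>Uniform in \<open>j\<close>, as dominated convergence against \<open>u\<close>
      demands. The roles are reversed here: the decay of \<open>K\<close> pays the factor from
      Peetre's inequality and that of \<open>h\<close> supplies \<open>wt N x\<close>.\<close>
    have F_bound: "norm (F (real (Suc j)) x) \<le> (D * C * (\<integral>t. wt N t \<partial>(lborel::'a measure))) * wt N x" for j x
    proof -
      let ?b = "real (Suc j)"
      have "norm (F ?b x) \<le> (\<integral>t. D * C * wt N x * wt N t \<partial>(lborel :: 'a measure))"
        unfolding F_def
      proof (rule Bochner_Integration.integral_norm_bound_integral)
        show "integrable lborel (\<lambda>t::'a. D * C * wt N x * wt N t)" using wtN by simp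
        have bd: "norm (complex_of_real (h (x - t /\<^sub>R ?b)) * K t) \<le> D * C * wt N x * wt N t" for t
        proof -
          have "norm (t /\<^sub>R ?b) \<le> norm t" by (simp add: field_simps)
          then have "(1 + norm (t /\<^sub>R ?b)) ^ N \<le> (1 + norm t) ^ N"
            by (intro power_mono) auto
          then have "wt N (x - t /\<^sub>R ?b) \<le> (1 + norm t) ^ N * wt N x"
            using wt_Peetre[of N x "t /\<^sub>R ?b"] by (meson mult_right_mono order_trans wt_pos(2))
          moreover have "wt (2 * N) (x - t /\<^sub>R ?b) \<le> wt N (x - t /\<^sub>R ?b)"
            by (rule wt_antimono) auto
          ultimately have "D * wt (2 * N) (x - t /\<^sub>R ?b) \<le> D * ((1 + norm t) ^ N * wt N x)"
            using D0 by (intro mult_left_mono) auto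
          then have "\<bar>h (x - t /\<^sub>R ?b)\<bar> * norm (K t) \<le> (D * ((1 + norm t) ^ N * wt N x)) * (C * wt (2 * N) t)"
            using D[of "x - t /\<^sub>R ?b"] K[of t] D0 by (intro mult_mono) auto
          also have "\<dots> = D * C * wt N x * ((1 + norm t) ^ N * wt (N + N) t)" by (simp add: mult_2)
          also have "\<dots> = D * C * wt N x * wt N t" by (simp only: power_mult_wt)
          finally show ?thesis by (simp add: norm_mult)
        qed
        show "integrable lborel (\<lambda>t. complex_of_real (h (x - t /\<^sub>R ?b)) * K t)"
          by (rule Bochner_Integration.integrable_bound[of _ "\<lambda>t. D * C * wt N x * wt N t"])
             (use wtN bd D0 C in \<open>auto intro!: AE_I2 simp: abs_mult\<close>)
        show "norm (complex_of_real (h (x - t /\<^sub>R ?b)) * K t) \<le> D * C * wt N x * wt N t" for t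
          by (rule bd)
      qed
      then show ?thesis by (simp add: mult_ac)
    qed
    have "(\<lambda>j. \<integral>x. u x * F (real (Suc j)) x \<partial>lborel)
        \<longlonglongrightarrow> (LINT x|lborel. u x * (complex_of_real (h x) * (LINT t|lborel. K t)))"
    proof (rule integral_dominated_convergence[where w="\<lambda>x. (D * C * (\<integral>t. wt N t \<partial>(lborel::'a measure))) * (norm (u x) * wt N x)"])
      show "AE x in lborel. (\<lambda>j. u x * F (real (Suc j)) x) \<longlonglongrightarrow> u x * (complex_of_real (h x) * (LINT t|lborel. K t))"
        by (intro AE_I2 tendsto_intros F_lim)
      show "AE x in lborel. norm (u x * F (real (Suc j)) x) \<le> (D * C * (\<integral>t. wt N t \<partial>(lborel::'a measure))) * (norm (u x) * wt N x)" for j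
      proof (rule AE_I2)
        fix x
        have "norm (u x) * norm (F (real (Suc j)) x) \<le> norm (u x) * ((D * C * (\<integral>t. wt N t \<partial>(lborel::'a measure))) * wt N x)"
          by (intro mult_left_mono F_bound) auto
        then show "norm (u x * F (real (Suc j)) x) \<le> (D * C * (\<integral>t. wt N t \<partial>(lborel::'a measure))) * (norm (u x) * wt N x)"
          by (simp add: norm_mult mult_ac)
      qed
      show "integrable lborel (\<lambda>x. (D * C * (\<integral>t. wt N t \<partial>(lborel::'a measure))) * (norm (u x) * wt N x))"
        using u by simp
      show "(\<lambda>x. u x * F (real (Suc j)) x) \<in> borel_measurable lborel" for j
        unfolding F_def by measurable
    qed measurable
    moreover have "(LINT x|lborel. u x * F (real (Suc j)) x) = 0" for j
      by (rule zero) simp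
    ultimately have "(\<lambda>j::nat. 0) \<longlonglongrightarrow> (LINT x|lborel. u x * complex_of_real (h x)) * (LINT t|lborel. K t)"
      by (simp add: mult.assoc[symmetric])
    then have "(LINT x|lborel. u x * complex_of_real (h x)) * (LINT t|lborel. K t) = 0"
      by (simp add: LIMSEQ_const_iff)
    then show ?thesis using K0 by simp
  qed
  show ?thesis
  proof (rule AE_zero_boxes)
    fix a b :: 'a
    let ?U = "box a b"
    obtain R where R: "\<And>x. x \<in> ?U \<Longrightarrow> norm x \<le> R" "0 \<le> R"
      using bounded_box[of a b] unfolding bounded_pos by (metis less_imp_le)
    have wtR: "1 \<le> (1 + R) ^ m * wt m x" if "x \<in> ?U" for x m
    proof -
      have "(1 + norm x) ^ m \<le> (1 + R) ^ m" using R that by (intro power_mono) auto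
      then show ?thesis by (simp add: wt_def field_simps)
    qed
    have ind_le: "indicat_real ?U x \<le> (1 + R) ^ m * wt m x" for x m
      using wtR[of x m] R by (auto split: split_indicator)
    have u_ind: "integrable lborel (\<lambda>x. (1 + R) ^ N * (norm (u x) * wt N x))"
      using u by simp
    have bd: "norm (c *\<^sub>R u x) \<le> (1 + R) ^ N * (norm (u x) * wt N x)" if "\<bar>c\<bar> \<le> indicator ?U x" for c x
    proof -
      have "\<bar>c\<bar> * norm (u x) \<le> ((1 + R) ^ N * wt N x) * norm (u x)"
        using that ind_le[of x N] by (intro mult_right_mono) auto
      then show ?thesis by (simp add: mult_ac)
    qed
    show int: "integrable lborel (\<lambda>x. indicator ?U x *\<^sub>R u x)"
      by (rule Bochner_Integration.integrable_bound[OF u_ind]) 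
        (auto intro!: AE_I2 order_trans[OF bd] simp del: norm_scaleR)
    show "(LINT x|lborel. indicator ?U x *\<^sub>R u x) = 0"
    proof (cases "- ?U = {}")
      case True
      then have "?U = UNIV" by blast
      then show ?thesis using bounded_box[of a b] not_bounded_UNIV by metis
    next
      case False
      \<comment> \<open>Lipschitz cutoffs that increase to the indicator of the open box. The
        distance to the complement is meaningful because a bounded box has a nonempty
        complement.\<close>
      define h where "h j x = min 1 (real j * infdist x (- ?U))" for j :: nat and x
      have h_cont: "continuous_on UNIV (h j)" for j
        unfolding h_def by (intro continuous_intros)
      have h_bd: "\<bar>h j x\<bar> \<le> indicator ?U x" for j x
        using infdist_nonneg[of x "- ?U"] by (auto simp: h_def split: split_indicator)
      have z: "(LINT x|lborel. h j x *\<^sub>R u x) = 0" for j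
        using test[OF h_cont, of j "(1 + R) ^ (2 * N)"] order_trans[OF h_bd ind_le]
        by (simp add: scaleR_conv_of_real mult.commute)
      have [measurable]: "h j \<in> borel_measurable borel" for j
        using h_cont by (rule borel_measurable_continuous_onI)
      have "(\<lambda>j. \<integral>x. h j x *\<^sub>R u x \<partial>lborel) \<longlonglongrightarrow> (LINT x|lborel. indicator ?U x *\<^sub>R u x)"
      proof (rule integral_dominated_convergence[OF _ _ u_ind])
        show "AE x in lborel. (\<lambda>j. h j x *\<^sub>R u x) \<longlonglongrightarrow> indicator ?U x *\<^sub>R u x"
        proof (intro AE_I2 tendsto_intros)
          fix x
          show "(\<lambda>j. h j x) \<longlonglongrightarrow> indicator ?U x"
          proof (cases "x \<in> ?U")
            case True
            then have pos: "0 < infdist x (- ?U)"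
              using False by (intro infdist_pos_not_in_closed) auto
            then obtain j0 where j0: "1 < real j0 * infdist x (- ?U)"
              using ex_less_of_nat_mult by blast
            have "eventually (\<lambda>j. h j x = 1) sequentially"
              using eventually_ge_at_top[of j0]
            proof eventually_elim
              case (elim j)
              then have "real j0 * infdist x (- ?U) \<le> real j * infdist x (- ?U)"
                using pos by (intro mult_right_mono) auto
              with j0 show ?case by (simp add: h_def)
            qed
            then show ?thesis using True by (simp add: tendsto_eventually)
          next
            case False
            then show ?thesis by (simp add: h_def)
          qed
        qed
        show "AE x in lborel. norm (h j x *\<^sub>R u x) \<le> (1 + R) ^ N * (norm (u x) * wt N x)" for j
          by (intro AE_I2 bd h_bd)
      qed measurable
      then show ?thesis by (simp add: z LIMSEQ_const_iff)
    qed
  qed measurable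
qed

section \<open>The Gaussian and Fourier inversion\<close>

definition gaussian :: "'a::euclidean_space \<Rightarrow> real" where
  "gaussian x = exp (- (norm x)\<^sup>2 / 2)"

lemma measurable_gaussian [measurable]: "gaussian \<in> borel_measurable borel"
  unfolding gaussian_def[abs_def] by measurable

lemma gaussian_minus: "gaussian (- x) = gaussian x"
  by (simp add: gaussian_def)

lemma gaussian_bounds: "0 \<le> gaussian x" "gaussian x \<le> 1"
  by (auto simp: gaussian_def)

lemma cexp_gaussian_eq_prod:
  fixes x t :: "'a::euclidean_space"
  shows "exp (\<i> * of_real (x \<bullet> t)) * complex_of_real (gaussian x)
    = (\<Prod>b\<in>Basis. exp (\<i> * of_real ((x \<bullet> b) * (t \<bullet> b))) * complex_of_real (exp (- (x \<bullet> b)\<^sup>2 / 2)))"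
proof -
  have "(norm x)\<^sup>2 = (\<Sum>b\<in>Basis. (x \<bullet> b)\<^sup>2)"
    by (simp add: norm_eq_sqrt_inner euclidean_inner[of x x] power2_eq_square sum_nonneg)
  then have "gaussian x = (\<Prod>b\<in>Basis. exp (- (x \<bullet> b)\<^sup>2 / 2))"
    by (simp add: gaussian_def exp_sum[symmetric] sum_negf sum_divide_distrib)
  moreover have "exp (\<i> * of_real (x \<bullet> t)) = (\<Prod>b\<in>Basis. exp (\<i> * of_real ((x \<bullet> b) * (t \<bullet> b))))"
    by (simp add: euclidean_inner[of x t] exp_sum[symmetric] sum_distrib_left)
  ultimately show ?thesis by (simp add: prod.distrib)
qed

abbreviation nexp :: "real \<Rightarrow> complex" where
  "nexp x \<equiv> exp (- (\<i> * complex_of_real x))"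

text \<open>Up to the factor \<open>sqrt (2 * pi)\<close> this is the characteristic function of the
  standard normal distribution.\<close>

lemma gaussian_real_fourier:
  fixes t :: real
  shows "integrable lborel (\<lambda>x. iexp (x * t) * complex_of_real (exp (- x\<^sup>2 / 2)))" (is "integrable _ ?f")
    and "(LINT x|lborel. iexp (x * t) * complex_of_real (exp (- x\<^sup>2 / 2))) = complex_of_real (sqrt (2 * pi) * exp (- t\<^sup>2 / 2))"
proof -
  have f: "?f x = complex_of_real (sqrt (2 * pi)) * (std_normal_density x *\<^sub>R iexp (t * x))" for x
    by (simp add: std_normal_density_def scaleR_conv_of_real mult_ac)
  have i: "integrable lborel (\<lambda>x. std_normal_density x *\<^sub>R iexp (t * x))"
  proof (rule Bochner_Integration.integrable_bound[of _ std_normal_density])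
    show "integrable lborel std_normal_density" using integrable_std_normal_moment[of 0] by simp
    show "AE x in lborel. norm (std_normal_density x *\<^sub>R iexp (t * x)) \<le> norm (std_normal_density x)"
      by (auto intro!: AE_I2)
  qed measurable
  then show "integrable lborel ?f" unfolding f by (rule integrable_mult_right)
  have "char std_normal_distribution t = (LINT x|lborel. std_normal_density x *\<^sub>R iexp (t * x))"
    unfolding char_def by (subst integral_density) (auto simp: normal_density_nonneg)
  then show "(LINT x|lborel. ?f x) = complex_of_real (sqrt (2 * pi) * exp (- t\<^sup>2 / 2))"
    unfolding f integral_mult_right_zero by (simp add: char_std_normal_distribution)
qed

text \<open>\<open>lborel\<close> is the image of a product of one-dimensional Lebesgue measures,
  and the integrand splits over the basis, so the integral is a product of one-dimensional
  ones.\<close>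

lemma gaussian_fourier:
  fixes t :: "'a::euclidean_space"
  shows "integrable lborel (\<lambda>x. iexp (x \<bullet> t) * complex_of_real (gaussian x))" (is "integrable _ ?f")
    and "(LINT x|lborel. iexp (x \<bullet> t) * complex_of_real (gaussian x))
      = complex_of_real (sqrt (2 * pi) ^ DIM('a) * gaussian t)"
proof -
  interpret product_sigma_finite "\<lambda>_::'a. lborel :: real measure" ..
  let ?g = "\<lambda>b x. iexp (x * (t \<bullet> b)) * complex_of_real (exp (- x\<^sup>2 / 2))"
  have f: "?f (\<Sum>b\<in>Basis. z b *\<^sub>R b) = (\<Prod>b\<in>Basis. ?g b (z b))" for z
    unfolding cexp_gaussian_eq_prod by (intro prod.cong) (auto simp: inner_sum_left inner_Basis if_distrib cong: if_cong)
  have [measurable]: "?f \<in> borel_measurable borel" by measurable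
  show "integrable lborel ?f"
    unfolding lborel_eq[where 'a='a]
    by (subst integrable_distr_eq) (simp, simp, unfold f, intro product_integrable_prod gaussian_real_fourier finite_Basis)
  have "(LINT x|lborel. ?f x) = (\<integral>z. (\<Prod>b\<in>Basis. ?g b (z b)) \<partial>(\<Pi>\<^sub>M b\<in>Basis. lborel))"
    unfolding lborel_eq[where 'a='a] by (subst integral_distr) (simp, simp, unfold f, rule refl)
  also have "\<dots> = (\<Prod>b\<in>(Basis::'a set). complex_of_real (sqrt (2 * pi) * exp (- (t \<bullet> b)\<^sup>2 / 2)))"
    by (subst product_integral_prod[OF finite_Basis gaussian_real_fourier(1)]) (simp only: gaussian_real_fourier(2))
  also have "\<dots> = complex_of_real (sqrt (2 * pi) ^ DIM('a) * (\<Prod>b\<in>(Basis::'a set). exp (- (t \<bullet> b)\<^sup>2 / 2)))"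
    by (simp add: prod.distrib)
  also have "(\<Prod>b\<in>(Basis::'a set). exp (- (t \<bullet> b)\<^sup>2 / 2)) = gaussian t"
    using cexp_gaussian_eq_prod[of t 0] by (simp del: of_real_exp flip: of_real_prod)
  finally show "(LINT x|lborel. ?f x) = complex_of_real (sqrt (2 * pi) ^ DIM('a) * gaussian t)" .
qed

lemma integrable_gaussian: "integrable lborel (gaussian :: 'a::euclidean_space \<Rightarrow> real)"
  and integral_gaussian: "(\<integral>x. gaussian x \<partial>(lborel :: 'a measure)) = sqrt (2 * pi) ^ DIM('a)"
proof -
  have "integrable lborel (\<lambda>x::'a. complex_of_real (gaussian x))"
    using gaussian_fourier(1)[of 0] by simp
  then show "integrable lborel (gaussian :: 'a \<Rightarrow> real)" by (simp add: complex_of_real_integrable_eq)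
  have "complex_of_real (\<integral>x. gaussian x \<partial>(lborel :: 'a measure)) = complex_of_real (sqrt (2 * pi) ^ DIM('a))"
    using gaussian_fourier(2)[of "0::'a"] by (simp add: gaussian_def)
  then show "(\<integral>x. gaussian x \<partial>(lborel :: 'a measure)) = sqrt (2 * pi) ^ DIM('a)"
    by (simp only: of_real_eq_iff)
qed

lemma sqrt_two_pi_power: "sqrt (2 * pi) ^ n * sqrt (2 * pi) ^ n = (2 * pi) ^ n"
  by (subst power_mult_distrib[symmetric]) simp

lemma norm_cexp_i [simp]: "norm (exp (\<i> * complex_of_real x)) = 1" "norm (exp (- (\<i> * complex_of_real x))) = 1"
  using norm_exp_i_times[of x] norm_exp_i_times[of "-x"] by auto

text \<open>The factor \<open>gaussian (e j *\<^sub>R z)\<close> makes Fubini applicable. Exchanging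
  the integrals and transforming the Gaussian yields an average of \<open>\<sigma>\<close> around
  \<open>\<xi>\<close> at scale \<open>e j\<close>. As \<open>e j\<close> tends to 0 both sides
  converge, one by integrability of \<open>K\<close>, the other by continuity and boundedness of
  \<open>\<sigma>\<close>.\<close>

lemma fourier_inversion:
  fixes \<sigma> K :: "'a::euclidean_space \<Rightarrow> complex"
  assumes K_def: "\<And>z. K z = (LINT \<eta>|lborel. \<sigma> \<eta> * nexp (z \<bullet> \<eta>)) / of_real ((2 * pi) ^ DIM('a))"
    and \<sigma>: "continuous_on UNIV \<sigma>" "integrable lborel \<sigma>" and B: "\<And>x. norm (\<sigma> x) \<le> B"
    and K: "integrable lborel K"
  shows "(LINT z|lborel. K z * iexp (z \<bullet> \<xi>)) = \<sigma> \<xi>"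
proof -
  let ?n = "DIM('a)"
  have [measurable]: "\<sigma> \<in> borel_measurable borel" "K \<in> borel_measurable borel"
    using \<sigma> K by auto
  define e where "e j = inverse (real (Suc j))" for j
  have e0: "e j > 0" "e j \<noteq> 0" for j by (auto simp: e_def)
  have e_lim: "e \<longlonglongrightarrow> 0" unfolding e_def by (rule LIMSEQ_inverse_real_of_nat)
  have "(\<lambda>j. \<integral>z. K z * iexp (z \<bullet> \<xi>) * of_real (gaussian (e j *\<^sub>R z)) \<partial>lborel)
      \<longlonglongrightarrow> (LINT z|lborel. K z * iexp (z \<bullet> \<xi>) * of_real (gaussian (0 *\<^sub>R z)))"
  proof (rule integral_dominated_convergence[where w="\<lambda>z. norm (K z)"])
    show "AE z in lborel. (\<lambda>j. K z * iexp (z \<bullet> \<xi>) * of_real (gaussian (e j *\<^sub>R z)))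
        \<longlonglongrightarrow> K z * iexp (z \<bullet> \<xi>) * of_real (gaussian (0 *\<^sub>R z))"
      unfolding gaussian_def by (intro AE_I2 tendsto_intros e_lim) auto
    show "AE z in lborel. norm (K z * iexp (z \<bullet> \<xi>) * of_real (gaussian (e j *\<^sub>R z))) \<le> norm (K z)" for j
      by (intro AE_I2) (auto simp: norm_mult gaussian_bounds mult_left_le)
  qed (use K in auto)
  then have 1: "(\<lambda>j. \<integral>z. K z * iexp (z \<bullet> \<xi>) * of_real (gaussian (e j *\<^sub>R z)) \<partial>lborel)
      \<longlonglongrightarrow> (LINT z|lborel. K z * iexp (z \<bullet> \<xi>))"
    by (simp add: gaussian_def)
  have "(\<lambda>j. \<integral>t. \<sigma> (\<xi> + e j *\<^sub>R t) * of_real (gaussian t) \<partial>lborel) \<longlonglongrightarrow> (\<integral>t. \<sigma> \<xi> * of_real (gaussian t) \<partial>(lborel :: 'a measure))"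
  proof (rule integral_dominated_convergence[where w="\<lambda>t. B * gaussian t"])
    show "AE t in lborel. (\<lambda>j. \<sigma> (\<xi> + e j *\<^sub>R t) * of_real (gaussian t)) \<longlonglongrightarrow> \<sigma> \<xi> * of_real (gaussian t)"
    proof (rule AE_I2)
      fix t
      have "(\<lambda>j. \<xi> + e j *\<^sub>R t) \<longlonglongrightarrow> \<xi> + 0 *\<^sub>R t" by (intro tendsto_intros e_lim)
      then show "(\<lambda>j. \<sigma> (\<xi> + e j *\<^sub>R t) * of_real (gaussian t)) \<longlonglongrightarrow> \<sigma> \<xi> * of_real (gaussian t)"
        by (intro tendsto_intros continuous_on_tendsto_compose[OF \<sigma>(1)]) auto
    qed
    show "AE t in lborel. norm (\<sigma> (\<xi> + e j *\<^sub>R t) * of_real (gaussian t)) \<le> B * gaussian t" for j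
      by (intro AE_I2) (auto simp: norm_mult gaussian_bounds B intro: mult_right_mono)
  qed (use integrable_gaussian in auto)
  also have "(\<integral>t. \<sigma> \<xi> * of_real (gaussian t) \<partial>(lborel :: 'a measure)) = \<sigma> \<xi> * of_real (sqrt (2 * pi) ^ ?n)"
    by (simp add: integral_gaussian)
  finally have 2: "(\<lambda>j. \<integral>t. \<sigma> (\<xi> + e j *\<^sub>R t) * of_real (gaussian t) \<partial>lborel) \<longlonglongrightarrow> \<sigma> \<xi> * of_real (sqrt (2 * pi) ^ ?n)" .
  have eq: "(LINT z|lborel. K z * iexp (z \<bullet> \<xi>) * of_real (gaussian (e j *\<^sub>R z)))
      = (LINT t|lborel. \<sigma> (\<xi> + e j *\<^sub>R t) * of_real (gaussian t)) / of_real (sqrt (2 * pi) ^ ?n)" for j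
  proof -
    let ?e = "e j"
    let ?F = "\<lambda>z \<eta>. \<sigma> \<eta> * iexp (z \<bullet> (\<xi> - \<eta>)) * of_real (gaussian (?e *\<^sub>R z))"
    have gint: "integrable lborel (\<lambda>z::'a. gaussian (?e *\<^sub>R z))"
      using integrable_affine_euclidean[OF integrable_gaussian, of ?e 0] e0 by simp
    have int: "integrable (lborel \<Otimes>\<^sub>M lborel) (\<lambda>(z, \<eta>). ?F z \<eta>)"
      by (rule lborel_pair.integrable_pair_bound[OF _ gint integrable_norm[OF \<sigma>(2)]])
         (auto simp: norm_mult gaussian_bounds)
    \<comment> \<open>The factor \<open>inverse ?e ^ ?n\<close> cancels against the Jacobian of the
      substitution \<open>\<eta> = \<xi> + ?e *\<^sub>R t\<close> made below.\<close>
    have inner: "(LINT z|lborel. iexp (z \<bullet> t) * of_real (gaussian (?e *\<^sub>R z)))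
        = inverse ?e ^ ?n *\<^sub>R of_real (sqrt (2 * pi) ^ ?n * gaussian (inverse ?e *\<^sub>R t))" for t :: 'a
    proof -
      have "(LINT z|lborel. iexp (z \<bullet> t) * of_real (gaussian (?e *\<^sub>R z)))
        = \<bar>inverse ?e\<bar> ^ ?n *\<^sub>R (LINT z|lborel. iexp ((0 + inverse ?e *\<^sub>R z) \<bullet> t) * of_real (gaussian (?e *\<^sub>R (0 + inverse ?e *\<^sub>R z))))"
        using e0[of j] by (intro integral_affine_euclidean) auto
      also have "(\<lambda>z::'a. iexp ((0 + inverse ?e *\<^sub>R z) \<bullet> t) * complex_of_real (gaussian (?e *\<^sub>R (0 + inverse ?e *\<^sub>R z))))
         = (\<lambda>z. iexp (z \<bullet> (inverse ?e *\<^sub>R t)) * complex_of_real (gaussian z))"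
        using e0[of j] by (auto simp: fun_eq_iff)
      finally show ?thesis using e0[of j] unfolding gaussian_fourier by (simp only: abs_inverse abs_of_pos)
    qed
    have K_eq: "K z * iexp (z \<bullet> \<xi>) * of_real (gaussian (?e *\<^sub>R z)) = (LINT \<eta>|lborel. ?F z \<eta>) / of_real ((2 * pi) ^ ?n)" for z
    proof -
      have "?F z \<eta> = (\<sigma> \<eta> * nexp (z \<bullet> \<eta>)) * (iexp (z \<bullet> \<xi>) * of_real (gaussian (?e *\<^sub>R z)))" for \<eta>
        by (simp add: inner_diff_right algebra_simps exp_diff exp_minus divide_inverse)
      then show ?thesis unfolding K_def by (simp only: integral_mult_left_zero) (simp add: divide_inverse mult_ac)
    qed
    have "(LINT z|lborel. K z * iexp (z \<bullet> \<xi>) * of_real (gaussian (?e *\<^sub>R z)))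
        = (LINT z|lborel. (LINT \<eta>|lborel. ?F z \<eta>)) / of_real ((2 * pi) ^ ?n)"
      by (simp only: K_eq integral_divide_zero)
    also have "(LINT z|lborel. (LINT \<eta>|lborel. ?F z \<eta>)) = (LINT \<eta>|lborel. (LINT z|lborel. ?F z \<eta>))"
      using lborel_pair.Fubini_integral[OF int] by simp
    also have "\<dots> = (LINT \<eta>|lborel. \<sigma> \<eta> * (inverse ?e ^ ?n *\<^sub>R of_real (sqrt (2 * pi) ^ ?n * gaussian (inverse ?e *\<^sub>R (\<xi> - \<eta>)))))"
      by (simp only: mult.assoc integral_mult_right_zero inner)
    also have "\<dots> = \<bar>?e\<bar> ^ ?n *\<^sub>R (LINT t|lborel. \<sigma> (\<xi> + ?e *\<^sub>R t) * (inverse ?e ^ ?n *\<^sub>R of_real (sqrt (2 * pi) ^ ?n * gaussian (inverse ?e *\<^sub>R (\<xi> - (\<xi> + ?e *\<^sub>R t))))))"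
      using e0[of j] by (intro integral_affine_euclidean) auto
    also have "\<dots> = of_real (sqrt (2 * pi) ^ ?n) * (LINT t|lborel. \<sigma> (\<xi> + ?e *\<^sub>R t) * of_real (gaussian t))"
    proof -
      have "\<sigma> (\<xi> + ?e *\<^sub>R t) * (inverse ?e ^ ?n *\<^sub>R of_real (sqrt (2 * pi) ^ ?n * gaussian (inverse ?e *\<^sub>R (\<xi> - (\<xi> + ?e *\<^sub>R t)))))
        = of_real (inverse ?e ^ ?n * sqrt (2 * pi) ^ ?n) * (\<sigma> (\<xi> + ?e *\<^sub>R t) * of_real (gaussian t))" for t
        using e0[of j] by (simp add: gaussian_minus scaleR_conv_of_real)
      then show ?thesis
        using e0[of j] by (simp only: integral_mult_right_zero) (simp add: scaleR_conv_of_real power_inverse)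
    qed
    \<comment> \<open>Of the two factors \<open>sqrt (2 * pi) ^ ?n\<close> in
      \<open>(2 * pi) ^ ?n\<close>, the Gaussian transform cancels one; the other cancels in the
      limit against the integral of the Gaussian.\<close>
    finally show ?thesis
      unfolding sqrt_two_pi_power[of ?n, symmetric] of_real_mult by (simp del: of_real_power)
  qed
  have "(\<lambda>j. \<integral>z. K z * iexp (z \<bullet> \<xi>) * of_real (gaussian (e j *\<^sub>R z)) \<partial>lborel) \<longlonglongrightarrow>
     (\<sigma> \<xi> * of_real (sqrt (2 * pi) ^ ?n)) / of_real (sqrt (2 * pi) ^ ?n)"
    unfolding eq by (intro tendsto_intros 2) auto
  then have "(\<lambda>j. \<integral>z. K z * iexp (z \<bullet> \<xi>) * of_real (gaussian (e j *\<^sub>R z)) \<partial>lborel) \<longlonglongrightarrow> \<sigma> \<xi>"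
    by simp
  with 1 show ?thesis by (rule LIMSEQ_unique)
qed

section \<open>Smooth functions\<close>

lemma partial_deriv_eqI: "(f has_derivative f') (at x) \<Longrightarrow> partial_deriv i f x = f' (axis i 1)"
  unfolding partial_deriv_def using frechet_derivative_at by metis

text \<open>Smoothness by finite order, for inductions over products and inverses.
  \<open>Ck k\<close> says that the derivatives of order below \<open>k\<close> are differentiable,
  so continuity of the first derivatives comes from order 2. The derivative peeled off is the
  innermost one, whereas \<open>partial_derivs\<close> peels off the outermost.\<close>

fun Ck :: "nat \<Rightarrow> (real^'n::finite \<Rightarrow> real) \<Rightarrow> bool" where
  "Ck 0 f \<longleftrightarrow> True"
| "Ck (Suc k) f \<longleftrightarrow> f differentiable_on UNIV \<and> (\<forall>i. Ck k (partial_deriv i f))"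

lemma partial_derivs_append: "partial_derivs (is @ js) f = partial_derivs is (partial_derivs js f)"
  by (induction "is") auto

lemma Ck_iff: "Ck k f \<longleftrightarrow> (\<forall>is. length is < k \<longrightarrow> partial_derivs is f differentiable_on UNIV)"
proof (induction k arbitrary: f)
  case (Suc k)
  show ?case
  proof
    assume C: "Ck (Suc k) f"
    show "\<forall>is. length is < Suc k \<longrightarrow> partial_derivs is f differentiable_on UNIV"
    proof (intro allI impI)
      fix "is" :: "'a list" assume l: "length is < Suc k"
      show "partial_derivs is f differentiable_on UNIV"
      proof (cases "is" rule: rev_cases)
        case (snoc js i)
        then show ?thesis using C l Suc[of "partial_deriv i f"] by (simp add: partial_derivs_append)
      qed (use C in auto)
    qed
  next
    assume A: "\<forall>is. length is < Suc k \<longrightarrow> partial_derivs is f differentiable_on UNIV"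
    have "partial_derivs is (partial_deriv i f) differentiable_on UNIV" if "length is < k" for "is" i
      using A[rule_format, of "is @ [i]"] that by (simp add: partial_derivs_append)
    then show "Ck (Suc k) f" using A[rule_format, of "[]"] Suc by simp
  qed
qed simp

lemma smooth_iff_Ck: "smooth f \<longleftrightarrow> (\<forall>k. Ck k f)" for f :: "real^'n::finite \<Rightarrow> real"
  unfolding smooth_def Ck_iff by auto

lemma Ck_Suc_imp: "Ck (Suc k) f \<Longrightarrow> Ck k f"
  by (auto simp: Ck_iff)

lemma Ck_has_derivative: "Ck (Suc k) f \<Longrightarrow> (f has_derivative frechet_derivative f (at x)) (at x)"
  by (auto simp: differentiable_on_def frechet_derivative_works)

lemma partial_deriv_mult:
  fixes f g :: "real^'n::finite \<Rightarrow> real"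
  assumes "f differentiable (at x)" "g differentiable (at x)"
  shows "partial_deriv i (\<lambda>x. f x * g x) x = partial_deriv i f x * g x + f x * partial_deriv i g x"
proof -
  have "((\<lambda>x. f x * g x) has_derivative (\<lambda>h. f x * frechet_derivative g (at x) h + frechet_derivative f (at x) h * g x)) (at x)"
    using assms by (intro has_derivative_mult) (auto simp: frechet_derivative_works)
  from partial_deriv_eqI[OF this] show ?thesis by (simp add: partial_deriv_def)
qed

lemma partial_deriv_add:
  fixes f g :: "real^'n::finite \<Rightarrow> real"
  assumes "f differentiable (at x)" "g differentiable (at x)"
  shows "partial_deriv i (\<lambda>x. f x + g x) x = partial_deriv i f x + partial_deriv i g x"
proof -
  have "((\<lambda>x. f x + g x) has_derivative (\<lambda>h. frechet_derivative f (at x) h + frechet_derivative g (at x) h)) (at x)"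
    using assms by (intro has_derivative_add) (auto simp: frechet_derivative_works)
  from partial_deriv_eqI[OF this] show ?thesis by (simp add: partial_deriv_def)
qed

text \<open>The right-hand side uses only products and a constant, so that \<open>Ck_mult\<close>,
  \<open>Ck_const\<close> and the induction hypothesis for the inverse close the induction in
  \<open>Ck_inverse\<close>.\<close>

lemma partial_deriv_inverse:
  fixes f :: "real^'n::finite \<Rightarrow> real"
  assumes "f differentiable (at x)" "f x \<noteq> 0"
  shows "partial_deriv i (\<lambda>x. inverse (f x)) x = (- 1) * (partial_deriv i f x * (inverse (f x) * inverse (f x)))"
proof -
  have "((\<lambda>x. inverse (f x)) has_derivative (\<lambda>h. - (inverse (f x) * frechet_derivative f (at x) h * inverse (f x)))) (at x)"
    using assms by (intro Deriv.has_derivative_inverse) (auto simp: frechet_derivative_works)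
  from partial_deriv_eqI[OF this] show ?thesis by (simp add: partial_deriv_def)
qed

lemma has_derivative_affine:
  fixes f :: "real^'n::finite \<Rightarrow> real"
  assumes "f differentiable (at (b *\<^sub>R (x - y)))"
  shows "((\<lambda>x. f (b *\<^sub>R (x - y))) has_derivative (\<lambda>h. frechet_derivative f (at (b *\<^sub>R (x - y))) (b *\<^sub>R h))) (at x)"
proof (rule has_derivative_compose[of "\<lambda>x. b *\<^sub>R (x - y)" _ x UNIV f])
  show "(f has_derivative frechet_derivative f (at (b *\<^sub>R (x - y)))) (at (b *\<^sub>R (x - y)))"
    using assms by (simp add: frechet_derivative_works)
qed (auto intro!: derivative_eq_intros)

lemma partial_deriv_affine:
  fixes f :: "real^'n::finite \<Rightarrow> real"
  assumes f: "f differentiable (at (b *\<^sub>R (x - y)))"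
  shows "partial_deriv i (\<lambda>x. f (b *\<^sub>R (x - y))) x = b * partial_deriv i f (b *\<^sub>R (x - y))"
  using partial_deriv_eqI[OF has_derivative_affine[OF f]] linear_frechet_derivative[OF f]
  by (simp add: partial_deriv_def linear_scale)

lemma partial_deriv_const: "partial_deriv i (\<lambda>x. c) = (\<lambda>x. 0)"
  by (rule ext) (rule partial_deriv_eqI[OF has_derivative_const])

lemma Ck_const: "Ck k (\<lambda>x. c)"
  by (induction k arbitrary: c) (auto simp: partial_deriv_const)

lemma Ck_add: "Ck k f \<Longrightarrow> Ck k g \<Longrightarrow> Ck k (\<lambda>x. f x + g x)"
proof (induction k arbitrary: f g)
  case (Suc k)
  then have "partial_deriv i (\<lambda>x. f x + g x) = (\<lambda>x. partial_deriv i f x + partial_deriv i g x)" for i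
    by (intro ext partial_deriv_add) (auto simp: differentiable_on_def)
  with Suc show ?case by (auto intro: differentiable_on_add)
qed simp

lemma Ck_mult: "Ck k f \<Longrightarrow> Ck k g \<Longrightarrow> Ck k (\<lambda>x. f x * g x)"
proof (induction k arbitrary: f g)
  case (Suc k)
  then have "partial_deriv i (\<lambda>x. f x * g x) = (\<lambda>x. partial_deriv i f x * g x + f x * partial_deriv i g x)" for i
    by (intro ext partial_deriv_mult) (auto simp: differentiable_on_def)
  with Suc show ?case
    using Ck_Suc_imp[of k f] Ck_Suc_imp[of k g] by (auto intro!: differentiable_on_mult Ck_add)
qed simp

lemma Ck_inverse: "(\<And>x. f x \<noteq> 0) \<Longrightarrow> Ck k f \<Longrightarrow> Ck k (\<lambda>x. inverse (f x))"
proof (induction k arbitrary: f)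
  case (Suc k)
  then have "partial_deriv i (\<lambda>x. inverse (f x)) = (\<lambda>x. (- 1) * (partial_deriv i f x * (inverse (f x) * inverse (f x))))" for i
    by (intro ext partial_deriv_inverse) (auto simp: differentiable_on_def)
  moreover have "(\<lambda>x. inverse (f x)) differentiable_on UNIV"
    using Suc by (auto simp: differentiable_on_def intro!: differentiable_inverse)
  moreover have "Ck k (\<lambda>x. (- 1) * (partial_deriv i f x * (inverse (f x) * inverse (f x))))" for i
    by (intro Ck_mult Ck_const) (use Suc Ck_Suc_imp[of k f] in auto)
  ultimately show ?case by simp
qed simp

lemma Ck_affine: "Ck k f \<Longrightarrow> Ck k (\<lambda>x. f (b *\<^sub>R (x - y)))"
proof (induction k arbitrary: f)
  case (Suc k)
  have d: "f differentiable (at x)" for x using Suc by (auto simp: differentiable_on_def)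
  then have "partial_deriv i (\<lambda>x. f (b *\<^sub>R (x - y))) = (\<lambda>x. b * partial_deriv i f (b *\<^sub>R (x - y)))" for i
    by (intro ext partial_deriv_affine)
  moreover have "(\<lambda>x. f (b *\<^sub>R (x - y))) differentiable_on UNIV"
    unfolding differentiable_on_def
    using has_derivative_affine[OF d] by (auto simp: differentiable_def)
  ultimately show ?case
    using Suc by (auto intro!: Ck_mult Ck_const)
qed simp

lemma Ck_sum: "finite A \<Longrightarrow> (\<And>a. a \<in> A \<Longrightarrow> Ck k (f a)) \<Longrightarrow> Ck k (\<lambda>x. \<Sum>a\<in>A. f a x)"
  by (induction rule: finite_induct) (auto intro: Ck_const Ck_add)

text \<open>The strict inequality describes an open set, on which \<open>f\<close> is the constant
  0. Compact support is expressed in this form from here on.\<close>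

lemma partial_deriv_vanish:
  fixes f :: "real^'n::finite \<Rightarrow> 'b::real_normed_vector"
  assumes f: "\<And>x. R < norm x \<Longrightarrow> f x = 0" and x: "R < norm x"
  shows "partial_deriv i f x = 0"
proof -
  have o: "open {x::real^'n. R < norm x}" by (intro open_Collect_less continuous_intros)
  have "(f has_derivative (\<lambda>h. 0)) (at x)"
    by (rule has_derivative_transform_within_open[OF has_derivative_const[of 0] o]) (use f x in auto)
  from partial_deriv_eqI[OF this] show ?thesis .
qed

lemma partial_derivs_vanish:
  "(\<And>x. R < norm x \<Longrightarrow> f x = 0) \<Longrightarrow> R < norm x \<Longrightarrow> partial_derivs is f x = 0"
  by (induction "is" arbitrary: x) (auto intro: partial_deriv_vanish)

lemma bounded_compact_support:
  fixes f :: "'a::euclidean_space \<Rightarrow> 'b::real_normed_vector"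
  assumes "continuous_on UNIV f" "\<And>x. R < norm x \<Longrightarrow> f x = 0"
  shows "bounded (range f)"
proof -
  have "bounded (f ` cball 0 R)"
    using assms by (intro compact_imp_bounded compact_continuous_image) (auto intro: continuous_on_subset)
  moreover have "f x \<in> f ` cball 0 R \<union> {0}" for x
    by (cases "norm x \<le> R") (use assms(2)[of x] in auto)
  then have "range f \<subseteq> f ` cball 0 R \<union> {0}" by blast
  ultimately show ?thesis by (metis bounded_Un bounded_insert bounded_empty bounded_subset)
qed

lemma partial_derivs_of_real:
  assumes "smooth g"
  shows "partial_derivs is (\<lambda>x. complex_of_real (g x)) = (\<lambda>x. complex_of_real (partial_derivs is g x))"
proof (induction "is")
  case (Cons i "is")
  have "partial_deriv i (\<lambda>x. complex_of_real (partial_derivs is g x)) x = complex_of_real (partial_deriv i (partial_derivs is g) x)" for x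
  proof -
    have "(partial_derivs is g has_derivative frechet_derivative (partial_derivs is g) (at x)) (at x)"
      using assms by (auto simp: smooth_def differentiable_on_def frechet_derivative_works)
    from partial_deriv_eqI[OF has_derivative_of_real[OF this]] show ?thesis by (simp add: partial_deriv_def)
  qed
  with Cons show ?case by auto
qed simp

lemma schwartz_compact_support:
  fixes g :: "real^'n::finite \<Rightarrow> real"
  assumes g: "smooth g" and R: "\<And>x. R < norm x \<Longrightarrow> g x = 0"
  shows "(\<lambda>x. complex_of_real (g x)) \<in> schwartz"
proof -
  have diff: "partial_derivs is g differentiable_on UNIV" for "is"
    using g by (auto simp: smooth_def)
  have "smooth (\<lambda>x. complex_of_real (g x))"
    unfolding smooth_def partial_derivs_of_real[OF g]
    using diff unfolding differentiable_on_def differentiable_def by (blast intro: has_derivative_of_real)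
  moreover have cont: "continuous_on UNIV (partial_derivs is g)" for "is"
    using diff by (rule differentiable_imp_continuous_on)
  have "bounded (range (\<lambda>x. (1 + norm x) ^ N *\<^sub>R partial_derivs is (\<lambda>x. complex_of_real (g x)) x))" for "is" N
    unfolding partial_derivs_of_real[OF g]
    by (rule bounded_compact_support[where R=R])
       (auto simp: partial_derivs_vanish[OF R] intro!: continuous_intros cont)
  ultimately show ?thesis by (simp add: schwartz_def)
qed

section \<open>Decay of Fourier integrals\<close>

lemma integrable_cexp_mult:
  fixes g :: "'a::euclidean_space \<Rightarrow> complex"
  assumes "integrable lborel g"
  shows "integrable lborel (\<lambda>\<eta>. g \<eta> * nexp (z \<bullet> \<eta>))"
  by (rule Bochner_Integration.integrable_bound[OF assms]) (use assms in \<open>auto simp: norm_mult\<close>)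

lemma integrable_compact_support:
  fixes f :: "'a::euclidean_space \<Rightarrow> 'b::{banach, second_countable_topology}"
  assumes "continuous_on UNIV f" "\<And>x. R < norm x \<Longrightarrow> f x = 0"
  shows "integrable lborel f"
proof -
  have "integrable lborel (\<lambda>x. indicator (cball 0 R) x *\<^sub>R f x)"
    using assms by (intro borel_integrable_compact) (auto intro: continuous_on_subset)
  also have "(\<lambda>x. indicator (cball 0 R) x *\<^sub>R f x) = f"
    using assms(2) by (auto simp: fun_eq_iff indicator_def not_le)
  finally show ?thesis .
qed

text \<open>Integration by parts through difference quotients: translating the integrand turns the
  quotient into the factor \<open>(exp (\<i> * z $ i * t) - 1) / t\<close>, which tends to
  \<open>\<i> * z $ i\<close>, while dominated convergence yields the derivative. Two orders of
  differentiability make the partial derivative continuous, hence bounded.\<close>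

lemma fourier_partial_deriv:
  fixes g :: "real^'n::finite \<Rightarrow> real"
  assumes g: "Ck (Suc (Suc k)) g" and R: "\<And>x. R < norm x \<Longrightarrow> g x = 0"
  shows "(LINT \<eta>|lborel. complex_of_real (partial_deriv i g \<eta>) * nexp (z \<bullet> \<eta>))
    = \<i> * of_real (z $ i) * (LINT \<eta>|lborel. complex_of_real (g \<eta>) * nexp (z \<bullet> \<eta>))"
proof -
  let ?e = "axis i 1 :: real^'n"
  let ?E = "\<lambda>\<eta>. nexp (z \<bullet> \<eta>)"
  let ?I = "\<integral>\<eta>. complex_of_real (g \<eta>) * ?E \<eta> \<partial>lborel"
  have gd: "(g has_derivative frechet_derivative g (at x)) (at x)" for x
    using g by (rule Ck_has_derivative)
  have gc: "continuous_on UNIV g"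
    using g by (auto intro: differentiable_imp_continuous_on)
  have pc: "continuous_on UNIV (partial_deriv i g)"
    using g by (auto intro: differentiable_imp_continuous_on)
  have [measurable]: "g \<in> borel_measurable borel" "partial_deriv i g \<in> borel_measurable borel"
    using gc pc by (auto intro: borel_measurable_continuous_onI)
  have gint: "integrable lborel (\<lambda>x. complex_of_real (g x))"
    using integrable_compact_support[OF gc R] by simp
  obtain M where M: "\<And>x. \<bar>partial_deriv i g x\<bar> \<le> M" "0 < M"
    using bounded_compact_support[OF pc, of R] partial_deriv_vanish[of R g _ i] R unfolding bounded_pos by auto
  have dir: "((\<lambda>t. g (x + t *\<^sub>R ?e)) has_real_derivative partial_deriv i g (x + t *\<^sub>R ?e)) (at t)" for x t
  proof -
    have "((\<lambda>t. g (x + t *\<^sub>R ?e)) has_derivative (\<lambda>h. frechet_derivative g (at (x + t *\<^sub>R ?e)) (h *\<^sub>R ?e))) (at t)"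
      by (rule has_derivative_compose[of "\<lambda>t. x + t *\<^sub>R ?e" _ t UNIV g, OF _ gd]) (auto intro!: derivative_eq_intros)
    moreover have "(\<lambda>h. frechet_derivative g (at (x + t *\<^sub>R ?e)) (h *\<^sub>R ?e)) = (\<lambda>h. partial_deriv i g (x + t *\<^sub>R ?e) * h)"
      using linear_scale[OF has_derivative_linear[OF gd]] by (auto simp: partial_deriv_def mult.commute)
    ultimately show ?thesis by (simp add: has_field_derivative_def)
  qed
  define t where "t j = inverse (real (Suc j))" for j
  have t: "0 < t j" "t j \<le> 1" for j by (auto simp: t_def field_simps)
  have t_lim: "t \<longlonglongrightarrow> 0" unfolding t_def by (rule LIMSEQ_inverse_real_of_nat)
  have t_at: "filterlim t (at 0) sequentially"
    using t_lim t(1) by (auto simp: filterlim_at intro!: always_eventually) (metis less_irrefl)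
  define q where "q j x = (g (x + t j *\<^sub>R ?e) - g x) / t j" for j x
  have q_lim: "(\<lambda>j. q j x) \<longlonglongrightarrow> partial_deriv i g x" for x
  proof -
    have "((\<lambda>h. (g (x + (0 + h) *\<^sub>R ?e) - g (x + 0 *\<^sub>R ?e)) / h) \<longlongrightarrow> partial_deriv i g (x + 0 *\<^sub>R ?e)) (at 0)"
      using dir[of x 0] by (simp add: DERIV_def)
    from filterlim_compose[OF this t_at] show ?thesis by (simp add: q_def)
  qed
  \<comment> \<open>The mean value theorem bounds the quotients; the radius grows by one because
    \<open>t j \<le> 1\<close>.\<close>
  have q_bd: "\<bar>q j x\<bar> \<le> M * indicator (cball 0 (R + 1)) x" for j x
  proof (cases "x \<in> cball 0 (R + 1)")
    case True
    obtain s where "0 < s" "s < t j" "g (x + t j *\<^sub>R ?e) - g (x + 0 *\<^sub>R ?e) = (t j - 0) * partial_deriv i g (x + s *\<^sub>R ?e)"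
      using MVT2[of 0 "t j" "\<lambda>t. g (x + t *\<^sub>R ?e)" "\<lambda>t. partial_deriv i g (x + t *\<^sub>R ?e)"] t dir by blast
    then have "q j x = partial_deriv i g (x + s *\<^sub>R ?e)"
      using t(1)[of j] by (simp add: q_def)
    then show ?thesis using M True by simp
  next
    case False
    then have "R + 1 < norm x" by simp
    moreover have "norm x \<le> norm (x + t j *\<^sub>R ?e) + norm (t j *\<^sub>R ?e)"
      using norm_triangle_ineq4[of "x + t j *\<^sub>R ?e" "t j *\<^sub>R ?e"] by simp
    moreover have "norm (t j *\<^sub>R ?e) \<le> 1" using t[of j] by (simp add: norm_axis_1)
    ultimately have "R < norm (x + t j *\<^sub>R ?e)" "R < norm x" by linarith+
    then show ?thesis using False by (simp add: q_def R)
  qed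
  have "(\<lambda>j. \<integral>\<eta>. complex_of_real (q j \<eta>) * ?E \<eta> \<partial>lborel)
      \<longlonglongrightarrow> (LINT \<eta>|lborel. complex_of_real (partial_deriv i g \<eta>) * ?E \<eta>)"
  proof (rule integral_dominated_convergence[where w="\<lambda>x. M * indicator (cball 0 (R + 1)) x"])
    show "AE x in lborel. (\<lambda>j. complex_of_real (q j x) * ?E x) \<longlonglongrightarrow> complex_of_real (partial_deriv i g x) * ?E x"
      by (intro AE_I2 tendsto_intros q_lim)
    show "AE x in lborel. norm (complex_of_real (q j x) * ?E x) \<le> M * indicator (cball 0 (R + 1)) x" for j
      using q_bd by (intro AE_I2) (simp add: norm_mult)
    show "integrable lborel (\<lambda>x::real^'n. M * indicator (cball 0 (R + 1)) x)"
      using emeasure_bounded_finite[OF bounded_cball, of "0::real^'n" "R + 1"]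
      by (auto intro!: integrable_mult_right integrable_real_indicator)
    show "(\<lambda>x. complex_of_real (q j x) * ?E x) \<in> borel_measurable lborel" for j
      unfolding q_def by measurable
  qed measurable
  moreover have "(LINT \<eta>|lborel. complex_of_real (q j \<eta>) * ?E \<eta>) = (exp (\<i> * of_real (z $ i) * of_real (t j)) - 1) / of_real (t j) * ?I" for j
  proof -
    have sh: "integrable lborel (\<lambda>x. complex_of_real (g (x + t j *\<^sub>R ?e)))"
      using integrable_affine_euclidean[OF gint, of 1 "t j *\<^sub>R ?e"] by (simp add: add.commute)
    have "(LINT \<eta>|lborel. complex_of_real (g \<eta>) * ?E \<eta>)
        = (LINT \<eta>|lborel. complex_of_real (g (\<eta> + t j *\<^sub>R ?e)) * ?E (\<eta> + t j *\<^sub>R ?e))"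
      by (subst integral_affine_euclidean[where c=1 and t="t j *\<^sub>R ?e"]) (auto simp: add.commute)
    also have "\<dots> = (LINT \<eta>|lborel. complex_of_real (g (\<eta> + t j *\<^sub>R ?e)) * ?E \<eta>) * exp (- (\<i> * of_real (z $ i) * of_real (t j)))"
    proof -
      have "?E (\<eta> + t j *\<^sub>R ?e) = ?E \<eta> * exp (- (\<i> * of_real (z $ i) * of_real (t j)))" for \<eta>
        by (simp add: inner_add_right inner_axis algebra_simps flip: exp_add)
      then show ?thesis by (simp only: mult.assoc[symmetric] integral_mult_left_zero)
    qed
    finally have *: "(LINT \<eta>|lborel. complex_of_real (g (\<eta> + t j *\<^sub>R ?e)) * ?E \<eta>) = exp (\<i> * of_real (z $ i) * of_real (t j)) * ?I"
      by (simp add: exp_minus field_simps)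
    have "complex_of_real (q j \<eta>) * ?E \<eta> = (complex_of_real (g (\<eta> + t j *\<^sub>R ?e)) * ?E \<eta> - complex_of_real (g \<eta>) * ?E \<eta>) / of_real (t j)" for \<eta>
      by (simp add: q_def left_diff_distrib diff_divide_distrib)
    then have "(LINT \<eta>|lborel. complex_of_real (q j \<eta>) * ?E \<eta>)
       = ((LINT \<eta>|lborel. complex_of_real (g (\<eta> + t j *\<^sub>R ?e)) * ?E \<eta>) - ?I) / of_real (t j)"
      using integrable_cexp_mult[OF gint] integrable_cexp_mult[OF sh] by simp
    then show ?thesis by (simp add: * left_diff_distrib diff_divide_distrib)
  qed
  moreover have "(\<lambda>j. (exp (\<i> * of_real (z $ i) * of_real (t j)) - 1) / of_real (t j) * ?I) \<longlonglongrightarrow> (\<i> * of_real (z $ i)) * ?I"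
  proof -
    have "((\<lambda>w. exp (\<i> * of_real (z $ i) * w)) has_field_derivative \<i> * of_real (z $ i)) (at 0)"
      by (auto intro!: derivative_eq_intros)
    then have d: "((\<lambda>h. (exp (\<i> * of_real (z $ i) * h) - 1) / h) \<longlongrightarrow> \<i> * of_real (z $ i)) (at 0)"
      by (simp add: DERIV_def)
    have "filterlim (\<lambda>j. complex_of_real (t j)) (at 0) sequentially"
      using tendsto_of_real[OF t_lim, where 'a=complex] t(1)
      by (auto simp: filterlim_at intro!: always_eventually) (metis less_irrefl)
    from filterlim_compose[OF d this] show ?thesis by (intro tendsto_intros) simp
  qed
  ultimately show ?thesis by (simp add: LIMSEQ_unique)
qed

text \<open>Each use of \<open>fourier_partial_deriv\<close> trades one derivative of
  \<open>g\<close> for one factor \<open>z $ i\<close>; the spare order in \<open>Suc k\<close>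
  keeps the smoothness hypothesis of that lemma satisfied.\<close>

lemma fourier_coordinate_decay:
  fixes g :: "real^'n::finite \<Rightarrow> real"
  assumes "Ck (Suc k) g" "\<And>x. R < norm x \<Longrightarrow> g x = 0"
  shows "\<exists>C. \<forall>z. \<bar>z $ i\<bar> ^ k * norm (LINT \<eta>|lborel. complex_of_real (g \<eta>) * nexp (z \<bullet> \<eta>)) \<le> C"
  using assms
proof (induction k arbitrary: g)
  case 0
  have "norm (LINT \<eta>|lborel. complex_of_real (g \<eta>) * nexp (z \<bullet> \<eta>)) \<le> (LINT \<eta>|lborel. norm (complex_of_real (g \<eta>) * nexp (z \<bullet> \<eta>)))" for z
    by (rule integral_norm_bound)
  then show ?case by (auto simp: norm_mult)
next
  case (Suc k)
  have "Ck (Suc k) (partial_deriv i g)" using Suc.prems by simp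
  moreover have "partial_deriv i g x = 0" if "R < norm x" for x
    using Suc.prems(2) that by (rule partial_deriv_vanish)
  ultimately obtain C where C: "\<And>z. \<bar>z $ i\<bar> ^ k * norm (LINT \<eta>|lborel. complex_of_real (partial_deriv i g \<eta>) * nexp (z \<bullet> \<eta>)) \<le> C"
    using Suc.IH[of "partial_deriv i g"] by blast
  show ?case
  proof (intro exI allI)
    fix z
    show "\<bar>z $ i\<bar> ^ Suc k * norm (LINT \<eta>|lborel. complex_of_real (g \<eta>) * nexp (z \<bullet> \<eta>)) \<le> C"
      using C[of z] fourier_partial_deriv[OF Suc.prems, where i=i and z=z] by (simp add: norm_mult mult_ac)
  qed
qed

text \<open>The largest coordinate controls the norm. Summing over all coordinates removes its
  dependence on \<open>z\<close>, so that finitely many coordinatewise decay bounds combine.\<close>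

lemma one_plus_norm_power_le:
  fixes z :: "real^'n::finite"
  shows "(1 + norm z) ^ k \<le> 2 ^ k * (1 + real CARD('n) ^ k * (\<Sum>i\<in>UNIV. \<bar>z $ i\<bar> ^ k))"
proof -
  obtain i where i: "\<And>j. \<bar>z $ j\<bar> \<le> \<bar>z $ i\<bar>"
  proof -
    have "Max (range (\<lambda>j. \<bar>z $ j\<bar>)) \<in> range (\<lambda>j. \<bar>z $ j\<bar>)" by (intro Max_in) auto
    then obtain i where "\<bar>z $ i\<bar> = Max (range (\<lambda>j. \<bar>z $ j\<bar>))" by force
    then show thesis by (intro that[of i]) auto
  qed
  have "norm z \<le> (\<Sum>j\<in>UNIV. \<bar>z $ j\<bar>)" by (rule norm_le_l1_cart)
  also have "\<dots> \<le> (\<Sum>j\<in>(UNIV::'n set). \<bar>z $ i\<bar>)" by (intro sum_mono i)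
  finally have n: "norm z \<le> real CARD('n) * \<bar>z $ i\<bar>" by simp
  have "norm z ^ k \<le> (real CARD('n) * \<bar>z $ i\<bar>) ^ k" by (intro power_mono n) auto
  also have "\<dots> = real CARD('n) ^ k * \<bar>z $ i\<bar> ^ k" by (simp add: power_mult_distrib)
  also have "\<dots> \<le> real CARD('n) ^ k * (\<Sum>i\<in>UNIV. \<bar>z $ i\<bar> ^ k)"
    by (intro mult_left_mono member_le_sum) auto
  finally have "1 + norm z ^ k \<le> 1 + real CARD('n) ^ k * (\<Sum>i\<in>UNIV. \<bar>z $ i\<bar> ^ k)" by simp
  moreover have "(1 + norm z) ^ k \<le> 2 ^ k * (1 + norm z ^ k)"
  proof -
    have "1 + norm z \<le> 2 * max 1 (norm z)" by simp
    then have "(1 + norm z) ^ k \<le> (2 * max 1 (norm z)) ^ k" by (intro power_mono) auto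
    also have "\<dots> = 2 ^ k * max 1 (norm z) ^ k" by (simp add: power_mult_distrib)
    also have "\<dots> \<le> 2 ^ k * (1 + norm z ^ k)" by (intro mult_left_mono) (auto simp: max_def)
    finally show ?thesis .
  qed
  ultimately show ?thesis by (smt (verit) mult_left_mono zero_le_power)
qed

lemma fourier_decay:
  fixes g :: "real^'n::finite \<Rightarrow> real"
  assumes "smooth g" "\<And>x. R < norm x \<Longrightarrow> g x = 0"
  shows "\<exists>C. \<forall>z. norm (LINT \<eta>|lborel. complex_of_real (g \<eta>) * nexp (z \<bullet> \<eta>)) \<le> C * wt k z"
proof -
  let ?F = "\<lambda>z. norm (LINT \<eta>|lborel. complex_of_real (g \<eta>) * nexp (z \<bullet> \<eta>))"
  have "\<exists>C. \<forall>z. \<bar>z $ i\<bar> ^ k * ?F z \<le> C" for i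
    using assms by (intro fourier_coordinate_decay) (auto simp: smooth_iff_Ck)
  then obtain C where C: "\<And>i z. \<bar>z $ i\<bar> ^ k * ?F z \<le> C i" by metis
  \<comment> \<open>Exponent 0 gives the plain bound on the integral; any index serves, hence
    \<open>undefined\<close>.\<close>
  have "\<exists>C. \<forall>z. \<bar>z $ undefined\<bar> ^ 0 * ?F z \<le> C"
    using assms by (intro fourier_coordinate_decay) (auto simp: smooth_iff_Ck simp del: Ck.simps)
  then obtain C0 where C0: "\<And>z. ?F z \<le> C0" by auto
  have "?F z \<le> (2 ^ k * (C0 + real CARD('n) ^ k * (\<Sum>i\<in>UNIV. C i))) * wt k z" for z
  proof -
    have "(1 + norm z) ^ k * ?F z \<le> 2 ^ k * (1 + real CARD('n) ^ k * (\<Sum>i\<in>UNIV. \<bar>z $ i\<bar> ^ k)) * ?F z"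
      by (intro mult_right_mono one_plus_norm_power_le) auto
    also have "\<dots> = 2 ^ k * (?F z + real CARD('n) ^ k * (\<Sum>i\<in>UNIV. \<bar>z $ i\<bar> ^ k * ?F z))"
      by (simp add: algebra_simps sum_distrib_left)
    also have "\<dots> \<le> 2 ^ k * (C0 + real CARD('n) ^ k * (\<Sum>i\<in>UNIV. C i))"
      by (intro mult_left_mono add_mono sum_mono C C0) auto
    finally show ?thesis by (simp add: wt_def field_simps)
  qed
  then show ?thesis by blast
qed

section \<open>Tempered and rapidly decreasing functions\<close>

abbreviation Lpn :: "ennreal \<Rightarrow> (real^'n::finite \<Rightarrow> complex) \<Rightarrow> ennreal" where
  "Lpn p f \<equiv> Lnorm lborel p (\<lambda>x. ennreal (norm (f x)))"

text \<open>The exponent is that of \<open>integrable_wt\<close>; it is large enough for all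
  Lebesgue spaces with exponent at least one simultaneously.\<close>

definition tempered :: "(real^'n::finite \<Rightarrow> complex) \<Rightarrow> bool" where
  "tempered f \<longleftrightarrow> f \<in> borel_measurable borel \<and> integrable lborel (\<lambda>x. norm (f x) * wt (2 * CARD('n)) x)"

text \<open>Decay without smoothness: the class contains the Schwartz functions and the kernels, and
  is closed under multiplication by measurable functions of polynomial growth such as
  \<open>cv K f\<close>.\<close>

definition rapid :: "(real^'n::finite \<Rightarrow> complex) \<Rightarrow> bool" where
  "rapid \<phi> \<longleftrightarrow> \<phi> \<in> borel_measurable borel \<and> (\<forall>m. \<exists>C. \<forall>x. norm (\<phi> x) \<le> C * wt m x)"

lemma tempered_measurable: "tempered f \<Longrightarrow> f \<in> borel_measurable borel"
  and rapid_measurable: "rapid f \<Longrightarrow> f \<in> borel_measurable borel"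
  by (auto simp: tempered_def rapid_def)

lemma rapid_bound:
  assumes "rapid \<phi>"
  shows "\<exists>C. 0 \<le> C \<and> (\<forall>x. norm (\<phi> x) \<le> C * wt m x)"
proof -
  obtain C where C: "\<And>x. norm (\<phi> x) \<le> C * wt m x" using assms by (auto simp: rapid_def)
  have "0 \<le> C * wt m (0 :: real^'a)" by (rule order_trans[OF norm_ge_zero C])
  then have "0 \<le> C" by (simp add: wt_def)
  with C show ?thesis by blast
qed

lemma integrable_wt_cart: "2 * CARD('n) \<le> m \<Longrightarrow> integrable lborel (wt m :: real^'n::finite \<Rightarrow> real)"
  by (rule integrable_wt) simp

lemma rapid_integrable:
  assumes "rapid \<phi>" shows "integrable lborel \<phi>"
proof -
  obtain C where C: "\<And>x. norm (\<phi> x) \<le> C * wt (2 * CARD('a)) x"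
    using rapid_bound[OF assms] by blast
  show ?thesis
  proof (rule Bochner_Integration.integrable_bound[of _ "\<lambda>x. C * wt (2 * CARD('a)) x"])
    show "AE x in lborel. norm (\<phi> x) \<le> norm (C * wt (2 * CARD('a)) x)"
      using C order_trans[OF C abs_ge_self] by (intro AE_I2) (simp only: real_norm_def)
    show "integrable lborel (\<lambda>x::real^'a. C * wt (2 * CARD('a)) x)"
      by (intro integrable_mult_right integrable_wt_cart order_refl)
    show "\<phi> \<in> borel_measurable lborel"
      using rapid_measurable[OF assms] by (simp only: measurable_lborel2)
  qed
qed

lemma rapid_shift:
  assumes "rapid \<phi>" shows "rapid (\<lambda>x. \<phi> (x - a))"
  unfolding rapid_def
proof (intro conjI allI)
  note [measurable] = rapid_measurable[OF assms]
  show "(\<lambda>x. \<phi> (x - a)) \<in> borel_measurable borel" by measurable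
  fix m
  obtain C where C: "0 \<le> C" "\<And>x. norm (\<phi> x) \<le> C * wt m x" using rapid_bound[OF assms] by blast
  have "norm (\<phi> (x - a)) \<le> (C * (1 + norm a) ^ m) * wt m x" for x
    using C(2)[of "x - a"] mult_left_mono[OF wt_Peetre[of m x a] C(1)] by (simp add: mult_ac)
  then show "\<exists>C. \<forall>x. norm (\<phi> (x - a)) \<le> C * wt m x" by blast
qed

lemma rapid_reflect:
  assumes "rapid \<phi>" shows "rapid (\<lambda>x. \<phi> (a - x))"
proof -
  have "rapid (\<lambda>x. \<phi> (- x))"
    unfolding rapid_def
  proof (intro conjI allI)
    note [measurable] = rapid_measurable[OF assms]
    show "(\<lambda>x. \<phi> (- x)) \<in> borel_measurable borel" by measurable
    fix m
    obtain C where "\<And>x. norm (\<phi> x) \<le> C * wt m x" using rapid_bound[OF assms] by blast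
    from this[of "- x" for x] show "\<exists>C. \<forall>x. norm (\<phi> (- x)) \<le> C * wt m x"
      by (auto simp: wt_def)
  qed
  from rapid_shift[OF this, of a] show ?thesis by simp
qed

lemma rapid_dilate:
  assumes "rapid \<phi>" "1 \<le> b" shows "rapid (\<lambda>x. \<phi> (b *\<^sub>R x))"
  unfolding rapid_def
proof (intro conjI allI)
  note [measurable] = rapid_measurable[OF assms(1)]
  show "(\<lambda>x. \<phi> (b *\<^sub>R x)) \<in> borel_measurable borel" by measurable
  fix m
  obtain C where C: "0 \<le> C" "\<And>x. norm (\<phi> x) \<le> C * wt m x" using rapid_bound[OF assms(1)] by blast
  have "wt m (b *\<^sub>R x) \<le> wt m x" for x :: "real^'a"
  proof -
    have "norm x \<le> norm (b *\<^sub>R x)" using assms(2) mult_right_mono[of 1 b "norm x"] by simp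
    then show ?thesis
      unfolding wt_def by (intro divide_left_mono power_mono mult_pos_pos zero_less_power) (auto simp del: norm_scaleR)
  qed
  then have "norm (\<phi> (b *\<^sub>R x)) \<le> C * wt m x" for x
    using C by (meson mult_left_mono order_trans)
  then show "\<exists>C. \<forall>x. norm (\<phi> (b *\<^sub>R x)) \<le> C * wt m x" by blast
qed

lemma rapid_mult_growth:
  assumes "rapid \<phi>" and [measurable]: "v \<in> borel_measurable borel"
    and v: "\<And>x. norm (v x) \<le> D * (1 + norm x) ^ k"
  shows "rapid (\<lambda>x. \<phi> x * v x)"
  unfolding rapid_def
proof (intro conjI allI)
  note [measurable] = rapid_measurable[OF assms(1)]
  show "(\<lambda>x. \<phi> x * v x) \<in> borel_measurable borel" by measurable
  fix m
  obtain C where C: "0 \<le> C" "\<And>x. norm (\<phi> x) \<le> C * wt (k + m) x" using rapid_bound[OF assms(1)] by blast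
  have "norm (\<phi> x * v x) \<le> (C * D) * wt m x" for x
  proof -
    have "norm (\<phi> x * v x) \<le> (C * wt (k + m) x) * (D * (1 + norm x) ^ k)"
      unfolding norm_mult by (intro mult_mono C v) (use C in auto)
    also have "\<dots> = C * D * ((1 + norm x) ^ k * wt (k + m) x)" by simp
    finally show ?thesis by (simp only: power_mult_wt)
  qed
  then show "\<exists>C. \<forall>x. norm (\<phi> x * v x) \<le> C * wt m x" by blast
qed

lemma rapid_mult:
  assumes "rapid \<phi>" "rapid \<psi>" shows "rapid (\<lambda>x. \<phi> x * \<psi> x)"
proof -
  obtain C where "\<And>x. norm (\<psi> x) \<le> C * wt 0 x" using rapid_bound[OF assms(2)] by blast
  then show ?thesis
    by (intro rapid_mult_growth[OF assms(1) rapid_measurable[OF assms(2)], of C 0]) (simp add: wt_def)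
qed

lemma schwartz_rapid:
  assumes "\<phi> \<in> schwartz" shows "rapid \<phi>"
  unfolding rapid_def
proof (intro conjI allI)
  have "partial_derivs [] \<phi> differentiable_on UNIV"
    using assms unfolding schwartz_def smooth_def by blast
  then show "\<phi> \<in> borel_measurable borel"
    by (auto intro!: borel_measurable_continuous_onI differentiable_imp_continuous_on)
  fix m
  have "bounded (range (\<lambda>x. (1 + norm x) ^ m *\<^sub>R partial_derivs [] \<phi> x))"
    using assms unfolding schwartz_def by blast
  then obtain C where "\<And>x. norm ((1 + norm x) ^ m *\<^sub>R \<phi> x) \<le> C"
    unfolding bounded_iff by auto
  then have "norm (\<phi> x) \<le> C * wt m x" for x
    by (simp add: wt_def field_simps)
  then show "\<exists>C. \<forall>x. norm (\<phi> x) \<le> C * wt m x" by blast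
qed

section \<open>Tempered functions against rapidly decreasing kernels\<close>

lemma integrable_tempered_rapid:
  assumes "tempered f" "rapid \<phi>" shows "integrable lborel (\<lambda>x. f x * \<phi> x)"
proof -
  obtain C where C: "\<And>x. norm (\<phi> x) \<le> C * wt (2 * CARD('a)) x"
    using rapid_bound[OF assms(2)] by blast
  show ?thesis
  proof (rule Bochner_Integration.integrable_bound[of _ "\<lambda>x. C * (norm (f x) * wt (2 * CARD('a)) x)"])
    show "AE x in lborel. norm (f x * \<phi> x) \<le> norm (C * (norm (f x) * wt (2 * CARD('a)) x))"
    proof (rule AE_I2)
      fix x
      have "norm (f x * \<phi> x) \<le> norm (f x) * (C * wt (2 * CARD('a)) x)"
        unfolding norm_mult by (intro mult_left_mono C) auto
      then show "norm (f x * \<phi> x) \<le> norm (C * (norm (f x) * wt (2 * CARD('a)) x))"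
        by (simp add: mult_ac)
    qed
  qed (use assms in \<open>auto simp: tempered_def rapid_def\<close>)
qed

lemma ennreal_le_one_plus_powr: "1 \<le> r \<Longrightarrow> x \<le> 1 + ennreal_powr x r"
proof (cases x rule: ennreal_cases)
  case (real a)
  assume r: "1 \<le> r"
  have "a \<le> 1 + a powr r"
  proof (cases "a \<le> 1")
    case False
    then have "a powr 1 \<le> a powr r" using r by (intro powr_mono) auto
    then show ?thesis using False by simp
  qed (simp add: add_increasing2)
  then have "ennreal a \<le> ennreal (1 + a powr r)" by (rule ennreal_leI)
  then show ?thesis using real by simp
qed simp

text \<open>Conjugate exponents are avoided: for finite \<open>p\<close>, the estimate
  \<open>u \<le> 1 + u powr p\<close> reduces the claim to integrability of the weight and the bound
  1 on it. This is what makes functions of finite norm tempered.\<close>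

lemma nn_integral_mult_wt_less_top:
  fixes u :: "real^'n::finite \<Rightarrow> ennreal"
  assumes [measurable]: "u \<in> borel_measurable borel" and p: "1 \<le> p" and fin: "Lnorm lborel p u < \<infinity>"
  shows "(\<integral>\<^sup>+x. u x * ennreal (wt (2 * CARD('n)) x) \<partial>lborel) < \<infinity>"
proof -
  let ?w = "\<lambda>x::real^'n. ennreal (wt (2 * CARD('n)) x)"
  have w: "(\<integral>\<^sup>+x. ?w x \<partial>lborel) < \<infinity>"
    using integrable_wt_cart[of "2 * CARD('n)", where 'n='n] by (simp add: integrable_iff_bounded)
  show ?thesis
  proof (cases "p = \<infinity>")
    case True
    have "(\<integral>\<^sup>+x. u x * ?w x \<partial>lborel) \<le> (\<integral>\<^sup>+x. Lnorm lborel p u * ?w x \<partial>lborel)"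
      using esssup_AE[of u lborel] True
      by (intro nn_integral_mono_AE) (auto simp: Lnorm_def elim!: eventually_mono intro: mult_right_mono)
    also have "\<dots> < \<infinity>" using fin w by (simp add: nn_integral_cmult ennreal_mult_less_top)
    finally show ?thesis .
  next
    case False
    define r where "r = enn2real p"
    have r: "1 \<le> r" using p False by (auto simp: r_def intro: enn2real_ge_1)
    have "(\<integral>\<^sup>+x. u x * ?w x \<partial>lborel) \<le> (\<integral>\<^sup>+x. ?w x + ennreal_powr (u x) r \<partial>lborel)"
    proof (intro nn_integral_mono)
      fix x
      have "u x * ?w x \<le> (1 + ennreal_powr (u x) r) * ?w x"
        by (intro mult_right_mono ennreal_le_one_plus_powr r) auto
      also have "\<dots> = ?w x + ennreal_powr (u x) r * ?w x" by (simp add: ring_distribs)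
      also have "\<dots> \<le> ?w x + ennreal_powr (u x) r * 1"
        by (intro add_left_mono mult_left_mono) (auto simp: ennreal_le_1)
      finally show "u x * ?w x \<le> ?w x + ennreal_powr (u x) r" by simp
    qed
    also have "\<dots> = (\<integral>\<^sup>+x. ?w x \<partial>lborel) + (\<integral>\<^sup>+x. ennreal_powr (u x) r \<partial>lborel)"
      by (rule nn_integral_add) auto
    also have "\<dots> < \<infinity>"
      using w fin False by (simp add: Lnorm_def r_def less_top[symmetric])
    finally show ?thesis .
  qed
qed

lemma tempered_if_Lnorm_finite:
  fixes f :: "real^'n::finite \<Rightarrow> complex"
  assumes [measurable]: "f \<in> borel_measurable borel" and "1 \<le> p" "Lpn p f < \<infinity>"
  shows "tempered f"
  using nn_integral_mult_wt_less_top[OF _ assms(2,3)]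
  by (auto simp: tempered_def integrable_iff_bounded ennreal_mult)

text \<open>Convolution of \<open>f\<close> with the reflected kernel
  \<open>z \<mapsto> K (- z)\<close>. The order \<open>x - y\<close> matches the sign in
  \<open>kap\<close> and makes \<open>cv K f y\<close> the pairing of \<open>f\<close> with a
  translate of \<open>K\<close>.\<close>

definition cv :: "(real^'n::finite \<Rightarrow> complex) \<Rightarrow> (real^'n \<Rightarrow> complex) \<Rightarrow> real^'n \<Rightarrow> complex" where
  "cv K f y = (LINT x|lborel. f x * K (x - y))"

lemma measurable_cv [measurable]:
  assumes [measurable]: "f \<in> borel_measurable borel" "K \<in> borel_measurable borel"
  shows "cv K f \<in> borel_measurable borel"
  unfolding cv_def[abs_def] by measurable

lemma tempered_kernel_bound:
  fixes f K :: "real^'n::finite \<Rightarrow> complex"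
  assumes C: "0 \<le> C" "\<And>x. norm (K x) \<le> C * wt (2 * CARD('n)) x"
  shows "norm (f x * K (x - y)) \<le> C * (1 + norm y) ^ (2 * CARD('n)) * (norm (f x) * wt (2 * CARD('n)) x)"
proof -
  let ?N = "2 * CARD('n)"
  have "norm (K (x - y)) \<le> C * ((1 + norm y) ^ ?N * wt ?N x)"
    using C(2)[of "x - y"] mult_left_mono[OF wt_Peetre C(1)] by (rule order_trans)
  then have "norm (f x) * norm (K (x - y)) \<le> norm (f x) * (C * ((1 + norm y) ^ ?N * wt ?N x))"
    by (intro mult_left_mono) auto
  then show ?thesis by (simp add: norm_mult mult_ac)
qed

lemma cv_growth:
  fixes f K :: "real^'n::finite \<Rightarrow> complex"
  assumes f: "tempered f" and K: "rapid K"
  shows "\<exists>D. \<forall>y. norm (cv K f y) \<le> D * (1 + norm y) ^ (2 * CARD('n))"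
proof -
  let ?N = "2 * CARD('n)"
  obtain C where C: "0 \<le> C" "\<And>x. norm (K x) \<le> C * wt ?N x" using rapid_bound[OF K] by blast
  have "norm (cv K f y) \<le> (C * (LINT x|lborel. norm (f x) * wt ?N x)) * (1 + norm y) ^ ?N" for y
  proof -
    have "norm (cv K f y) \<le> (LINT x|lborel. C * (1 + norm y) ^ ?N * (norm (f x) * wt ?N x))"
      unfolding cv_def
      using integrable_tempered_rapid[OF f rapid_shift[OF K]] f tempered_kernel_bound[OF C, of f]
      by (intro Bochner_Integration.integral_norm_bound_integral) (auto simp: tempered_def)
    also have "\<dots> = C * (1 + norm y) ^ ?N * (LINT x|lborel. norm (f x) * wt ?N x)"
      by (rule integral_mult_right_zero)
    finally show ?thesis by (simp add: mult_ac)
  qed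
  then show ?thesis by blast
qed

lemma rapid_mult_cv:
  assumes "rapid v" "tempered f" "rapid K" shows "rapid (\<lambda>x. v x * cv K f x)"
proof -
  obtain D where D: "\<And>y. norm (cv K f y) \<le> D * (1 + norm y) ^ (2 * CARD('a))"
    using cv_growth[OF assms(2,3)] by blast
  show ?thesis
    by (rule rapid_mult_growth[OF assms(1) _ D])
       (use measurable_cv tempered_measurable[OF assms(2)] rapid_measurable[OF assms(3)] in blast)
qed

text \<open>Transposition: the convolution moves from \<open>f\<close> to the test function
  \<open>v\<close>. For Fubini, the decay of \<open>v\<close> of order \<open>?N + ?N\<close> pays
  the growth \<open>(1 + norm y) ^ ?N\<close> and leaves an integrable weight.\<close>

lemma integral_mult_cv:
  fixes f K v :: "real^'n::finite \<Rightarrow> complex"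
  assumes f: "tempered f" and K: "rapid K" and v: "rapid v"
  shows "(LINT y|lborel. v y * cv K f y) = (LINT x|lborel. f x * (LINT y|lborel. v y * K (x - y)))"
proof -
  let ?N = "2 * CARD('n)"
  note [measurable] = tempered_measurable[OF f] rapid_measurable[OF K] rapid_measurable[OF v]
  obtain C where C: "0 \<le> C" "\<And>x. norm (K x) \<le> C * wt ?N x" using rapid_bound[OF K] by blast
  obtain D where D: "0 \<le> D" "\<And>x. norm (v x) \<le> D * wt (?N + ?N) x" using rapid_bound[OF v] by blast
  have "integrable (lborel \<Otimes>\<^sub>M lborel) (\<lambda>(y, x). v y * (f x * K (x - y)))"
  proof (rule lborel_pair.integrable_pair_bound)
    show "integrable lborel (\<lambda>y::real^'n. D * C * wt ?N y)"
      using integrable_wt_cart[of ?N, where 'n='n] by simp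
    show "integrable lborel (\<lambda>x. norm (f x) * wt ?N x)" using f by (simp add: tempered_def)
    fix y x
    have "norm (v y * (f x * K (x - y))) \<le> (D * wt (?N + ?N) y) * (C * (1 + norm y) ^ ?N * (norm (f x) * wt ?N x))"
      unfolding norm_mult[of "v y"] by (intro mult_mono D tempered_kernel_bound C) (use D in auto)
    also have "\<dots> = D * C * ((1 + norm y) ^ ?N * wt (?N + ?N) y) * (norm (f x) * wt ?N x)" by simp
    finally show "norm (case (y, x) of (y, x) \<Rightarrow> v y * (f x * K (x - y))) \<le> D * C * wt ?N y * (norm (f x) * wt ?N x)"
      by (simp only: power_mult_wt prod.case)
  qed measurable
  from lborel_pair.Fubini_integral[OF this]
  have "(LINT x|lborel. (LINT y|lborel. v y * (f x * K (x - y)))) = (LINT y|lborel. (LINT x|lborel. v y * (f x * K (x - y))))"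
    by simp
  moreover have "v y * (f x * K (x - y)) = f x * (v y * K (x - y))" for x y
    by (simp add: mult.left_commute)
  ultimately show ?thesis
    unfolding cv_def by (metis (no_types, lifting) Bochner_Integration.integral_cong integral_mult_right_zero)
qed

lemma norm_integral_le_nn_integral:
  fixes f :: "'a \<Rightarrow> 'b::{banach, second_countable_topology}"
  shows "ennreal (norm (\<integral>x. f x \<partial>M)) \<le> (\<integral>\<^sup>+x. ennreal (norm (f x)) \<partial>M)"
  by (cases "integrable M f") (auto intro: integral_norm_bound_ennreal simp: not_integrable_integral_eq)

text \<open>The substitution \<open>x = y + z\<close> exhibits the inner integral as a superposition
  of translates of \<open>f\<close> with weights \<open>norm (K z)\<close>, and all translates have
  the same norm.\<close>

lemma Lnorm_cv_le:
  fixes f K :: "real^'n::finite \<Rightarrow> complex"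
  assumes p: "1 \<le> p" and [measurable]: "f \<in> borel_measurable borel" and K: "integrable lborel K"
  shows "Lnorm lborel p (\<lambda>y. \<integral>\<^sup>+x. ennreal (norm (f x)) * ennreal (norm (K (x - y))) \<partial>lborel)
    \<le> (\<integral>\<^sup>+z. ennreal (norm (K z)) \<partial>lborel) * Lpn p f"
proof -
  note [measurable] = borel_measurable_integrable[OF K]
  have "(\<integral>\<^sup>+x. ennreal (norm (f x)) * ennreal (norm (K (x - y))) \<partial>lborel) = (\<integral>\<^sup>+z. ennreal (norm (K z)) * ennreal (norm (f (y + z))) \<partial>lborel)" for y
    by (subst nn_integral_affine_euclidean[of _ 1 y]) (auto simp: mult.commute)
  then have "Lnorm lborel p (\<lambda>y. \<integral>\<^sup>+x. ennreal (norm (f x)) * ennreal (norm (K (x - y))) \<partial>lborel)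
    = Lnorm lborel p (\<lambda>y. \<integral>\<^sup>+z. ennreal (norm (K z)) * ennreal (norm (f (y + z))) \<partial>lborel)" by simp
  also have "\<dots> \<le> (\<integral>\<^sup>+z. ennreal (norm (K z)) \<partial>lborel) * Lpn p f"
  proof (rule Lnorm_weighted_le)
    show "Lpn p (\<lambda>x. f (x + z)) \<le> Lpn p f" for z
      using Lnorm_shift[of "\<lambda>x. ennreal (norm (f x))" p z] by simp
  qed (use p K in \<open>auto simp: integrable_iff_bounded lborel.sigma_finite_measure_axioms\<close>)
  finally show ?thesis .
qed

lemma Lnorm_norm_cv_le:
  fixes f K :: "real^'n::finite \<Rightarrow> complex"
  assumes p: "1 \<le> p" and [measurable]: "f \<in> borel_measurable borel" and K: "integrable lborel K"
  shows "Lpn p (cv K f)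
    \<le> (\<integral>\<^sup>+z. ennreal (norm (K z)) \<partial>lborel) * Lpn p f"
proof -
  note [measurable] = borel_measurable_integrable[OF K]
  have "ennreal (norm (cv K f y)) \<le> (\<integral>\<^sup>+x. ennreal (norm (f x)) * ennreal (norm (K (x - y))) \<partial>lborel)" for y
    unfolding cv_def using norm_integral_le_nn_integral[of lborel "\<lambda>x. f x * K (x - y)"] by (simp add: norm_mult ennreal_mult)
  then have "Lpn p (cv K f) \<le> Lnorm lborel p (\<lambda>y. \<integral>\<^sup>+x. ennreal (norm (f x)) * ennreal (norm (K (x - y))) \<partial>lborel)"
    by (intro Lnorm_mono_AE p) auto
  also note Lnorm_cv_le[OF p assms(2) K]
  finally show ?thesis .
qed

text \<open>The sign is opposite to that of \<open>kap\<close>, and the factor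
  \<open>(2 * pi) ^ CARD('n)\<close> sits in \<open>kap\<close> alone, so \<open>hat\<close> inverts
  it without constants.\<close>

definition hat :: "(real^'n::finite \<Rightarrow> complex) \<Rightarrow> real^'n \<Rightarrow> complex" where
  "hat v \<xi> = (LINT x|lborel. v x * iexp (x \<bullet> \<xi>))"

section \<open>The decomposition functions and their kernels\<close>

lemma finite_int_vec_box: "finite {m::int^'n::finite. \<forall>i. a i \<le> m $ i \<and> m $ i \<le> c i}"
proof (rule finite_subset)
  show "{m::int^'n. \<forall>i. a i \<le> m $ i \<and> m $ i \<le> c i} \<subseteq> vec_lambda ` (PiE UNIV (\<lambda>i. {a i..c i}))"
  proof
    fix m :: "int^'n" assume "m \<in> {m. \<forall>i. a i \<le> m $ i \<and> m $ i \<le> c i}"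
    then have "vec_nth m \<in> PiE UNIV (\<lambda>i. {a i..c i})" by auto
    then show "m \<in> vec_lambda ` (PiE UNIV (\<lambda>i. {a i..c i}))"
      by (metis vec_nth_inverse imageI)
  qed
qed (intro finite_imageI finite_PiE, auto)

lemma lattice_point_nth [simp]: "lattice_point k $ i = of_int (k $ i)"
  by (simp add: lattice_point_def)

lemma lattice_point_add: "lattice_point (k + l) = lattice_point k + lattice_point l"
  and lattice_point_diff: "lattice_point (k - l) = lattice_point k - lattice_point l"
  and lattice_point_0 [simp]: "lattice_point 0 = 0"
  by (auto simp: vec_eq_iff)

locale freq_window =
  fixes \<rho> :: "real^'n::finite \<Rightarrow> real"
  assumes window: "decomposition_window \<rho>"
begin

lemma rho_smooth: "smooth \<rho>" and rho_ge_0: "0 \<le> \<rho> \<xi>" and rho_le_1: "\<rho> \<xi> \<le> 1"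
  using window by (auto simp: decomposition_window_def image_subset_iff)

lemma rho_support: "\<rho> \<xi> \<noteq> 0 \<Longrightarrow> \<bar>\<xi> $ i\<bar> \<le> 1"
proof -
  assume "\<rho> \<xi> \<noteq> 0"
  then have "\<xi> \<in> closure {\<xi>. \<rho> \<xi> \<noteq> 0}" by (intro closure_subset[THEN subsetD]) simp
  then have "\<xi> \<in> cbox (\<chi> i. - 1) (\<chi> i. 1)" using window by (auto simp: decomposition_window_def)
  then have "- 1 \<le> \<xi> $ i \<and> \<xi> $ i \<le> 1" by (simp add: mem_box_cart)
  then show ?thesis by linarith
qed

lemma rho_eq_1: "(\<And>i. \<bar>\<xi> $ i\<bar> \<le> 1/2) \<Longrightarrow> \<rho> \<xi> = 1"
proof -
  assume "\<And>i. \<bar>\<xi> $ i\<bar> \<le> 1/2"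
  then have "- (1/2) \<le> \<xi> $ i \<and> \<xi> $ i \<le> 1/2" for i by (metis abs_le_D1 abs_le_D2 minus_le_iff)
  then have "\<xi> \<in> cbox (\<chi> i. - (1/2)) (\<chi> i. 1/2)" by (simp add: mem_box_cart)
  then show ?thesis using window by (auto simp: decomposition_window_def)
qed

definition total :: "real^'n \<Rightarrow> real" where
  "total \<xi> = (\<Sum>\<^sub>\<infinity>m\<in>UNIV. window_shift \<rho> m \<xi>)"

lemma freq_decomp_eq: "freq_decomp \<rho> k \<xi> = \<rho> (\<xi> - lattice_point k) * inverse (total \<xi>)"
  by (simp add: freq_decomp_def total_def window_shift_def)

lemma finite_rho_support: "finite {m. \<rho> (\<xi> - lattice_point m) \<noteq> 0}"
proof (rule finite_subset)
  show "{m. \<rho> (\<xi> - lattice_point m) \<noteq> 0} \<subseteq> {m. \<forall>i. \<lfloor>\<xi> $ i\<rfloor> - 1 \<le> m $ i \<and> m $ i \<le> \<lceil>\<xi> $ i\<rceil> + 1}"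
  proof clarify
    fix m i assume "\<rho> (\<xi> - lattice_point m) \<noteq> 0"
    from rho_support[OF this, of i] have "\<bar>\<xi> $ i - of_int (m $ i)\<bar> \<le> 1" by simp
    then show "\<lfloor>\<xi> $ i\<rfloor> - 1 \<le> m $ i \<and> m $ i \<le> \<lceil>\<xi> $ i\<rceil> + 1" by linarith
  qed
qed (rule finite_int_vec_box)

lemma total_eq_sum:
  assumes "finite F" "{m. \<rho> (\<xi> - lattice_point m) \<noteq> 0} \<subseteq> F"
  shows "total \<xi> = (\<Sum>m\<in>F. \<rho> (\<xi> - lattice_point m))"
proof -
  have "total \<xi> = (\<Sum>\<^sub>\<infinity>m\<in>F. window_shift \<rho> m \<xi>)"
    unfolding total_def by (rule infsum_cong_neutral) (use assms(2) in \<open>auto simp: window_shift_def\<close>)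
  then show ?thesis using assms(1) by (simp add: window_shift_def)
qed

lemma rho_round: "\<rho> (\<xi> - lattice_point (\<chi> i. round (\<xi> $ i))) = 1"
proof (rule rho_eq_1)
  fix i
  show "\<bar>(\<xi> - lattice_point (\<chi> i. round (\<xi> $ i))) $ i\<bar> \<le> 1/2"
    using of_int_round_abs_le[of "\<xi> $ i"] by (simp add: abs_minus_commute)
qed

text \<open>The lattice point obtained by rounding \<open>\<xi>\<close> contributes a full 1, and
  the other terms are nonnegative.\<close>

lemma total_ge_1: "1 \<le> total \<xi>"
proof -
  let ?F = "{m. \<rho> (\<xi> - lattice_point m) \<noteq> 0}"
  have "1 = \<rho> (\<xi> - lattice_point (\<chi> i. round (\<xi> $ i)))" by (simp add: rho_round)
  also have "\<dots> \<le> (\<Sum>m\<in>?F. \<rho> (\<xi> - lattice_point m))"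
    by (rule member_le_sum) (auto simp: rho_ge_0 rho_round finite_rho_support)
  also have "\<dots> = total \<xi>" by (rule total_eq_sum[symmetric]) (auto simp: finite_rho_support)
  finally show ?thesis .
qed

lemma total_shift: "total (\<xi> - lattice_point k) = total \<xi>"
proof -
  have "total \<xi> = (\<Sum>\<^sub>\<infinity>m\<in>range (\<lambda>m. m + k). window_shift \<rho> m \<xi>)"
    unfolding total_def by (metis surj_plus_right)
  also have "\<dots> = total (\<xi> - lattice_point k)"
    unfolding total_def by (subst infsum_reindex) (auto simp: o_def window_shift_def lattice_point_add algebra_simps intro: injI)
  finally show ?thesis by simp
qed

lemma freq_decomp_shift: "freq_decomp \<rho> k \<xi> = freq_decomp \<rho> 0 (\<xi> - lattice_point k)"
  by (simp add: freq_decomp_eq total_shift)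

lemma freq_decomp_support: "freq_decomp \<rho> k \<xi> \<noteq> 0 \<Longrightarrow> \<bar>\<xi> $ i - of_int (k $ i)\<bar> \<le> 1"
  using rho_support[of "\<xi> - lattice_point k" i] by (auto simp: freq_decomp_eq)

lemma freq_decomp_bounds: "0 \<le> freq_decomp \<rho> k \<xi>" "freq_decomp \<rho> k \<xi> \<le> 1"
proof -
  have "inverse (total \<xi>) \<le> 1" "0 \<le> inverse (total \<xi>)" using total_ge_1[of \<xi>] by (auto simp: field_simps)
  then show "0 \<le> freq_decomp \<rho> k \<xi>" "freq_decomp \<rho> k \<xi> \<le> 1"
    unfolding freq_decomp_eq using rho_ge_0 rho_le_1 by (auto intro: mult_le_one)
qed

lemma freq_decomp_sum:
  assumes "finite F" "{m. freq_decomp \<rho> m \<xi> \<noteq> 0} \<subseteq> F"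
  shows "(\<Sum>m\<in>F. freq_decomp \<rho> m \<xi>) = 1"
proof -
  have "{m. \<rho> (\<xi> - lattice_point m) \<noteq> 0} \<subseteq> F"
    using assms(2) total_ge_1[of \<xi>] by (auto simp: freq_decomp_eq)
  then have "(\<Sum>m\<in>F. freq_decomp \<rho> m \<xi>) = total \<xi> * inverse (total \<xi>)"
    by (simp add: freq_decomp_eq total_eq_sum[OF assms(1)] flip: sum_distrib_right)
  then show ?thesis using total_ge_1[of \<xi>] by simp
qed

text \<open>On the cube with coordinates of modulus at most 1 the norm is bounded by the l1 norm,
  hence by \<open>CARD('n)\<close>.\<close>

lemma freq_decomp_0_vanish: "real CARD('n) < norm \<xi> \<Longrightarrow> freq_decomp \<rho> 0 \<xi> = 0"
proof (rule ccontr)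
  assume R: "real CARD('n) < norm \<xi>" and "freq_decomp \<rho> 0 \<xi> \<noteq> 0"
  then have "\<bar>\<xi> $ i\<bar> \<le> 1" for i using freq_decomp_support[of 0 \<xi> i] by simp
  then have "(\<Sum>i\<in>UNIV. \<bar>\<xi> $ i\<bar>) \<le> (\<Sum>i\<in>(UNIV::'n set). 1)" by (intro sum_mono)
  then show False using norm_le_l1_cart[of \<xi>] R by simp
qed

text \<open>Adding \<open>1 - \<rho> (\<xi> / 2)\<close> keeps the denominator positive far away from the support of \<open>\<rho>\<close>
  without changing it on that support, so that only a finite sum has to be differentiated.\<close>

lemma freq_decomp_0_smooth: "smooth (freq_decomp \<rho> 0)"
proof -
  \<comment> \<open>The bound 3 covers two cases: the rounding of a \<open>\<xi>\<close> with
    coordinates of modulus at most 2, and every \<open>m\<close> whose window is nonzero at a point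
    of the support of \<open>\<rho>\<close>.\<close>
  define F :: "(int^'n) set" where "F = {m. \<forall>i. - 3 \<le> m $ i \<and> m $ i \<le> 3}"
  have finF: "finite F" unfolding F_def by (rule finite_int_vec_box)
  \<comment> \<open>The factors 1 and -1 and the shift by 0 put every term into the shape of
    \<open>Ck_affine\<close>, \<open>Ck_const\<close> and \<open>Ck_mult\<close>.\<close>
  define d where "d \<xi> = (\<Sum>m\<in>F. \<rho> (1 *\<^sub>R (\<xi> - lattice_point m))) + (1 + (- 1) * \<rho> ((1/2) *\<^sub>R (\<xi> - 0)))" for \<xi>
  have d: "d \<xi> \<noteq> 0" for \<xi>
  proof
    assume d0: "d \<xi> = 0"
    have s0: "0 \<le> (\<Sum>m\<in>F. \<rho> (1 *\<^sub>R (\<xi> - lattice_point m)))" by (intro sum_nonneg rho_ge_0)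
    moreover have "0 \<le> 1 + (- 1) * \<rho> ((1/2) *\<^sub>R (\<xi> - 0))" using rho_le_1 by simp
    ultimately have *: "(\<Sum>m\<in>F. \<rho> (1 *\<^sub>R (\<xi> - lattice_point m))) = 0" "\<rho> ((1/2) *\<^sub>R (\<xi> - 0)) = 1"
      using d0 unfolding d_def by linarith+
    then have b: "\<bar>\<xi> $ i\<bar> \<le> 2" for i using rho_support[of "(1/2) *\<^sub>R (\<xi> - 0)" i] by simp
    have "(\<chi> i. round (\<xi> $ i)) \<in> F"
      unfolding F_def
    proof (clarsimp)
      fix i
      show "- 3 \<le> round (\<xi> $ i) \<and> round (\<xi> $ i) \<le> 3"
        using b[of i] of_int_round_abs_le[of "\<xi> $ i"] by linarith
    qed
    then have "\<rho> (1 *\<^sub>R (\<xi> - lattice_point (\<chi> i. round (\<xi> $ i)))) \<le> (\<Sum>m\<in>F. \<rho> (1 *\<^sub>R (\<xi> - lattice_point m)))"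
      by (intro member_le_sum finF rho_ge_0)
    then show False using * by (simp add: rho_round)
  qed
  have "freq_decomp \<rho> 0 = (\<lambda>\<xi>. \<rho> \<xi> * inverse (d \<xi>))"
  proof
    fix \<xi>
    show "freq_decomp \<rho> 0 \<xi> = \<rho> \<xi> * inverse (d \<xi>)"
    proof (cases "\<rho> \<xi> = 0")
      case False
      then have b: "\<bar>\<xi> $ i\<bar> \<le> 1" for i by (rule rho_support)
      have "\<rho> ((1/2) *\<^sub>R (\<xi> - 0)) = 1" by (rule rho_eq_1) (use b in auto)
      moreover have "{m. \<rho> (\<xi> - lattice_point m) \<noteq> 0} \<subseteq> F"
        unfolding F_def
      proof clarify
        fix m i assume "\<rho> (\<xi> - lattice_point m) \<noteq> 0"
        from rho_support[OF this, of i] b[of i] show "- 3 \<le> m $ i \<and> m $ i \<le> 3" by simp linarith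
      qed
      ultimately show ?thesis using finF by (simp add: freq_decomp_eq d_def total_eq_sum)
    qed (simp add: freq_decomp_eq)
  qed
  moreover have "Ck k (\<lambda>\<xi>. \<rho> \<xi> * inverse (d \<xi>))" for k
  proof -
    have rho: "Ck k \<rho>" using rho_smooth by (simp add: smooth_iff_Ck)
    have "Ck k (\<lambda>\<xi>. \<Sum>m\<in>F. \<rho> (1 *\<^sub>R (\<xi> - lattice_point m)))"
      by (rule Ck_sum[OF finF]) (rule Ck_affine[OF rho])
    from Ck_add[OF this Ck_add[OF Ck_const Ck_mult[OF Ck_const Ck_affine[OF rho]]]]
    have "Ck k d" unfolding d_def[abs_def] .
    from Ck_mult[OF rho Ck_inverse[OF d this]] show ?thesis .
  qed
  ultimately show ?thesis by (simp add: smooth_iff_Ck)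
qed

lemma freq_decomp_continuous: "continuous_on UNIV (freq_decomp \<rho> k)"
proof -
  have "partial_derivs [] (freq_decomp \<rho> 0) differentiable_on UNIV"
    using freq_decomp_0_smooth unfolding smooth_def by blast
  then have c: "continuous_on UNIV (freq_decomp \<rho> 0)" by (simp add: differentiable_imp_continuous_on)
  have "continuous_on UNIV (\<lambda>\<xi>. freq_decomp \<rho> 0 (\<xi> - lattice_point k))"
    by (rule continuous_on_compose2[OF c]) (auto intro!: continuous_intros)
  then show ?thesis by (simp flip: freq_decomp_shift)
qed

lemma measurable_freq_decomp [measurable]: "freq_decomp \<rho> k \<in> borel_measurable borel"
  using freq_decomp_continuous by (rule borel_measurable_continuous_onI)

lemma freq_decomp_integrable: "integrable lborel (\<lambda>\<xi>. complex_of_real (freq_decomp \<rho> k \<xi>))"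
proof -
  have "integrable lborel (freq_decomp \<rho> 0)"
    using freq_decomp_continuous freq_decomp_0_vanish by (rule integrable_compact_support)
  from integrable_affine_euclidean[OF this, of 1 "- lattice_point k"]
  have "integrable lborel (freq_decomp \<rho> k)" by (simp add: freq_decomp_shift[of k, abs_def])
  then show ?thesis by simp
qed

text \<open>\<open>kap k (- z)\<close> is \<open>(2 * pi) powr (- CARD('n) / 2)\<close> times the
  inverse Fourier transform of \<open>freq_decomp \<rho> k\<close> at \<open>z\<close>. This factor
  makes \<open>\<box>\<^sub>k\<close> a convolution without constants, and \<open>cv\<close> undoes
  the reflection.\<close>

definition kap :: "int^'n \<Rightarrow> real^'n \<Rightarrow> complex" where
  "kap k z = (LINT \<eta>|lborel. of_real (freq_decomp \<rho> k \<eta>) * nexp (z \<bullet> \<eta>)) / of_real ((2 * pi) ^ CARD('n))"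

lemma measurable_kap [measurable]: "kap k \<in> borel_measurable borel"
  unfolding kap_def[abs_def] by measurable

lemma kap_shift: "kap k z = nexp (z \<bullet> lattice_point k) * kap 0 z"
proof -
  have "(LINT \<eta>|lborel. complex_of_real (freq_decomp \<rho> k \<eta>) * nexp (z \<bullet> \<eta>))
     = (LINT \<eta>|lborel. complex_of_real (freq_decomp \<rho> k (lattice_point k + 1 *\<^sub>R \<eta>)) * nexp (z \<bullet> (lattice_point k + 1 *\<^sub>R \<eta>)))"
    by (subst integral_affine_euclidean[where c=1 and t="lattice_point k"]) auto
  also have "\<dots> = (LINT \<eta>|lborel. nexp (z \<bullet> lattice_point k) * (complex_of_real (freq_decomp \<rho> 0 \<eta>) * nexp (z \<bullet> \<eta>)))"
    by (simp add: freq_decomp_shift[of k] inner_add_right ring_distribs exp_add exp_diff exp_minus field_simps)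
  also have "\<dots> = nexp (z \<bullet> lattice_point k) * (LINT \<eta>|lborel. complex_of_real (freq_decomp \<rho> 0 \<eta>) * nexp (z \<bullet> \<eta>))"
    by (rule integral_mult_right_zero)
  finally show ?thesis by (simp add: kap_def)
qed

lemma norm_kap: "norm (kap k z) = norm (kap 0 z)"
  unfolding kap_shift[of k z] by (simp only: norm_mult norm_cexp_i mult_1)

lemma rapid_kap: "rapid (kap k)"
  unfolding rapid_def norm_kap[of k]
proof (intro conjI allI measurable_kap)
  fix m
  obtain C where C: "\<And>z. norm (LINT \<eta>|lborel. complex_of_real (freq_decomp \<rho> 0 \<eta>) * nexp (z \<bullet> \<eta>)) \<le> C * wt m z"
    using fourier_decay[OF freq_decomp_0_smooth freq_decomp_0_vanish] by blast
  have "norm (kap 0 z) \<le> (C / (2 * pi) ^ CARD('n)) * wt m z" for z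
    using C[of z] by (simp add: kap_def norm_divide norm_mult norm_power divide_right_mono)
  then show "\<exists>C. \<forall>z. norm (kap 0 z) \<le> C * wt m z" by blast
qed

lemma kap_integrable: "integrable lborel (kap k)"
  by (rule rapid_integrable[OF rapid_kap])

lemma hat_kap: "hat (kap k) \<xi> = of_real (freq_decomp \<rho> k \<xi>)"
  unfolding hat_def
proof (rule fourier_inversion)
  show "kap k z = (LINT \<eta>|lborel. of_real (freq_decomp \<rho> k \<eta>) * nexp (z \<bullet> \<eta>)) / of_real ((2 * pi) ^ DIM(real^'n))" for z
    by (simp add: kap_def)
  show "continuous_on UNIV (\<lambda>\<xi>. complex_of_real (freq_decomp \<rho> k \<xi>))"
    by (intro continuous_intros freq_decomp_continuous)
  show "norm (complex_of_real (freq_decomp \<rho> k x)) \<le> 1" for x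
    using freq_decomp_bounds by simp
qed (simp_all only: freq_decomp_integrable kap_integrable)

lemma hat_kap_translate: "hat (\<lambda>x. kap k (x - y)) \<xi> = iexp (y \<bullet> \<xi>) * of_real (freq_decomp \<rho> k \<xi>)"
proof -
  have "hat (\<lambda>x. kap k (x - y)) \<xi> = (LINT x|lborel. kap k x * iexp ((y + x) \<bullet> \<xi>))"
    unfolding hat_def by (subst integral_affine_euclidean[where c=1 and t=y]) auto
  also have "\<dots> = (LINT x|lborel. iexp (y \<bullet> \<xi>) * (kap k x * iexp (x \<bullet> \<xi>)))"
    by (simp add: inner_add_left ring_distribs exp_add mult_ac)
  also have "\<dots> = iexp (y \<bullet> \<xi>) * hat (kap k) \<xi>"
    unfolding hat_def by (rule integral_mult_right_zero)
  finally show ?thesis by (simp add: hat_kap)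
qed

text \<open>Insert the integral that defines \<open>kap m\<close> and exchange the integrals:
  multiplication by the kernel superposes translates of \<open>hat v\<close> by the frequencies in
  the window \<open>m\<close>.\<close>

lemma hat_mult_kap:
  assumes v: "integrable lborel v"
  shows "hat (\<lambda>x. v x * kap m (b - x)) \<xi>
    = (LINT \<eta>|lborel. of_real (freq_decomp \<rho> m \<eta>) * nexp (b \<bullet> \<eta>) * hat v (\<xi> + \<eta>)) / of_real ((2 * pi) ^ CARD('n))"
proof -
  note [measurable] = borel_measurable_integrable[OF v]
  let ?c = "complex_of_real ((2 * pi) ^ CARD('n))"
  let ?F = "\<lambda>x \<eta>. v x * iexp (x \<bullet> \<xi>) * (of_real (freq_decomp \<rho> m \<eta>) * nexp ((b - x) \<bullet> \<eta>))"
  have "integrable (lborel \<Otimes>\<^sub>M lborel) (\<lambda>(x, \<eta>). ?F x \<eta>)"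
    by (rule lborel_pair.integrable_pair_bound[OF _ integrable_norm[OF v] integrable_norm[OF freq_decomp_integrable[of m]]])
       (auto simp: norm_mult)
  from lborel_pair.Fubini_integral[OF this]
  have fub: "(LINT x|lborel. (LINT \<eta>|lborel. ?F x \<eta>)) = (LINT \<eta>|lborel. (LINT x|lborel. ?F x \<eta>))" by simp
  have "v x * kap m (b - x) * iexp (x \<bullet> \<xi>) = (LINT \<eta>|lborel. ?F x \<eta>) / ?c" for x
    unfolding kap_def by (simp only: integral_mult_right_zero) (simp add: mult_ac)
  then have "hat (\<lambda>x. v x * kap m (b - x)) \<xi> = (LINT x|lborel. (LINT \<eta>|lborel. ?F x \<eta>)) / ?c"
    unfolding hat_def by simp
  moreover have "(LINT x|lborel. ?F x \<eta>) = of_real (freq_decomp \<rho> m \<eta>) * nexp (b \<bullet> \<eta>) * hat v (\<xi> + \<eta>)" for \<eta>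
  proof -
    have "?F x \<eta> = of_real (freq_decomp \<rho> m \<eta>) * nexp (b \<bullet> \<eta>) * (v x * iexp (x \<bullet> (\<xi> + \<eta>)))" for x
      by (simp add: inner_diff_left inner_add_right ring_distribs exp_add exp_diff exp_minus field_simps)
    then show ?thesis unfolding hat_def by (simp only: integral_mult_right_zero)
  qed
  ultimately show ?thesis using fub by simp
qed

text \<open>\<open>cv (kap m) f\<close> is a superposition over \<open>b\<close> of the functions
  \<open>x \<mapsto> kap m (b - x)\<close>. For each \<open>b\<close> the formula of
  \<open>hat_mult_kap\<close> makes the transform at \<open>\<xi>\<close> vanish, and
  \<open>integral_mult_cv\<close> performs the superposition.\<close>

lemma hat_mult_cv_eq_0:
  assumes v: "rapid v" and f: "tempered f"
    and 0: "\<And>\<eta>. freq_decomp \<rho> m \<eta> \<noteq> 0 \<Longrightarrow> hat v (\<xi> + \<eta>) = 0"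
  shows "hat (\<lambda>x. v x * cv (kap m) f x) \<xi> = 0"
proof -
  have e: "rapid (\<lambda>x. v x * iexp (x \<bullet> \<xi>))"
    by (rule rapid_mult_growth[OF v, of _ 1 0]) auto
  have "(\<lambda>\<eta>. of_real (freq_decomp \<rho> m \<eta>) * nexp (b \<bullet> \<eta>) * hat v (\<xi> + \<eta>)) = (\<lambda>\<eta>. 0)" for b
    using 0 by fastforce
  then have "hat (\<lambda>x. v x * kap m (b - x)) \<xi> = 0" for b
    using hat_mult_kap[OF rapid_integrable[OF v], of m b \<xi>] by simp
  then have "(LINT x|lborel. v x * iexp (x \<bullet> \<xi>) * kap m (b - x)) = 0" for b
    by (simp add: hat_def mult_ac)
  then have "(LINT x|lborel. v x * iexp (x \<bullet> \<xi>) * cv (kap m) f x) = 0"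
    using integral_mult_cv[OF f rapid_kap e] by simp
  then show ?thesis by (simp add: hat_def mult_ac)
qed

text \<open>The spectrum of a product lies in the sum of the spectra.\<close>

lemma cv_mult_eq_0:
  assumes f: "tempered f" and g: "tempered g" and far: "\<exists>i. 3 < \<bar>k $ i - l $ i - m $ i\<bar>"
  shows "cv (kap k) (\<lambda>x. cv (kap l) f x * cv (kap m) g x) y = 0"
proof -
  let ?v = "\<lambda>x. kap k (x - y)"
  have v: "rapid ?v" by (rule rapid_shift[OF rapid_kap])
  have v1: "rapid (\<lambda>x. ?v x * cv (kap l) f x)" by (rule rapid_mult_cv[OF v f rapid_kap])
  \<comment> \<open>The convolution at \<open>y\<close> is the integral of a product of three
    functions, that is, its \<open>hat\<close> at frequency 0; the two factors from \<open>f\<close>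
    and \<open>g\<close> are removed one at a time.\<close>
  have "hat (\<lambda>x. ?v x * cv (kap l) f x * cv (kap m) g x) 0 = 0"
  proof (rule hat_mult_cv_eq_0[OF v1 g])
    fix \<eta> assume \<eta>: "freq_decomp \<rho> m \<eta> \<noteq> 0"
    show "hat (\<lambda>x. ?v x * cv (kap l) f x) (0 + \<eta>) = 0"
    proof (rule hat_mult_cv_eq_0[OF v f])
      fix \<zeta> assume \<zeta>: "freq_decomp \<rho> l \<zeta> \<noteq> 0"
      obtain i where i: "3 < \<bar>k $ i - l $ i - m $ i\<bar>" using far by blast
      have "freq_decomp \<rho> k (0 + \<eta> + \<zeta>) = 0"
      proof (rule ccontr)
        assume "freq_decomp \<rho> k (0 + \<eta> + \<zeta>) \<noteq> 0"
        \<comment> \<open>In every coordinate each of the three windows deviates from its lattice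
          point by at most 1, whence the bound 3.\<close>
        from freq_decomp_support[OF this, of i] freq_decomp_support[OF \<eta>, of i] freq_decomp_support[OF \<zeta>, of i]
        have "\<bar>real_of_int (k $ i - l $ i - m $ i)\<bar> \<le> 3" by simp
        then show False using i by linarith
      qed
      then show "hat ?v (0 + \<eta> + \<zeta>) = 0" by (simp add: hat_kap_translate)
    qed
  qed
  then show ?thesis by (simp add: hat_def cv_def mult_ac)
qed

end

section \<open>Representation of the box operators\<close>

text \<open>The spaces are defined over \<open>lebesgue\<close>, while product measurability and
  Fubini are used for Borel functions on \<open>lborel\<close>; a representative connects the
  two.\<close>

lemma completion_borel_representative:
  fixes f :: "'a \<Rightarrow> complex"
  assumes "f \<in> borel_measurable (completion M)"
  shows "\<exists>f'\<in>borel_measurable M. AE x in M. f x = f' x"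
proof -
  have "(\<lambda>x. Re (f x)) \<in> borel_measurable (completion M)"
    using assms by measurable
  from completion_ex_borel_measurable_real[OF this]
  obtain a where a[measurable]: "a \<in> borel_measurable M" and ae_a: "AE x in M. Re (f x) = a x" by (elim bexE)
  have "(\<lambda>x. Im (f x)) \<in> borel_measurable (completion M)"
    using assms by measurable
  from completion_ex_borel_measurable_real[OF this]
  obtain b where b[measurable]: "b \<in> borel_measurable M" and ae_b: "AE x in M. Im (f x) = b x" by (elim bexE)
  show ?thesis
  proof
    show "(\<lambda>x. of_real (a x) + \<i> * of_real (b x)) \<in> borel_measurable M"
      by measurable
    show "AE x in M. f x = of_real (a x) + \<i> * of_real (b x)"
      using ae_a ae_b by eventually_elim (simp add: complex_eq_iff)
  qed
qed

lemma Lnorm_completion: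
  assumes u: "u \<in> borel_measurable M"
  shows "Lnorm (completion M) p u = Lnorm M p u"
  using u measurable_completion[OF u]
  by (simp add: Lnorm_def nn_integral_completion esssup_eq_AE AE_completion_iff)

lemma Lp_norm_eq_Lnorm: "Lp_norm p f = Lnorm lebesgue p (\<lambda>x. ennreal (norm (f x)))"
  unfolding Lp_norm_def Lnorm_def by (simp add: infinity_ennreal_def)

lemma Lp_norm_cong_borel:
  assumes f: "f \<in> borel_measurable lebesgue" and f': "f' \<in> borel_measurable borel"
    and ae: "AE x in lborel. f x = f' x"
  shows "Lp_norm p f = Lpn p f'"
proof -
  have "Lnorm lebesgue p (\<lambda>x. ennreal (norm (f x))) = Lnorm lebesgue p (\<lambda>x. ennreal (norm (f' x)))"
    using f measurable_completion[of f' lborel borel] f' AE_completion[OF ae]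
    by (intro Lnorm_cong_AE) (auto elim!: eventually_mono)
  also have "\<dots> = Lpn p f'"
    using f' by (intro Lnorm_completion) auto
  finally show ?thesis by (simp add: Lp_norm_eq_Lnorm)
qed

lemma Lp_norm_borel: "f \<in> borel_measurable borel \<Longrightarrow> Lp_norm p f = Lpn p f"
  by (rule Lp_norm_cong_borel) (auto intro: measurable_completion)

lemma tempered_diff:
  assumes "tempered f" "tempered g" shows "tempered (\<lambda>x. f x - g x)"
  unfolding tempered_def
proof
  note [measurable] = tempered_measurable[OF assms(1)] tempered_measurable[OF assms(2)]
  let ?w = "wt (2 * CARD('a)) :: real^'a \<Rightarrow> real"
  show "(\<lambda>x. f x - g x) \<in> borel_measurable borel" by measurable
  show "integrable lborel (\<lambda>x. norm (f x - g x) * ?w x)"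
  proof (rule Bochner_Integration.integrable_bound)
    show "integrable lborel (\<lambda>x. norm (f x) * ?w x + norm (g x) * ?w x)"
      using assms by (simp add: tempered_def)
    have "norm (f x - g x) * ?w x \<le> (norm (f x) + norm (g x)) * ?w x" for x
      by (intro mult_right_mono norm_triangle_ineq4) simp
    then show "AE x in lborel. norm (norm (f x - g x) * ?w x) \<le> norm (norm (f x) * ?w x + norm (g x) * ?w x)"
      by (intro AE_I2) (simp add: ring_distribs abs_mult)
  qed measurable
qed

lemma AE_eq_if_dilates_eq:
  assumes u: "tempered u" and v: "tempered v" and K: "rapid K" and K0: "(LINT x|lborel. K x) \<noteq> 0"
    and eq: "\<And>b y. 1 \<le> b \<Longrightarrow> (LINT x|lborel. u x * K (b *\<^sub>R (x - y))) = (LINT x|lborel. v x * K (b *\<^sub>R (x - y)))"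
  shows "AE x in lborel. u x = v x"
proof -
  obtain C where C: "\<And>x. norm (K x) \<le> C * wt (2 * (2 * CARD('a))) x" using rapid_bound[OF K] by blast
  have d: "tempered (\<lambda>x. u x - v x)" using u v by (rule tempered_diff)
  have "AE x in lborel. u x - v x = 0"
  proof (rule AE_zero_dilates)
    show "norm (K x) \<le> C * wt (2 * (2 * DIM(real^'a))) x" for x using C by simp
    show "integrable lborel (\<lambda>x. norm (u x - v x) * wt (2 * DIM(real^'a)) x)"
      using d by (simp add: tempered_def)
    fix b :: real and y :: "real^'a" assume b: "1 \<le> b"
    have r: "rapid (\<lambda>x. K (b *\<^sub>R (x - y)))" by (rule rapid_shift[OF rapid_dilate[OF K b]])
    show "(LINT x|lborel. (u x - v x) * K (b *\<^sub>R (x - y))) = 0"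
      using integrable_tempered_rapid[OF u r] integrable_tempered_rapid[OF v r] eq[OF b]
      by (simp add: left_diff_distrib)
  qed (use K0 tempered_measurable[OF d] rapid_measurable[OF K] in simp_all)
  then show ?thesis by simp
qed

section \<open>Termwise integration of series of functions\<close>

lemma sigma_finite_count_space: "sigma_finite_measure (count_space (UNIV :: 'j::countable set))"
  by (simp add: sigma_finite_measure_count_space_countable)

text \<open>Minkowski's inequality gives the sum of the absolute values finite norm, hence makes it
  integrable against the decay of \<open>\<phi>\<close>; Fubini on the product with counting measure
  does the rest. As Bochner integrals over counting measure, the series take the value 0 where
  absolute convergence fails.\<close>

lemma integral_series_rapid:
  fixes U :: "'j::countable \<Rightarrow> real^'n::finite \<Rightarrow> complex"
  assumes [measurable]: "\<And>j. U j \<in> borel_measurable borel" and p: "1 \<le> p" and \<phi>: "rapid \<phi>"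
    and fin: "(csum (\<lambda>j. Lpn p (U j))) < \<infinity>"
  shows "(LINT x|lborel. (\<integral>j. U j x \<partial>count_space UNIV) * \<phi> x) = (\<integral>j. (LINT x|lborel. U j x * \<phi> x) \<partial>count_space UNIV)"
proof -
  let ?N = "2 * CARD('n)"
  interpret J: sigma_finite_measure "count_space (UNIV :: 'j set)" by (rule sigma_finite_count_space)
  interpret P: pair_sigma_finite lborel "count_space (UNIV :: 'j set)" ..
  note [measurable] = rapid_measurable[OF \<phi>]
  have U[measurable]: "(\<lambda>(x, j). U j x) \<in> borel_measurable (lborel \<Otimes>\<^sub>M count_space UNIV)"
    by (rule measurable_count_pair) simp
  have \<phi>'[measurable]: "(\<lambda>z. \<phi> (fst z)) \<in> borel_measurable (lborel \<Otimes>\<^sub>M count_space (UNIV :: 'j set))"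
    by measurable
  obtain C where C: "0 \<le> C" "\<And>x. norm (\<phi> x) \<le> C * wt ?N x" using rapid_bound[OF \<phi>] by blast
  define S where "S x = (csum (\<lambda>j. ennreal (norm (U j x))))" for x
  have S[measurable]: "S \<in> borel_measurable borel"
    unfolding S_def[abs_def] using U by (subst measurable_lborel2[symmetric]) measurable
  have "Lnorm lborel p S < \<infinity>"
    using Lnorm_sum_le[OF lborel.sigma_finite_measure_axioms p, of "\<lambda>j x. ennreal (norm (U j x))"] fin
    by (auto simp: S_def[abs_def])
  then have S_wt: "(\<integral>\<^sup>+x. S x * ennreal (wt ?N x) \<partial>lborel) < \<infinity>"
    using p by (intro nn_integral_mult_wt_less_top) auto
  have "integrable (lborel \<Otimes>\<^sub>M count_space UNIV) (\<lambda>(x, j). U j x * \<phi> x)"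
  proof (rule integrableI_bounded)
    show m: "(\<lambda>(x, j). U j x * \<phi> x) \<in> borel_measurable (lborel \<Otimes>\<^sub>M count_space UNIV)"
      by (rule measurable_count_pair) simp
    have "(\<integral>\<^sup>+z. ennreal (norm (case z of (x, j) \<Rightarrow> U j x * \<phi> x)) \<partial>(lborel \<Otimes>\<^sub>M count_space UNIV))
        = (\<integral>\<^sup>+x. (csum (\<lambda>j. ennreal (norm (U j x)) * ennreal (norm (\<phi> x)))) \<partial>lborel)"
      using m by (subst J.nn_integral_fst[symmetric]) (auto simp: norm_mult ennreal_mult)
    also have "\<dots> = (\<integral>\<^sup>+x. S x * ennreal (norm (\<phi> x)) \<partial>lborel)"
      by (simp add: S_def nn_integral_multc)
    also have "\<dots> \<le> (\<integral>\<^sup>+x. ennreal C * (S x * ennreal (wt ?N x)) \<partial>lborel)"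
    proof (intro nn_integral_mono)
      fix x
      have "ennreal (norm (\<phi> x)) \<le> ennreal C * ennreal (wt ?N x)"
        using C by (simp add: ennreal_leI flip: ennreal_mult)
      then have "S x * ennreal (norm (\<phi> x)) \<le> S x * (ennreal C * ennreal (wt ?N x))"
        by (rule mult_left_mono) simp
      then show "S x * ennreal (norm (\<phi> x)) \<le> ennreal C * (S x * ennreal (wt ?N x))"
        by (simp add: mult_ac)
    qed
    also have "\<dots> = ennreal C * (\<integral>\<^sup>+x. S x * ennreal (wt ?N x) \<partial>lborel)"
      by (rule nn_integral_cmult) measurable
    also have "\<dots> < \<infinity>" using S_wt by (simp add: ennreal_mult_less_top)
    finally show "(\<integral>\<^sup>+z. ennreal (norm (case z of (x, j) \<Rightarrow> U j x * \<phi> x)) \<partial>(lborel \<Otimes>\<^sub>M count_space UNIV)) < \<infinity>" .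
  qed
  from P.Fubini_integral[OF this] show ?thesis by simp
qed

context freq_window
begin

lemma two_pi_powr_square: "complex_of_real ((2 * pi) powr (- real CARD('n) / 2)) * (complex_of_real ((2 * pi) powr (- real CARD('n) / 2)) * z)
    = z / of_real ((2 * pi) ^ CARD('n))"
proof -
  have "(2 * pi) powr (- real CARD('n) / 2) * (2 * pi) powr (- real CARD('n) / 2) = (2 * pi) powr (- real CARD('n))"
    by (simp flip: powr_add)
  also have "\<dots> = inverse ((2 * pi) ^ CARD('n))"
    by (simp add: powr_minus powr_realpow)
  finally have "complex_of_real ((2 * pi) powr (- real CARD('n) / 2)) * complex_of_real ((2 * pi) powr (- real CARD('n) / 2)) = inverse (of_real ((2 * pi) ^ CARD('n)))"
    by (simp only: of_real_mult[symmetric] of_real_inverse[symmetric])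
  then show ?thesis by (simp only: mult.assoc[symmetric] divide_inverse mult.commute[of z])
qed

text \<open>After unfolding the transpositions in \<open>box_op\<close>, this is the function that
  \<open>f\<close> is paired with when \<open>\<box>\<^sub>k f\<close> is tested on
  \<open>\<phi>\<close>. The two normalising factors combine to the power of \<open>2 * pi\<close>
  in \<open>kap\<close>.\<close>

lemma fourier_mult_inv_fourier:
  assumes "\<phi> \<in> schwartz"
  shows "fourier (\<lambda>\<xi>. of_real (freq_decomp \<rho> k \<xi>) * inv_fourier \<phi> \<xi>) x = (LINT y|lborel. \<phi> y * kap k (x - y))"
proof -
  let ?c = "complex_of_real ((2 * pi) powr (- real CARD('n) / 2))"
  have r: "rapid \<phi>" using assms by (rule schwartz_rapid)
  note [measurable] = rapid_measurable[OF r]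
  have inv: "inv_fourier \<phi> \<xi> = ?c * hat \<phi> \<xi>" for \<xi>
    unfolding inv_fourier_def hat_def by (subst integral_completion) (auto simp: inner_commute)
  have [measurable]: "hat \<phi> \<in> borel_measurable borel"
    unfolding hat_def[abs_def] by measurable
  have "fourier (\<lambda>\<xi>. of_real (freq_decomp \<rho> k \<xi>) * inv_fourier \<phi> \<xi>) x
      = ?c * (LINT \<xi>|lborel. of_real (freq_decomp \<rho> k \<xi>) * (?c * hat \<phi> \<xi>) * exp (- \<i> * of_real (\<xi> \<bullet> x)))"
    unfolding fourier_def inv by (subst integral_completion) auto
  also have "(\<lambda>\<xi>. of_real (freq_decomp \<rho> k \<xi>) * (?c * hat \<phi> \<xi>) * exp (- \<i> * of_real (\<xi> \<bullet> x)))
      = (\<lambda>\<xi>. ?c * (of_real (freq_decomp \<rho> k \<xi>) * nexp (x \<bullet> \<xi>) * hat \<phi> (0 + \<xi>)))"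
    by (simp add: fun_eq_iff inner_commute mult_ac)
  also have "?c * (LINT \<xi>|lborel. ?c * (of_real (freq_decomp \<rho> k \<xi>) * nexp (x \<bullet> \<xi>) * hat \<phi> (0 + \<xi>)))
      = hat (\<lambda>y. \<phi> y * kap k (x - y)) 0"
    unfolding integral_mult_right_zero two_pi_powr_square hat_mult_kap[OF rapid_integrable[OF r]] ..
  finally show ?thesis by (simp add: hat_def)
qed

lemma box_op_eq:
  assumes \<phi>: "\<phi> \<in> schwartz" and f: "f \<in> borel_measurable lebesgue" and f': "tempered f'"
    and ae: "AE x in lborel. f x = f' x"
  shows "box_op \<rho> k f \<phi> = (LINT y|lborel. cv (kap k) f' y * \<phi> y)"
proof -
  have r: "rapid \<phi>" using \<phi> by (rule schwartz_rapid)
  note [measurable] = rapid_measurable[OF r] tempered_measurable[OF f']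
  have [measurable]: "f' \<in> borel_measurable lebesgue"
    using tempered_measurable[OF f'] by (intro measurable_completion) simp
  let ?\<Phi> = "\<lambda>x. \<integral>y. \<phi> y * kap k (x - y) \<partial>lborel"
  have "?\<Phi> \<in> borel_measurable borel" by measurable
  then have [measurable]: "?\<Phi> \<in> borel_measurable lebesgue"
    by (intro measurable_completion) simp
  have "box_op \<rho> k f \<phi> = (\<integral>x. f x * ?\<Phi> x \<partial>lebesgue)"
    unfolding box_op_def distr_inv_fourier_def distr_mult_def distr_fourier_def distr_of_fun_def
    by (simp only: fourier_mult_inv_fourier[OF \<phi>])
  also have "\<dots> = (\<integral>x. f' x * ?\<Phi> x \<partial>lebesgue)"
    using f AE_completion[OF ae] by (intro integral_cong_AE) (auto elim!: eventually_mono)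
  also have "\<dots> = (LINT x|lborel. f' x * ?\<Phi> x)"
    by (rule integral_completion) measurable
  also have "\<dots> = (LINT y|lborel. \<phi> y * cv (kap k) f' y)"
    by (rule integral_mult_cv[OF f' rapid_kap r, symmetric])
  finally show ?thesis by (simp add: mult.commute)
qed

lemma rho_vanish: "real CARD('n) < norm \<xi> \<Longrightarrow> \<rho> \<xi> = 0"
  using freq_decomp_0_vanish[of \<xi>] total_ge_1[of \<xi>] by (auto simp: freq_decomp_eq)

text \<open>A factor \<open>b \<ge> 1\<close> can only shrink the support, which stays in a ball of
  radius \<open>CARD('n) + norm y\<close>. The window thus supplies the Schwartz functions for
  \<open>AE_eq_if_dilates_eq\<close>.\<close>

lemma rho_dilate_schwartz: "(\<lambda>x. complex_of_real (\<rho> (b *\<^sub>R (x - y)))) \<in> schwartz" if b: "1 \<le> b"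
proof (rule schwartz_compact_support[where R="real CARD('n) + norm y"])
  show "smooth (\<lambda>x. \<rho> (b *\<^sub>R (x - y)))"
    using rho_smooth by (simp add: smooth_iff_Ck Ck_affine)
  fix x :: "real^'n" assume "real CARD('n) + norm y < norm x"
  then have "real CARD('n) < norm (x - y)" using norm_triangle_ineq2[of x y] by linarith
  also have "\<dots> \<le> norm (b *\<^sub>R (x - y))" using b mult_right_mono[of 1 b "norm (x - y)"] by simp
  finally show "\<rho> (b *\<^sub>R (x - y)) = 0" by (rule rho_vanish)
qed

lemma integral_rho_nonzero: "(LINT x|lborel. complex_of_real (\<rho> x)) \<noteq> 0"
proof -
  let ?Q = "cbox (\<chi> i. - (1/2)) (\<chi> i. 1/2) :: (real^'n) set"
  have s: "rapid (\<lambda>x. complex_of_real (\<rho> x))"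
    using schwartz_rapid[OF rho_dilate_schwartz[of 1 0]] by simp
  have i: "integrable lborel \<rho>" using rapid_integrable[OF s] by (simp add: complex_of_real_integrable_eq)
  have "measure lborel ?Q = (LINT x|lborel. indicator ?Q x)" by simp
  also have "\<dots> \<le> (LINT x|lborel. \<rho> x)"
  proof (rule integral_mono[OF _ i])
    show "integrable lborel (indicator ?Q :: real^'n \<Rightarrow> real)"
      by (intro integrable_real_indicator) (auto simp: emeasure_lborel_cbox_eq)
    show "indicator ?Q x \<le> \<rho> x" for x
    proof (cases "x \<in> ?Q")
      case True
      then have "- (1/2) \<le> x $ i \<and> x $ i \<le> 1/2" for i by (simp add: mem_box_cart)
      then have "\<bar>x $ i\<bar> \<le> 1/2" for i by (metis abs_leI minus_le_iff)
      then show ?thesis using rho_eq_1 by simp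
    qed (simp add: rho_ge_0)
  qed
  finally have "measure lborel ?Q \<le> (LINT x|lborel. \<rho> x)" .
  moreover have "measure lborel ?Q > 0"
    by (rule content_pos_lt) (auto simp: Basis_vec_def inner_axis)
  ultimately show ?thesis by simp
qed

text \<open>The infimum runs over functions that agree almost everywhere:
  \<open>cv (kap k) f'\<close> is one of them, and testing against translated dilates of
  \<open>\<rho>\<close> identifies any other with it.\<close>

lemma distr_Lp_norm_box_op:
  assumes p: "1 \<le> p" and f: "f \<in> borel_measurable lebesgue" and f'[measurable]: "f' \<in> borel_measurable borel"
    and ae: "AE x in lborel. f x = f' x" and fin: "Lpn p f' < \<infinity>"
  shows "distr_Lp_norm p (box_op \<rho> k f) = Lpn p (cv (kap k) f')"
proof (rule antisym)
  have tf: "tempered f'" using f' p fin by (rule tempered_if_Lnorm_finite)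
  have kap_fin: "(\<integral>\<^sup>+z. ennreal (norm (kap k z)) \<partial>lborel) < \<infinity>"
    using kap_integrable[of k] by (simp add: integrable_iff_bounded)
  have cv_fin: "Lpn p (cv (kap k) f') < \<infinity>"
    using Lnorm_norm_cv_le[OF p f' kap_integrable[of k]] kap_fin fin
    by (auto simp: ennreal_mult_less_top intro: order.strict_trans1)
  have cvm[measurable]: "cv (kap k) f' \<in> borel_measurable borel" by measurable
  have tcv: "tempered (cv (kap k) f')" using cvm p cv_fin by (rule tempered_if_Lnorm_finite)
  have rep: "box_op \<rho> k f \<phi> = distr_of_fun (cv (kap k) f') \<phi>" if "\<phi> \<in> schwartz" for \<phi>
    using rapid_measurable[OF schwartz_rapid[OF that]]
    unfolding box_op_eq[OF that f tf ae] distr_of_fun_def by (subst integral_completion) auto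
  show "distr_Lp_norm p (box_op \<rho> k f) \<le> Lpn p (cv (kap k) f')"
    unfolding distr_Lp_norm_def Lp_norm_borel[OF cvm, symmetric]
    using rep cv_fin cvm by (intro INF_lower) (auto simp: Lp_space_def Lp_norm_borel intro: measurable_completion)
  show "Lpn p (cv (kap k) f') \<le> distr_Lp_norm p (box_op \<rho> k f)"
    unfolding distr_Lp_norm_def
  proof (rule INF_greatest)
    fix h assume "h \<in> {h \<in> Lp_space p. \<forall>\<phi>\<in>schwartz. box_op \<rho> k f \<phi> = distr_of_fun h \<phi>}"
    then have h: "h \<in> borel_measurable lebesgue" "Lp_norm p h < \<infinity>"
      and h_rep: "\<And>\<phi>. \<phi> \<in> schwartz \<Longrightarrow> box_op \<rho> k f \<phi> = distr_of_fun h \<phi>"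
      by (auto simp: Lp_space_def)
    obtain h' where h'[measurable]: "h' \<in> borel_measurable borel" and hh': "AE x in lborel. h x = h' x"
      using completion_borel_representative[OF h(1)] by (auto elim!: bexE)
    have h_norm: "Lp_norm p h = Lpn p h'"
      by (rule Lp_norm_cong_borel[OF h(1) h' hh'])
    then have th: "tempered h'" using h(2) by (intro tempered_if_Lnorm_finite[OF h' p]) simp
    have "AE x in lborel. cv (kap k) f' x = h' x"
    proof (rule AE_eq_if_dilates_eq[OF tcv th _ integral_rho_nonzero])
      show "rapid (\<lambda>x. complex_of_real (\<rho> x))"
        using schwartz_rapid[OF rho_dilate_schwartz[of 1 0]] by simp
      fix b y assume b: "1 \<le> (b::real)"
      let ?\<phi> = "\<lambda>x. complex_of_real (\<rho> (b *\<^sub>R (x - y)))"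
      have s: "?\<phi> \<in> schwartz" using b by (rule rho_dilate_schwartz)
      note [measurable] = rapid_measurable[OF schwartz_rapid[OF s]]
      have "(\<lambda>x. h' x * ?\<phi> x) \<in> borel_measurable borel" by measurable
      then have m: "(\<lambda>x. h' x * ?\<phi> x) \<in> borel_measurable lebesgue"
        by (intro measurable_completion) simp
      have m\<phi>: "?\<phi> \<in> borel_measurable lebesgue"
        using rapid_measurable[OF schwartz_rapid[OF s]] by (intro measurable_completion) simp
      have "(LINT x|lborel. cv (kap k) f' x * ?\<phi> x) = distr_of_fun h ?\<phi>"
        using h_rep[OF s] box_op_eq[OF s f tf ae] by simp
      also have "\<dots> = (\<integral>x. h' x * ?\<phi> x \<partial>lebesgue)"
        unfolding distr_of_fun_def using AE_completion[OF hh'] h(1) m m\<phi>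
        by (intro integral_cong_AE) (auto elim!: eventually_mono)
      also have "\<dots> = (LINT x|lborel. h' x * ?\<phi> x)"
        by (rule integral_completion) simp
      finally show "(LINT x|lborel. cv (kap k) f' x * ?\<phi> x) = (LINT x|lborel. h' x * ?\<phi> x)" .
    qed
    then have "Lpn p (cv (kap k) f') = Lpn p h'"
      by (intro Lnorm_cong_AE) auto
    then show "Lpn p (cv (kap k) f') \<le> Lp_norm p h"
      by (simp add: h_norm)
  qed
qed

section \<open>Reconstruction from the frequency pieces\<close>

lemma hat_kap_dilate:
  assumes b: "1 \<le> b"
  shows "hat (\<lambda>x. kap 0 (b *\<^sub>R (x - y))) \<eta>
    = of_real (inverse b ^ CARD('n)) * (iexp (y \<bullet> \<eta>) * of_real (freq_decomp \<rho> 0 (\<eta> /\<^sub>R b)))"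
proof -
  have "hat (\<lambda>x. kap 0 (b *\<^sub>R (x - y))) \<eta>
      = \<bar>inverse b\<bar> ^ CARD('n) *\<^sub>R (LINT t|lborel. kap 0 (b *\<^sub>R ((y + inverse b *\<^sub>R t) - y)) * iexp ((y + inverse b *\<^sub>R t) \<bullet> \<eta>))"
    unfolding hat_def using b by (subst integral_affine_euclidean[where c="inverse b" and t=y]) auto
  also have "(\<lambda>t. kap 0 (b *\<^sub>R ((y + inverse b *\<^sub>R t) - y)) * iexp ((y + inverse b *\<^sub>R t) \<bullet> \<eta>))
      = (\<lambda>t. iexp (y \<bullet> \<eta>) * (kap 0 t * iexp (t \<bullet> (\<eta> /\<^sub>R b))))"
    using b by (auto simp: fun_eq_iff inner_add_left ring_distribs exp_add)
  also have "(LINT t|lborel. iexp (y \<bullet> \<eta>) * (kap 0 t * iexp (t \<bullet> (\<eta> /\<^sub>R b))))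
      = iexp (y \<bullet> \<eta>) * hat (kap 0) (\<eta> /\<^sub>R b)"
    unfolding hat_def by (rule integral_mult_right_zero)
  finally show ?thesis using b by (simp add: hat_kap scaleR_conv_of_real)
qed

text \<open>The transform of the dilated kernel is explicit and compactly supported, so the
  substitution \<open>\<eta> = b *\<^sub>R \<zeta>\<close> leads straight back to the definition of
  \<open>kap 0\<close>.\<close>

lemma hat_inversion_kap_dilate:
  assumes b: "1 \<le> b"
  shows "(LINT \<eta>|lborel. nexp (x \<bullet> \<eta>) * hat (\<lambda>x. kap 0 (b *\<^sub>R (x - y))) \<eta>) / of_real ((2 * pi) ^ CARD('n))
    = kap 0 (b *\<^sub>R (x - y))"
proof -
  let ?h = "\<lambda>\<eta>. nexp (x \<bullet> \<eta>) * hat (\<lambda>x. kap 0 (b *\<^sub>R (x - y))) \<eta>"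
  have [measurable]: "?h \<in> borel_measurable borel"
    unfolding hat_kap_dilate[OF b] by measurable
  have "(LINT \<eta>|lborel. ?h \<eta>) = \<bar>b\<bar> ^ CARD('n) *\<^sub>R (LINT \<zeta>|lborel. ?h (0 + b *\<^sub>R \<zeta>))"
    using b by (subst integral_affine_euclidean[where c=b and t=0]) auto
  also have "?h (0 + b *\<^sub>R \<zeta>) = of_real (inverse b ^ CARD('n)) * (of_real (freq_decomp \<rho> 0 \<zeta>) * nexp ((b *\<^sub>R (x - y)) \<bullet> \<zeta>))" for \<zeta>
    unfolding hat_kap_dilate[OF b] using b
    by (simp add: inner_diff_left right_diff_distrib exp_diff exp_minus field_simps)
  then have "(\<lambda>\<zeta>. ?h (0 + b *\<^sub>R \<zeta>)) = (\<lambda>\<zeta>. of_real (inverse b ^ CARD('n)) * (of_real (freq_decomp \<rho> 0 \<zeta>) * nexp ((b *\<^sub>R (x - y)) \<bullet> \<zeta>)))"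
    by blast
  also have "\<bar>b\<bar> ^ CARD('n) *\<^sub>R (LINT \<zeta>|lborel. of_real (inverse b ^ CARD('n)) * (of_real (freq_decomp \<rho> 0 \<zeta>) * nexp ((b *\<^sub>R (x - y)) \<bullet> \<zeta>)))
     = (LINT \<zeta>|lborel. of_real (freq_decomp \<rho> 0 \<zeta>) * nexp ((b *\<^sub>R (x - y)) \<bullet> \<zeta>))"
    unfolding integral_mult_right_zero using b by (simp add: scaleR_conv_of_real power_inverse)
  finally show ?thesis by (simp only: kap_def)
qed

text \<open>Against a test function with compact frequency support only finitely many pieces contribute.\<close>

lemma AE_eq_sum_pieces:
  assumes p: "1 \<le> p" and f[measurable]: "f \<in> borel_measurable borel" and f_fin: "Lpn p f < \<infinity>"
    and fin: "(csum (\<lambda>l. Lpn p (cv (kap l) f))) < \<infinity>"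
  shows "AE x in lborel. f x = (\<integral>l. cv (kap l) f x \<partial>count_space UNIV)"
proof -
  interpret J: sigma_finite_measure "count_space (UNIV :: (int^'n) set)" by (rule sigma_finite_count_space)
  define F where "F x = (\<integral>l. cv (kap l) f x \<partial>count_space UNIV)" for x
  have cvm: "(\<lambda>(x, l). cv (kap l) f x) \<in> borel_measurable (lborel \<Otimes>\<^sub>M count_space UNIV)"
    by (rule measurable_count_pair) simp
  have F[measurable]: "F \<in> borel_measurable borel"
    unfolding F_def[abs_def] using cvm by (subst measurable_lborel2[symmetric]) measurable
  have "Lpn p F \<le> Lnorm lborel p (\<lambda>x. \<integral>\<^sup>+l. ennreal (norm (cv (kap l) f x)) \<partial>count_space UNIV)"
    by (intro Lnorm_mono_AE p AE_I2) (auto simp: F_def norm_integral_le_nn_integral)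
  also have "\<dots> \<le> (csum (\<lambda>l. Lpn p (cv (kap l) f)))"
    by (rule Lnorm_sum_le[OF lborel.sigma_finite_measure_axioms p]) simp
  finally have tF: "tempered F" using fin by (intro tempered_if_Lnorm_finite[OF F p]) simp
  have tf: "tempered f" using f p f_fin by (rule tempered_if_Lnorm_finite)
  have "AE x in lborel. f x = F x"
  \<comment> \<open>Dilates of \<open>kap 0\<close> are chosen because their transforms vanish
    outside a ball of radius \<open>b * CARD('n)\<close>.\<close>
  proof (rule AE_eq_if_dilates_eq[OF tf tF rapid_kap[of 0]])
    have "(LINT x|lborel. kap 0 x) = of_real (freq_decomp \<rho> 0 0)"
      using hat_kap[of 0 0] by (simp add: hat_def)
    moreover have "freq_decomp \<rho> 0 0 > 0"
      using rho_eq_1[of 0] total_ge_1[of 0] by (simp add: freq_decomp_eq)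
    ultimately show "(LINT x|lborel. kap 0 x) \<noteq> 0" by simp
    fix b y assume b: "1 \<le> (b::real)"
    define \<phi> where "\<phi> x = kap 0 (b *\<^sub>R (x - y))" for x
    have r: "rapid \<phi>" unfolding \<phi>_def[abs_def] by (rule rapid_shift[OF rapid_dilate[OF rapid_kap b]])
    \<comment> \<open>\<open>\<psi> l\<close> is the part of \<open>\<phi>\<close> with frequencies
      in the window \<open>l\<close>: what \<open>\<phi>\<close> becomes when the convolution with
      \<open>kap l\<close> is moved onto it.\<close>
    define \<psi> where "\<psi> l x = (LINT z|lborel. \<phi> z * kap l (x - z))" for l x
    \<comment> \<open>Frequencies of \<open>\<phi>\<close> have coordinates of modulus up to
      \<open>b * CARD('n)\<close>, and a window reaches 1 beyond its lattice point.\<close>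
    define M where "M = \<lceil>b * real CARD('n)\<rceil> + 1"
    define L :: "(int^'n) set" where "L = {l. \<forall>i. - M \<le> l $ i \<and> l $ i \<le> M}"
    have finL: "finite L" unfolding L_def by (rule finite_int_vec_box)
    have \<psi>: "\<psi> l x = (LINT \<eta>|lborel. of_real (freq_decomp \<rho> l \<eta>) * nexp (x \<bullet> \<eta>) * hat \<phi> \<eta>) / of_real ((2 * pi) ^ CARD('n))" for l x
      using hat_mult_kap[OF rapid_integrable[OF r], of l x 0] by (simp add: \<psi>_def hat_def)
    have inL: "l \<in> L" if "freq_decomp \<rho> l \<eta> \<noteq> 0" "hat \<phi> \<eta> \<noteq> 0" for l \<eta>
    proof -
      have "freq_decomp \<rho> 0 (\<eta> /\<^sub>R b) \<noteq> 0"
        using that(2) unfolding \<phi>_def[abs_def] hat_kap_dilate[OF b] by auto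
      then have "norm (\<eta> /\<^sub>R b) \<le> real CARD('n)" using freq_decomp_0_vanish by (meson not_le)
      then have "norm \<eta> \<le> b * real CARD('n)" using b by (simp add: field_simps)
      then have \<eta>: "\<bar>\<eta> $ i\<bar> \<le> b * real CARD('n)" for i using component_le_norm_cart[of \<eta> i] by linarith
      have "\<bar>real_of_int (l $ i)\<bar> \<le> b * real CARD('n) + 1" for i
        using \<eta>[of i] freq_decomp_support[OF that(1), of i] by linarith
      moreover have "b * real CARD('n) + 1 \<le> real_of_int M"
        by (simp add: M_def)
      ultimately have "\<bar>real_of_int (l $ i)\<bar> \<le> real_of_int M" for i
        by (rule order_trans)
      then have "- M \<le> l $ i \<and> l $ i \<le> M" for i
        by (metis abs_le_iff minus_le_iff of_int_abs of_int_le_iff)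
      then show ?thesis by (simp add: L_def)
    qed
    have \<psi>_0: "\<psi> l x = 0" if "l \<notin> L" for l x
    proof -
      have "(\<lambda>\<eta>. of_real (freq_decomp \<rho> l \<eta>) * nexp (x \<bullet> \<eta>) * hat \<phi> \<eta>) = (\<lambda>\<eta>. 0)"
        using that inL by fastforce
      then show ?thesis by (simp add: \<psi>)
    qed
    have hat_int: "integrable lborel (\<lambda>\<eta>. of_real (freq_decomp \<rho> l \<eta>) * nexp (x \<bullet> \<eta>) * hat \<phi> \<eta>)" for l x
    proof (rule Bochner_Integration.integrable_bound[OF integrable_mult_right[OF freq_decomp_integrable[of l], of "of_real (inverse b ^ CARD('n))"]])
      show "AE \<eta> in lborel. norm (of_real (freq_decomp \<rho> l \<eta>) * nexp (x \<bullet> \<eta>) * hat \<phi> \<eta>)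
          \<le> norm (complex_of_real (inverse b ^ CARD('n)) * complex_of_real (freq_decomp \<rho> l \<eta>))"
      proof (rule AE_I2)
        fix \<eta> :: "real^'n"
        have "norm (hat \<phi> \<eta>) \<le> inverse b ^ CARD('n)"
          unfolding \<phi>_def[abs_def] hat_kap_dilate[OF b] norm_mult
          using b freq_decomp_bounds[of 0 "\<eta> /\<^sub>R b"]
          by (simp add: norm_power norm_inverse mult_left_le)
        then have "\<bar>freq_decomp \<rho> l \<eta>\<bar> * norm (hat \<phi> \<eta>) \<le> \<bar>freq_decomp \<rho> l \<eta>\<bar> * inverse b ^ CARD('n)"
          by (intro mult_left_mono) auto
        then show "norm (of_real (freq_decomp \<rho> l \<eta>) * nexp (x \<bullet> \<eta>) * hat \<phi> \<eta>)
          \<le> norm (complex_of_real (inverse b ^ CARD('n)) * complex_of_real (freq_decomp \<rho> l \<eta>))"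
          using b by (simp add: norm_mult mult.commute norm_power norm_inverse)
      qed
      show "(\<lambda>\<eta>. of_real (freq_decomp \<rho> l \<eta>) * nexp (x \<bullet> \<eta>) * hat \<phi> \<eta>) \<in> borel_measurable lborel"
        unfolding \<phi>_def[abs_def] hat_kap_dilate[OF b] by measurable
    qed
    have sum_\<psi>: "(\<Sum>l\<in>L. \<psi> l x) = \<phi> x" for x
    proof -
      let ?E = "\<lambda>\<eta>. nexp (x \<bullet> \<eta>)"
      have "(\<Sum>l\<in>L. \<psi> l x) = (\<Sum>l\<in>L. \<integral>\<eta>. of_real (freq_decomp \<rho> l \<eta>) * ?E \<eta> * hat \<phi> \<eta> \<partial>lborel) / of_real ((2 * pi) ^ CARD('n))"
        by (simp only: \<psi> sum_divide_distrib)
      also have "(\<Sum>l\<in>L. \<integral>\<eta>. of_real (freq_decomp \<rho> l \<eta>) * ?E \<eta> * hat \<phi> \<eta> \<partial>lborel)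
          = (LINT \<eta>|lborel. (\<Sum>l\<in>L. of_real (freq_decomp \<rho> l \<eta>) * ?E \<eta> * hat \<phi> \<eta>))"
        by (rule Bochner_Integration.integral_sum[symmetric]) (rule hat_int)
      also have "(\<lambda>\<eta>. \<Sum>l\<in>L. of_real (freq_decomp \<rho> l \<eta>) * ?E \<eta> * hat \<phi> \<eta>) = (\<lambda>\<eta>. ?E \<eta> * hat \<phi> \<eta>)"
      proof
        fix \<eta>
        show "(\<Sum>l\<in>L. of_real (freq_decomp \<rho> l \<eta>) * ?E \<eta> * hat \<phi> \<eta>) = ?E \<eta> * hat \<phi> \<eta>"
        proof (cases "hat \<phi> \<eta> = 0")
          case False
          \<comment> \<open>On the spectrum of \<open>\<phi>\<close> the windows in \<open>L\<close>
            already form a partition of unity.\<close>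
          then have "(\<Sum>l\<in>L. freq_decomp \<rho> l \<eta>) = 1" by (intro freq_decomp_sum finL) (use inL in auto)
          then have "(\<Sum>l\<in>L. complex_of_real (freq_decomp \<rho> l \<eta>)) = 1" by (metis of_real_1 of_real_sum)
          then show ?thesis by (simp flip: sum_distrib_right)
        qed simp
      qed
      also have "(LINT \<eta>|lborel. ?E \<eta> * hat \<phi> \<eta>) / of_real ((2 * pi) ^ CARD('n)) = \<phi> x"
        unfolding \<phi>_def[abs_def] by (rule hat_inversion_kap_dilate[OF b])
      finally show ?thesis .
    qed
    have piece: "(LINT x|lborel. cv (kap l) f x * \<phi> x) = (LINT x|lborel. f x * \<psi> l x)" for l
      using integral_mult_cv[OF tf rapid_kap r, of l] by (simp add: \<psi>_def mult.commute)
    have "(LINT x|lborel. F x * \<phi> x) = (\<integral>l. (LINT x|lborel. cv (kap l) f x * \<phi> x) \<partial>count_space UNIV)"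
      unfolding F_def by (rule integral_series_rapid[OF _ p r fin]) simp
    also have "\<dots> = (\<Sum>l\<in>L. \<integral>x. cv (kap l) f x * \<phi> x \<partial>lborel)"
    proof (subst lebesgue_integral_count_space_finite_support)
      have sub: "{l \<in> UNIV. (LINT x|lborel. cv (kap l) f x * \<phi> x) \<noteq> 0} \<subseteq> L"
        using \<psi>_0 by (force simp: piece)
      then show "finite {l \<in> UNIV. (LINT x|lborel. cv (kap l) f x * \<phi> x) \<noteq> 0}"
        using finL by (rule finite_subset)
      show "(\<Sum>l | l \<in> UNIV \<and> (LINT x|lborel. cv (kap l) f x * \<phi> x) \<noteq> 0. \<integral>x. cv (kap l) f x * \<phi> x \<partial>lborel)
          = (\<Sum>l\<in>L. \<integral>x. cv (kap l) f x * \<phi> x \<partial>lborel)"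
        using sub by (intro sum.mono_neutral_left finL) auto
    qed
    also have "\<dots> = (LINT x|lborel. \<phi> x * (\<Sum>l\<in>L. cv (kap l) f x))"
      using rapid_integrable[OF rapid_mult_cv[OF r tf rapid_kap]]
      by (subst Bochner_Integration.integral_sum[symmetric]) (simp_all add: sum_distrib_left mult.commute)
    \<comment> \<open>Collecting the finitely many kernels into one lets the transposition be
      applied a single time; the sum then falls on \<open>\<phi>\<close> and reproduces it.\<close>
    also have "(\<lambda>x. \<Sum>l\<in>L. cv (kap l) f x) = cv (\<lambda>z. \<Sum>l\<in>L. kap l z) f"
      unfolding cv_def using integrable_tempered_rapid[OF tf rapid_shift[OF rapid_kap]]
      by (subst Bochner_Integration.integral_sum[symmetric]) (simp_all add: fun_eq_iff sum_distrib_left)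
    also have "(LINT x|lborel. \<phi> x * cv (\<lambda>z. \<Sum>l\<in>L. kap l z) f x) = (LINT x|lborel. f x * (LINT z|lborel. \<phi> z * (\<Sum>l\<in>L. kap l (x - z))))"
    proof (rule integral_mult_cv[OF tf _ r])
      show "rapid (\<lambda>z. \<Sum>l\<in>L. kap l z)"
        unfolding rapid_def
      proof (intro conjI allI)
        fix m
        obtain C where C: "\<And>z. norm (kap 0 z) \<le> C * wt m z" using rapid_bound[OF rapid_kap[of 0]] by blast
        have "norm (\<Sum>l\<in>L. kap l z) \<le> (real (card L) * C) * wt m z" for z
        proof -
          have "norm (\<Sum>l\<in>L. kap l z) \<le> (\<Sum>l\<in>L. norm (kap l z))" by (rule norm_sum)
          also have "\<dots> \<le> (\<Sum>l\<in>L. C * wt m z)"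
          proof (rule sum_mono)
            fix l show "norm (kap l z) \<le> C * wt m z" using C[of z] norm_kap[of l z] by simp
          qed
          finally show ?thesis by simp
        qed
        then show "\<exists>C. \<forall>x. norm (\<Sum>l\<in>L. kap l x) \<le> C * wt m x" by blast
      qed measurable
    qed
    also have "\<dots> = (LINT x|lborel. f x * \<phi> x)"
    proof -
      have "(LINT z|lborel. \<phi> z * (\<Sum>l\<in>L. kap l (x - z))) = \<phi> x" for x
        using rapid_integrable[OF rapid_mult[OF r rapid_reflect[OF rapid_kap]]]
        by (simp add: sum_distrib_left \<psi>_def[symmetric] sum_\<psi>)
      then show ?thesis by simp
    qed
    finally show "(LINT x|lborel. f x * kap 0 (b *\<^sub>R (x - y))) = (LINT x|lborel. F x * kap 0 (b *\<^sub>R (x - y)))"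
      by (simp add: \<phi>_def)
  qed
  then show ?thesis by (simp add: F_def)
qed

end

section \<open>Sequence spaces over the lattice\<close>

text \<open>Connects the sums in \<open>GM_norm\<close> with \<open>csum\<close>. Finite sums are
  integrals over finite sets, and the initial segments of an enumeration exhaust the index type, so
  monotone convergence applies.\<close>

lemma infsum_eq_nn_integral_count_space:
  fixes f :: "'j::countable \<Rightarrow> ennreal"
  shows "(\<Sum>\<^sub>\<infinity>j\<in>UNIV. f j) = (csum (\<lambda>j. f j))"
proof -
  have fin_sum: "sum f F = (csum (\<lambda>j. f j * indicator F j))" if "finite F" for F
  proof -
    have "(csum (\<lambda>j. f j * indicator F j)) = (\<integral>\<^sup>+j. f j \<partial>count_space F)"
      by (simp add: nn_integral_count_space_indicator)
    then show ?thesis using that by (simp add: nn_integral_count_space_finite)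
  qed
  have "(\<Sum>\<^sub>\<infinity>j\<in>UNIV. f j) = (SUP F\<in>{F. finite F \<and> F \<subseteq> UNIV}. sum f F)"
    by (rule nonneg_infsum_complete) simp
  also have "\<dots> = (csum (\<lambda>j. f j))"
  proof (rule antisym)
    show "(SUP F\<in>{F. finite F \<and> F \<subseteq> UNIV}. sum f F) \<le> (csum (\<lambda>j. f j))"
    proof (rule SUP_least)
      fix F :: "'j set" assume "F \<in> {F. finite F \<and> F \<subseteq> UNIV}"
      then have "sum f F = (csum (\<lambda>j. f j * indicator F j))" by (simp add: fin_sum)
      also have "\<dots> \<le> (csum (\<lambda>j. f j))"
        by (intro nn_integral_mono) (auto split: split_indicator)
      finally show "sum f F \<le> (csum (\<lambda>j. f j))" .
    qed
    define E where "E n = {j::'j. to_nat j < n}" for n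
    have finE: "finite (E n)" for n
    proof (rule finite_imageD)
      show "finite (to_nat ` E n)" by (rule finite_subset[of _ "{..<n}"]) (auto simp: E_def)
      show "inj_on to_nat (E n)" by (rule inj_on_subset[OF inj_to_nat]) simp
    qed
    have "f j = (SUP n. f j * indicator (E n) j)" for j
    proof (rule antisym)
      have "f j = f j * indicator (E (Suc (to_nat j))) j" by (simp add: E_def)
      then show "f j \<le> (SUP n. f j * indicator (E n) j)" by (metis SUP_upper UNIV_I)
      show "(SUP n. f j * indicator (E n) j) \<le> f j" by (rule SUP_least) (auto split: split_indicator)
    qed
    then have "(csum (\<lambda>j. f j)) = (csum (\<lambda>j. (SUP n. f j * indicator (E n) j)))" by simp
    also have "\<dots> = (SUP n. \<integral>\<^sup>+j. f j * indicator (E n) j \<partial>count_space UNIV)"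
      by (rule nn_integral_monotone_convergence_SUP) (auto simp: incseq_def le_fun_def E_def split: split_indicator)
    also have "\<dots> = (SUP n. sum f (E n))" by (simp only: fin_sum[OF finE])
    also have "\<dots> \<le> (SUP F\<in>{F. finite F \<and> F \<subseteq> UNIV}. sum f F)"
      by (rule SUP_least) (auto intro!: SUP_upper finE)
    finally show "(csum (\<lambda>j. f j)) \<le> (SUP F\<in>{F. finite F \<and> F \<subseteq> UNIV}. sum f F)" .
  qed
  finally show ?thesis .
qed

lemma esssup_count_space: "esssup (count_space UNIV) u = (SUP k. u k)" for u :: "'j \<Rightarrow> ennreal"
proof (rule antisym)
  show "esssup (count_space UNIV) u \<le> (SUP k. u k)"
    by (rule esssup_I) (auto simp: AE_count_space intro: SUP_upper)
  show "(SUP k. u k) \<le> esssup (count_space UNIV) u"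
    using esssup_AE[of u "count_space UNIV"] by (intro SUP_least) (auto simp: AE_count_space)
qed

text \<open>The embedding of the sequence spaces into the bounded sequences with constant 1: one
  term of a nonnegative sum is at most the whole.\<close>

lemma Lnorm_count_space_upper:
  assumes "1 \<le> q" shows "u k \<le> Lnorm (count_space UNIV) q u"
proof (cases "q = \<infinity>")
  case True
  then show ?thesis by (auto simp: Lnorm_def esssup_count_space intro: SUP_upper)
next
  case False
  define r where "r = enn2real q"
  have r: "1 \<le> r" using assms False by (auto simp: r_def intro: enn2real_ge_1)
  have "ennreal_powr (u k) r = (csum (\<lambda>j. ennreal_powr (u k) r * indicator {k} j))"
    by simp
  also have "\<dots> \<le> (csum (\<lambda>j. ennreal_powr (u j) r))"
    by (intro nn_integral_mono) (auto split: split_indicator)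
  finally have "ennreal_powr (ennreal_powr (u k) r) (1/r) \<le> ennreal_powr (csum (\<lambda>j. ennreal_powr (u j) r)) (1/r)"
    using r by (intro ennreal_powr_mono) auto
  then show ?thesis using False r by (simp add: Lnorm_def ennreal_powr_powr r_def)
qed

section \<open>Translation invariance and discrete convolution\<close>

lemma bij_diff_right: "bij (\<lambda>k. k - c :: 'a::ab_group_add)"
  by (rule bij_betw_byWitness[where f'="\<lambda>k. k + c"]) auto

lemma bij_diff_left: "bij (\<lambda>k. c - k :: 'a::ab_group_add)"
  by (rule bij_betw_byWitness[where f'="\<lambda>k. c - k"]) auto

lemma Lnorm_count_space_shift:
  fixes u :: "'a::ab_group_add \<Rightarrow> ennreal"
  shows "Lnorm (count_space UNIV) q (\<lambda>k. u (k - c)) = Lnorm (count_space UNIV) q u"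
proof -
  have "(SUP k. u (k - c)) = (SUP k\<in>range (\<lambda>k. k - c). u k)" by (simp only: image_image)
  also have "range (\<lambda>k. k - c) = UNIV" using bij_diff_right[of c] by (simp add: bij_def)
  finally have "(SUP k. u (k - c)) = (SUP k. u k)" .
  moreover have "(csum (\<lambda>k. ennreal_powr (u (k - c)) r)) = (csum (\<lambda>k. ennreal_powr (u k) r))" for r
    using nn_integral_bij_count_space[OF bij_diff_right, of "\<lambda>k. ennreal_powr (u k) r" c] .
  ultimately show ?thesis by (simp add: Lnorm_def esssup_count_space)
qed

lemma Lnorm_zero: "1 \<le> p \<Longrightarrow> Lnorm M p (\<lambda>x. 0) = 0"
  using Lnorm_cmult_le[of p "\<lambda>_. 0" M 0] by simp

lemma Lnorm_add_le:
  assumes "sigma_finite_measure M" "1 \<le> p" "u \<in> borel_measurable M" "v \<in> borel_measurable M"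
  shows "Lnorm M p (\<lambda>x. u x + v x) \<le> Lnorm M p u + Lnorm M p v"
  using Lnorm_sum_le[of M p "\<lambda>b::bool. if b then u else v"] assms
  by (auto simp: nn_integral_count_space_finite UNIV_bool ac_simps split: if_splits)

text \<open>The complement of the case settled by \<open>cv_mult_eq_0\<close>. For fixed
  \<open>k\<close> and \<open>l\<close> it leaves \<open>m\<close> in a cube of
  \<open>7 ^ CARD('n)\<close> lattice points around \<open>k - l\<close>.\<close>

definition near :: "int^'n::finite \<Rightarrow> int^'n \<Rightarrow> int^'n \<Rightarrow> bool" where
  "near k l m \<longleftrightarrow> (\<forall>i. \<bar>k $ i - l $ i - m $ i\<bar> \<le> 3)"

lemma near_swap: "near k l m \<longleftrightarrow> near k m l"
  by (simp add: near_def algebra_simps)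

lemma finite_near_zero: "finite {j :: int^'n::finite. near j 0 0}"
proof (rule finite_subset[OF _ finite_int_vec_box[of "\<lambda>_. - 3" "\<lambda>_. 3"]], clarify)
  fix j :: "int^'n" and i assume "near j 0 0"
  then have "\<bar>j $ i\<bar> \<le> 3" by (simp add: near_def)
  then show "- 3 \<le> j $ i \<and> j $ i \<le> 3" by linarith
qed

text \<open>A discrete Young inequality. With \<open>m = k - l - j\<close> the sum runs over pairs
  \<open>(l, j)\<close>, where \<open>j\<close> stays in a fixed finite set, and combines shifts of
  \<open>Y\<close> with weights \<open>w l\<close>, the factor \<open>X\<close> being replaced by
  its bound \<open>\<xi>\<close>. Summability comes from \<open>w\<close> alone, whatever
  \<open>q\<close> is.\<close>

lemma Lnorm_near_sum_le:
  fixes w X Y :: "int^'n::finite \<Rightarrow> ennreal"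
  assumes q: "1 \<le> q" and w: "(csum (\<lambda>l. w l)) < \<infinity>" and X: "\<And>l. X l \<le> \<xi>"
  shows "Lnorm (count_space UNIV) q (\<lambda>k. \<integral>\<^sup>+l. (csum (\<lambda>m. of_bool (near k l m) * (w l * X l * Y m))) \<partial>count_space UNIV)
    \<le> (csum (\<lambda>l. w l)) * of_nat (card {j :: int^'n. near j 0 0}) * (\<xi> * Lnorm (count_space UNIV) q Y)"
proof -
  let ?J = "{j :: int^'n. near j 0 0}"
  let ?W = "\<lambda>(l, j). w l * indicator ?J j"
  let ?U = "\<lambda>k (l, j). \<xi> * Y (k - (l + j))"
  have inner: "(csum (\<lambda>m. of_bool (near k l m) * (w l * X l * Y m)))
      \<le> (csum (\<lambda>j. ?W (l, j) * ?U k (l, j)))" for k l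
  proof -
    have "(csum (\<lambda>m. of_bool (near k l m) * (w l * X l * Y m)))
       = (csum (\<lambda>j. of_bool (near k l (k - l - j)) * (w l * X l * Y (k - l - j))))"
      by (rule nn_integral_bij_count_space[OF bij_diff_left, symmetric])
    also have "\<dots> \<le> (csum (\<lambda>j. ?W (l, j) * ?U k (l, j)))"
    proof (intro nn_integral_mono)
      fix j
      have "near k l (k - l - j) \<longleftrightarrow> j \<in> ?J" by (simp add: near_def)
      moreover have "w l * X l * Y (k - l - j) \<le> w l * \<xi> * Y (k - l - j)"
        by (intro mult_right_mono mult_left_mono X) auto
      ultimately show "of_bool (near k l (k - l - j)) * (w l * X l * Y (k - l - j)) \<le> ?W (l, j) * ?U k (l, j)"
        by (auto simp: diff_diff_eq mult.assoc split: split_indicator)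
    qed
    finally show ?thesis .
  qed
  have "Lnorm (count_space UNIV) q (\<lambda>k. \<integral>\<^sup>+l. (csum (\<lambda>m. of_bool (near k l m) * (w l * X l * Y m))) \<partial>count_space UNIV)
      \<le> Lnorm (count_space UNIV) q (\<lambda>k. \<integral>\<^sup>+l. (csum (\<lambda>j. ?W (l, j) * ?U k (l, j))) \<partial>count_space UNIV)"
    by (intro Lnorm_mono_AE q AE_I2 nn_integral_mono inner) simp
  also have "\<dots> = Lnorm (count_space UNIV) q (\<lambda>k. \<integral>\<^sup>+z. ?W z * ?U k z \<partial>count_space UNIV)"
    by (subst nn_integral_fst_count_space) simp
  also have W: "(csum (\<lambda>z. ?W z)) = (csum (\<lambda>l. w l)) * of_nat (card ?J)"
  proof -
    have "(csum (\<lambda>z. ?W z)) = (csum (\<lambda>l. (csum (\<lambda>j. ?W (l, j)))))"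
      by (rule nn_integral_fst_count_space[symmetric])
    also have "\<dots> = (csum (\<lambda>l. w l * of_nat (card ?J)))"
      using finite_near_zero[where 'n='n] by (simp add: nn_integral_cmult)
    also have "\<dots> = (csum (\<lambda>l. w l)) * of_nat (card ?J)"
      by (rule nn_integral_multc) simp
    finally show ?thesis .
  qed
  have "Lnorm (count_space UNIV) q (\<lambda>k. \<integral>\<^sup>+z. ?W z * ?U k z \<partial>count_space UNIV)
      \<le> (csum (\<lambda>z. ?W z)) * (\<xi> * Lnorm (count_space UNIV) q Y)"
  proof (rule Lnorm_weighted_le[OF sigma_finite_count_space sigma_finite_count_space _ _ _ q])
    show "case_prod ?U \<in> borel_measurable (count_space UNIV \<Otimes>\<^sub>M count_space UNIV)"
      by (rule measurable_count_pair) simp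
    show "(csum (\<lambda>z. ?W z)) < \<infinity>"
      unfolding W using w by (simp add: ennreal_mult_less_top of_nat_less_top)
    fix z :: "(int^'n) \<times> (int^'n)"
    obtain l j where z: "z = (l, j)" by (cases z)
    have "Lnorm (count_space UNIV) q (\<lambda>k. \<xi> * Y (k - (l + j))) \<le> \<xi> * Lnorm (count_space UNIV) q (\<lambda>k. Y (k - (l + j)))"
      by (rule Lnorm_cmult_le[OF q]) simp
    then show "Lnorm (count_space UNIV) q (\<lambda>k. ?U k z) \<le> \<xi> * Lnorm (count_space UNIV) q Y"
      by (simp add: z Lnorm_count_space_shift)
  qed simp
  finally show ?thesis by (simp only: W)
qed

section \<open>Gevrey weights\<close>

text \<open>For fixed \<open>a\<close> the increment \<open>(a + t) powr r - t powr r\<close> is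
  nonincreasing in \<open>t\<close> because \<open>r \<le> 1\<close>; compare \<open>t = b\<close>
  with \<open>t = a\<close>. For \<open>r < 1\<close> the factor \<open>2 powr r - 1\<close> is
  below 1, which is the gain over subadditivity.\<close>

lemma powr_add_gain:
  fixes a b r :: real
  assumes r: "0 < r" "r \<le> 1" and ab: "0 \<le> a" "a \<le> b"
  shows "(a + b) powr r \<le> b powr r + (2 powr r - 1) * a powr r"
proof (cases "a = 0")
  case False
  then have a: "0 < a" using ab by simp
  have "(a + b) powr r - b powr r \<le> (a + a) powr r - a powr r"
  proof (rule DERIV_nonpos_imp_nonincreasing[OF ab(2), where f="\<lambda>t. (a + t) powr r - t powr r"])
    fix t assume t: "a \<le> t" "t \<le> b"
    have "((\<lambda>t. (a + t) powr r - t powr r) has_real_derivative r * (a + t) powr (r - 1) - r * t powr (r - 1)) (at t)"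
      using a t by (auto intro!: derivative_eq_intros)
    moreover have "r * (a + t) powr (r - 1) \<le> r * t powr (r - 1)"
      using a t r by (intro mult_left_mono powr_mono2') auto
    ultimately show "\<exists>y. ((\<lambda>t. (a + t) powr r - t powr r) has_real_derivative y) (at t) \<and> y \<le> 0" by force
  qed
  moreover have "(a + a) powr r = 2 powr r * a powr r"
    using a by (simp add: powr_mult flip: mult_2)
  ultimately show ?thesis by (simp add: algebra_simps)
qed (use r in simp)

lemma two_powr_bounds: "0 < r \<Longrightarrow> r \<le> 1 \<Longrightarrow> 1 \<le> (2::real) powr r" "0 < r \<Longrightarrow> r \<le> 1 \<Longrightarrow> (2::real) powr r \<le> 2"
  using powr_mono[of r 1 "2::real"] powr_mono[of 0 r "2::real"] by auto

lemma powr_subadditive: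
  fixes a b r :: real
  assumes r: "0 < r" "r \<le> 1" and ab: "0 \<le> a" "0 \<le> b"
  shows "(a + b) powr r \<le> a powr r + b powr r"
proof -
  have *: "(x + y) powr r \<le> x powr r + y powr r" if "0 \<le> x" "x \<le> y" for x y :: real
  proof -
    have "(2 powr r - 1) * x powr r \<le> 1 * x powr r"
      using two_powr_bounds[OF r] by (intro mult_right_mono) auto
    then show ?thesis using powr_add_gain[OF r that] by simp
  qed
  show ?thesis using *[of a b] *[of b a] ab by (cases "a \<le> b") (auto simp: add.commute)
qed

definition gevrey_weight :: "real \<Rightarrow> int^'n::finite \<Rightarrow> real" where
  "gevrey_weight s k = exp (norm (lattice_point k) powr (1/s))"

text \<open>The coefficient is \<open>1 - (2 powr (1/s) - 1)\<close>, which is what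
  \<open>powr_add_gain\<close> saves on the smaller index; it is positive for
  \<open>s > 1\<close>.\<close>

definition gevrey_gain :: "real \<Rightarrow> int^'n::finite \<Rightarrow> real" where
  "gevrey_gain s k = exp (- ((2 - 2 powr (1/s)) * norm (lattice_point k) powr (1/s)))"

text \<open>Strict concavity of \<open>t \<mapsto> t powr (1/s)\<close> makes the weight better than submultiplicative; this is where
  \<open>s > 1\<close> enters.\<close>

lemma gevrey_weight_near:
  fixes k l m :: "int^'n::finite"
  assumes s: "1 < s" and near: "near k l m"
  shows "gevrey_weight s k \<le> exp ((3 * real CARD('n)) powr (1/s)) * (gevrey_weight s l * gevrey_weight s m * (gevrey_gain s l + gevrey_gain s m))"
proof -
  let ?r = "1/s" and ?n = "\<lambda>k::int^'n. norm (lattice_point k)"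
  have r: "0 < ?r" "?r \<le> 1" using s by auto
  \<comment> \<open>The index of smaller norm carries the gain. Adding both gains in the conclusion
    makes it symmetric in \<open>l\<close> and \<open>m\<close>.\<close>
  have gain: "gevrey_weight s k \<le> exp ((3 * real CARD('n)) powr ?r) * (gevrey_weight s l * gevrey_weight s m * gevrey_gain s l)"
    if near: "near k l m" and le: "?n l \<le> ?n m" for l m
  proof -
    have "norm (lattice_point (k - l - m)) \<le> (\<Sum>i\<in>UNIV. \<bar>lattice_point (k - l - m) $ i\<bar>)"
      by (rule norm_le_l1_cart)
    also have "\<dots> \<le> (\<Sum>i\<in>(UNIV::'n set). 3)"
    proof (rule sum_mono)
      fix i
      have "\<bar>k $ i - l $ i - m $ i\<bar> \<le> 3" using near by (simp add: near_def)
      then have "real_of_int \<bar>k $ i - l $ i - m $ i\<bar> \<le> 3" by linarith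
      then show "\<bar>lattice_point (k - l - m) $ i\<bar> \<le> 3" by simp
    qed
    finally have d: "norm (lattice_point (k - l - m)) \<le> 3 * real CARD('n)" by simp
    \<comment> \<open>The remainder \<open>k - l - m\<close> has bounded norm; subadditivity splits
      it off and turns it into the constant factor.\<close>
    have "lattice_point k = lattice_point l + lattice_point m + lattice_point (k - l - m)"
      by (simp add: lattice_point_diff)
    then have "?n k \<le> norm (lattice_point l + lattice_point m :: real^'n) + norm (lattice_point (k - l - m))"
      using norm_triangle_ineq[of "lattice_point l + lattice_point m" "lattice_point (k - l - m)"] by simp
    then have "?n k \<le> (?n l + ?n m) + 3 * real CARD('n)"
      using norm_triangle_ineq[of "lattice_point l" "lattice_point m"] d by linarith
    then have "?n k powr ?r \<le> ((?n l + ?n m) + 3 * real CARD('n)) powr ?r"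
      using r by (intro powr_mono2) auto
    also have "\<dots> \<le> (?n l + ?n m) powr ?r + (3 * real CARD('n)) powr ?r"
      by (rule powr_subadditive[OF r]) auto
    also have "(?n l + ?n m) powr ?r \<le> ?n m powr ?r + (2 powr ?r - 1) * ?n l powr ?r"
      by (rule powr_add_gain[OF r _ le]) simp
    finally have "?n k powr ?r \<le> (3 * real CARD('n)) powr ?r + (?n l powr ?r + ?n m powr ?r + (- ((2 - 2 powr ?r) * ?n l powr ?r)))"
      by (simp add: algebra_simps)
    then show ?thesis
      by (simp add: gevrey_weight_def gevrey_gain_def flip: exp_add)
  qed
  have pos: "0 < gevrey_weight s k" "0 < gevrey_gain s k" for k :: "int^'n"
    by (auto simp: gevrey_weight_def gevrey_gain_def)
  let ?C = "exp ((3 * real CARD('n)) powr ?r) * (gevrey_weight s l * gevrey_weight s m)"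
  have C: "0 \<le> ?C" using pos by (simp add: less_imp_le)
  show ?thesis
  proof (cases "?n l \<le> ?n m")
    case True
    have "gevrey_weight s k \<le> ?C * gevrey_gain s l" using gain[OF near True] by (simp add: mult_ac)
    also have "\<dots> \<le> ?C * (gevrey_gain s l + gevrey_gain s m)"
      using pos[of m] by (intro mult_left_mono[OF _ C]) simp
    finally show ?thesis by (simp add: mult_ac)
  next
    case False
    then have "gevrey_weight s k \<le> ?C * gevrey_gain s m"
      using gain[of m l] near by (simp add: near_swap mult_ac)
    also have "\<dots> \<le> ?C * (gevrey_gain s l + gevrey_gain s m)"
      using pos[of l] by (intro mult_left_mono[OF _ C]) simp
    finally show ?thesis by (simp add: mult_ac)
  qed
qed

text \<open>Raise \<open>1 + x \<le> exp x\<close> with \<open>x = \<delta> / M * t powr r\<close>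
  to a power \<open>M\<close> for which \<open>r * M \<ge> N\<close>.\<close>

lemma exp_neg_powr_le:
  fixes r \<delta> :: real
  assumes r: "0 < r" "r \<le> 1" and \<delta>: "0 < \<delta>"
  shows "\<exists>C\<ge>0. \<forall>t\<ge>0. exp (- (\<delta> * t powr r)) \<le> C / (1 + t) ^ N"
proof -
  define M where "M = nat \<lceil>real N / r\<rceil> + 1"
  have M: "0 < M" "real N \<le> r * real M"
  proof -
    have "real N / r \<le> real M" unfolding M_def by linarith
    then show "real N \<le> r * real M" using r by (simp add: field_simps)
  qed (simp add: M_def)
  \<comment> \<open>Chosen so that
    \<open>c * (1 + t powr r) \<le> 1 + \<delta> / M * t powr r\<close>, comparing the constant and
    the variable term separately.\<close>
  define c where "c = min 1 (\<delta> / real M)"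
  have c: "0 < c" "c \<le> 1" "c \<le> \<delta> / real M" using \<delta> M by (auto simp: c_def)
  have "exp (- (\<delta> * t powr r)) \<le> (1 / c ^ M) / (1 + t) ^ N" if t: "0 \<le> t" for t
  proof -
    have "c * (1 + t) powr r \<le> c * (1 + t powr r)"
      using powr_subadditive[OF r, of 1 t] t c by (intro mult_left_mono) auto
    also have "\<dots> = c + c * t powr r" by (simp add: algebra_simps)
    also have "\<dots> \<le> 1 + \<delta> / real M * t powr r"
      using c by (intro add_mono mult_right_mono) auto
    also have "\<dots> \<le> exp (\<delta> / real M * t powr r)" by (rule exp_ge_add_one_self)
    finally have "(c * (1 + t) powr r) ^ M \<le> exp (\<delta> / real M * t powr r) ^ M"
      using c by (intro power_mono) auto
    also have "\<dots> = exp (\<delta> * t powr r)"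
      using M by (simp flip: exp_of_nat_mult)
    finally have 1: "c ^ M * ((1 + t) powr r) ^ M \<le> exp (\<delta> * t powr r)" by (simp add: power_mult_distrib)
    have "(1 + t) ^ N = (1 + t) powr real N" using t by (simp add: powr_realpow)
    also have "\<dots> \<le> (1 + t) powr (r * real M)" using M t by (intro powr_mono) auto
    also have "\<dots> = ((1 + t) powr r) ^ M" using t by (simp add: powr_powr[symmetric] powr_realpow)
    finally have "c ^ M * (1 + t) ^ N \<le> exp (\<delta> * t powr r)"
      using 1 c by (meson mult_left_mono order_trans zero_le_power less_imp_le)
    then show ?thesis using c t by (simp add: exp_minus field_simps)
  qed
  then show ?thesis using c by (intro exI[of _ "1 / c ^ M"]) auto
qed

text \<open>Comparison with an integral: the open unit cubes at the lattice points are disjoint and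
  of measure 1, and Peetre's inequality moves the weight from the corner to any point of the cube at
  a fixed cost.\<close>

lemma nn_integral_wt_lattice_less_top:
  "(csum (\<lambda>l. ennreal (wt (2 * CARD('n)) (lattice_point (l :: int^'n::finite))))) < \<infinity>"
proof -
  let ?N = "2 * CARD('n)" and ?n = "real CARD('n)"
  interpret J: sigma_finite_measure "count_space (UNIV :: (int^'n) set)" by (rule sigma_finite_count_space)
  interpret P: pair_sigma_finite "lborel :: (real^'n) measure" "count_space (UNIV :: (int^'n) set)" ..
  define Q where "Q l = box (lattice_point l) (lattice_point l + 1)" for l :: "int^'n"
  have Q_floor: "l = (\<chi> i. \<lfloor>x $ i\<rfloor>)" "norm (x - lattice_point l) \<le> ?n" if "x \<in> Q l" for x l
  proof -
    have b: "real_of_int (l $ i) < x $ i \<and> x $ i < real_of_int (l $ i) + 1" for i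
      using that by (simp add: Q_def mem_box_cart)
    then have "\<lfloor>x $ i\<rfloor> = l $ i" for i by (intro floor_unique) (auto intro: less_imp_le)
    then show "l = (\<chi> i. \<lfloor>x $ i\<rfloor>)" by (simp add: vec_eq_iff)
    have "norm (x - lattice_point l) \<le> (\<Sum>i\<in>UNIV. \<bar>(x - lattice_point l) $ i\<bar>)" by (rule norm_le_l1_cart)
    also have "\<dots> \<le> (\<Sum>i\<in>(UNIV::'n set). 1)"
    proof (rule sum_mono)
      show "\<bar>(x - lattice_point l) $ i\<bar> \<le> 1" for i using b[of i] by simp
    qed
    finally show "norm (x - lattice_point l) \<le> ?n" by simp
  qed
  have Q1: "emeasure lborel (Q l) = 1" for l
    unfolding Q_def by (subst emeasure_lborel_box) (auto simp: Basis_vec_def inner_axis inner_add_left intro!: prod.neutral)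
  have [measurable]: "Q l \<in> sets borel" for l by (simp add: Q_def)
  have ind: "(csum (\<lambda>l. indicator (Q l) x)) \<le> 1" for x
  proof -
    have "(csum (\<lambda>l. indicator (Q l) x)) \<le> (csum (\<lambda>l. indicator {\<chi> i. \<lfloor>x $ i\<rfloor>} l))"
    proof (intro nn_integral_mono)
      fix l
      show "indicator (Q l) x \<le> (indicator {\<chi> i. \<lfloor>x $ i\<rfloor>} l :: ennreal)"
      proof (cases "x \<in> Q l")
        case True
        then have l: "l \<in> {\<chi> i. \<lfloor>x $ i\<rfloor>}" using Q_floor(1) by blast
        then show ?thesis by (simp only: indicator_simps(1)[OF l] indicator_simps(1)[OF True] order_refl)
      qed simp
    qed
    then show ?thesis by simp
  qed
  have m: "(\<lambda>(x, l). indicator (Q l) x :: ennreal) \<in> borel_measurable (lborel \<Otimes>\<^sub>M count_space UNIV)"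
    by (rule measurable_count_pair) simp
  let ?c = "ennreal ((1 + ?n) ^ ?N)"
  have "(csum (\<lambda>l. ennreal (wt ?N (lattice_point (l :: int^'n)))))
     = (csum (\<lambda>l. (\<integral>\<^sup>+x. ennreal (wt ?N (lattice_point l)) * indicator (Q l) x \<partial>lborel)))"
    by (simp add: nn_integral_cmult Q1)
  also have "\<dots> \<le> (csum (\<lambda>l. (\<integral>\<^sup>+x. ?c * ennreal (wt ?N x) * indicator (Q l) x \<partial>lborel)))"
  proof (intro nn_integral_mono)
    fix l :: "int^'n" and x :: "real^'n"
    show "ennreal (wt ?N (lattice_point l)) * indicator (Q l) x \<le> ?c * ennreal (wt ?N x) * indicator (Q l) x"
    proof (cases "x \<in> Q l")
      case True
      have "wt ?N (lattice_point l) \<le> (1 + norm (x - lattice_point l)) ^ ?N * wt ?N x"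
        using wt_Peetre[of ?N x "x - lattice_point l"] by simp
      also have "\<dots> \<le> (1 + ?n) ^ ?N * wt ?N x"
        using Q_floor(2)[OF True] by (intro mult_right_mono power_mono) auto
      finally show ?thesis using True by (simp add: ennreal_leI flip: ennreal_mult)
    qed simp
  qed
  also have "\<dots> = (\<integral>\<^sup>+x. (csum (\<lambda>l. ?c * ennreal (wt ?N x) * indicator (Q l) x)) \<partial>lborel)"
  proof (rule P.Fubini')
    show "(\<lambda>(x, l). ?c * ennreal (wt ?N x) * indicator (Q l) x) \<in> borel_measurable (lborel \<Otimes>\<^sub>M count_space UNIV)"
      by (rule measurable_count_pair) simp
  qed
  also have "\<dots> = (\<integral>\<^sup>+x. ?c * ennreal (wt ?N x) * (csum (\<lambda>l. indicator (Q l) x)) \<partial>lborel)"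
    by (simp add: nn_integral_cmult)
  also have "\<dots> \<le> (\<integral>\<^sup>+x. ?c * ennreal (wt ?N (x :: real^'n)) * 1 \<partial>lborel)"
    by (intro nn_integral_mono mult_left_mono ind) simp
  also have "\<dots> = ?c * (\<integral>\<^sup>+x. ennreal (wt ?N x) \<partial>(lborel :: (real^'n) measure))"
    by (simp add: nn_integral_cmult)
  also have "\<dots> < \<infinity>"
    using integrable_wt_cart[of ?N, where 'n='n] by (simp add: integrable_iff_bounded ennreal_mult_less_top)
  finally show ?thesis .
qed

lemma nn_integral_exp_neg_lattice_less_top:
  fixes r \<delta> :: real
  assumes "0 < r" "r \<le> 1" "0 < \<delta>"
  shows "(csum (\<lambda>l. ennreal (exp (- (\<delta> * norm (lattice_point (l :: int^'n::finite)) powr r))))) < \<infinity>"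
proof -
  obtain C where C: "0 \<le> C" "\<And>t. 0 \<le> t \<Longrightarrow> exp (- (\<delta> * t powr r)) \<le> C / (1 + t) ^ (2 * CARD('n))"
    using exp_neg_powr_le[OF assms, of "2 * CARD('n)"] by blast
  have "(csum (\<lambda>l. ennreal (exp (- (\<delta> * norm (lattice_point (l :: int^'n)) powr r)))))
     \<le> (csum (\<lambda>l. ennreal C * ennreal (wt (2 * CARD('n)) (lattice_point (l :: int^'n)))))"
    using C by (intro nn_integral_mono) (auto simp: wt_def ennreal_leI simp flip: ennreal_mult)
  also have "\<dots> = ennreal C * (csum (\<lambda>l. ennreal (wt (2 * CARD('n)) (lattice_point (l :: int^'n)))))"
    by (rule nn_integral_cmult) simp
  also have "\<dots> < \<infinity>" using nn_integral_wt_lattice_less_top[where 'n='n] by (simp add: ennreal_mult_less_top)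
  finally show ?thesis .
qed

section \<open>Frequency pieces of a product\<close>

lemma cv_series:
  fixes U :: "'j::countable \<Rightarrow> real^'n::finite \<Rightarrow> complex"
  assumes [measurable]: "\<And>j. U j \<in> borel_measurable borel" "u \<in> borel_measurable borel"
    and p: "1 \<le> p" and K: "rapid K" and ae: "AE x in lborel. u x = (\<integral>j. U j x \<partial>count_space UNIV)"
    and fin: "(csum (\<lambda>j. Lpn p (U j))) < \<infinity>"
  shows "cv K u y = (\<integral>j. cv K (U j) y \<partial>count_space UNIV)"
proof -
  interpret J: sigma_finite_measure "count_space (UNIV :: 'j set)" by (rule sigma_finite_count_space)
  note [measurable] = rapid_measurable[OF K]
  have U: "(\<lambda>(x, j). U j x) \<in> borel_measurable (lborel \<Otimes>\<^sub>M count_space UNIV)"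
    by (rule measurable_count_pair) simp
  have [measurable]: "(\<lambda>x. \<integral>j. U j x \<partial>count_space UNIV) \<in> borel_measurable borel"
    using U by (subst measurable_lborel2[symmetric]) measurable
  have "cv K u y = (LINT x|lborel. (\<integral>j. U j x \<partial>count_space UNIV) * K (x - y))"
    unfolding cv_def using ae by (intro integral_cong_AE) (auto elim!: eventually_mono)
  also have "\<dots> = (\<integral>j. cv K (U j) y \<partial>count_space UNIV)"
    unfolding cv_def by (rule integral_series_rapid[OF _ p rapid_shift[OF K] fin]) simp
  finally show ?thesis .
qed

context freq_window
begin

text \<open>Two single expansions in place of a double series: \<open>f\<close> is expanded with
  \<open>g\<close> kept whole, then \<open>g\<close> for each fixed \<open>l\<close>. Hoelder's
  inequality and the summability of the pieces justify each of them.\<close>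

lemma Lnorm_cv_mult_le:
  assumes p: "1 \<le> p1" "1 \<le> p2" "1 \<le> p" "1 / p = 1 / p1 + 1 / p2"
    and [measurable]: "f \<in> borel_measurable borel" "g \<in> borel_measurable borel"
    and f_fin: "Lpn p1 f < \<infinity>"
    and g_fin: "Lpn p2 g < \<infinity>"
    and f_sum: "(csum (\<lambda>l. Lpn p1 (cv (kap l) f))) < \<infinity>"
    and g_sum: "(csum (\<lambda>m. Lpn p2 (cv (kap m) g))) < \<infinity>"
  shows "Lpn p (\<lambda>x. cv (kap k) (\<lambda>x. f x * g x) x)
    \<le> (\<integral>\<^sup>+z. ennreal (norm (kap 0 z)) \<partial>lborel) *
      (csum (\<lambda>l. (csum (\<lambda>m. of_bool (near k l m) * (Lpn p1 (cv (kap l) f) *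
          Lpn p2 (cv (kap m) g))))))"
    (is "_ \<le> ?K * (\<integral>\<^sup>+l. (\<integral>\<^sup>+m. of_bool (near k l m) * (?a l * ?b m) \<partial>_) \<partial>_)")
proof -
  let ?F = "\<lambda>l. cv (kap l) f" and ?G = "\<lambda>m. cv (kap m) g"
  have tf: "tempered f" by (rule tempered_if_Lnorm_finite[OF _ p(1) f_fin]) simp
  have tg: "tempered g" by (rule tempered_if_Lnorm_finite[OF _ p(2) g_fin]) simp
  have a_fin: "?a l < \<infinity>" for l
    using nn_integral_PInf_AE[of ?a "count_space UNIV"] f_sum by (auto simp: AE_count_space less_top)
  have b_fin: "?b m < \<infinity>" for m
    using nn_integral_PInf_AE[of ?b "count_space UNIV"] g_sum by (auto simp: AE_count_space less_top)
  have Hoelder: "Lpn p (\<lambda>x. u x * v x) \<le> Lpn p1 u * Lpn p2 v"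
    if [measurable]: "u \<in> borel_measurable borel" "v \<in> borel_measurable borel"
      and "Lpn p1 u < \<infinity>" "Lpn p2 v < \<infinity>"
    for u v :: "real^'n \<Rightarrow> complex"
    using Lnorm_Holder[OF p, of "\<lambda>x. ennreal (norm (u x))" lborel "\<lambda>x. ennreal (norm (v x))"] that
    by (simp add: norm_mult ennreal_mult)
  have f_eq: "AE x in lborel. f x = (\<integral>l. ?F l x \<partial>count_space UNIV)"
    by (rule AE_eq_sum_pieces[OF p(1) _ f_fin f_sum]) simp
  have g_eq: "AE x in lborel. g x = (\<integral>m. ?G m x \<partial>count_space UNIV)"
    by (rule AE_eq_sum_pieces[OF p(2) _ g_fin g_sum]) simp
  have 1: "cv (kap k) (\<lambda>x. f x * g x) y = (\<integral>l. cv (kap k) (\<lambda>x. ?F l x * g x) y \<partial>count_space UNIV)" for y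
  proof (rule cv_series[OF _ _ p(3) rapid_kap])
    show "AE x in lborel. f x * g x = (\<integral>l. ?F l x * g x \<partial>count_space UNIV)"
      using f_eq by eventually_elim (simp only: integral_mult_left_zero)
    have "(csum (\<lambda>l. Lpn p (\<lambda>x. ?F l x * g x)))
        \<le> (csum (\<lambda>l. ?a l * Lpn p2 g))"
      by (intro nn_integral_mono Hoelder a_fin g_fin) simp_all
    also have "\<dots> = (csum (\<lambda>l. ?a l)) * Lpn p2 g"
      by (rule nn_integral_multc) simp
    also have "\<dots> < \<infinity>" using f_sum g_fin by (simp add: ennreal_mult_less_top)
    finally show "(csum (\<lambda>l. Lpn p (\<lambda>x. ?F l x * g x))) < \<infinity>" .
  qed simp_all
  have 2: "cv (kap k) (\<lambda>x. ?F l x * g x) y = (\<integral>m. cv (kap k) (\<lambda>x. ?F l x * ?G m x) y \<partial>count_space UNIV)" for l y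
  proof (rule cv_series[OF _ _ p(3) rapid_kap])
    show "AE x in lborel. ?F l x * g x = (\<integral>m. ?F l x * ?G m x \<partial>count_space UNIV)"
      using g_eq by eventually_elim (simp only: integral_mult_right_zero)
    have "(csum (\<lambda>m. Lpn p (\<lambda>x. ?F l x * ?G m x)))
        \<le> (csum (\<lambda>m. ?a l * ?b m))"
      by (intro nn_integral_mono Hoelder a_fin b_fin) simp_all
    also have "\<dots> = ?a l * (csum (\<lambda>m. ?b m))"
      by (rule nn_integral_cmult) simp
    also have "\<dots> < \<infinity>" using g_sum a_fin[of l] by (simp add: ennreal_mult_less_top)
    finally show "(csum (\<lambda>m. Lpn p (\<lambda>x. ?F l x * ?G m x))) < \<infinity>" .
  qed simp_all
  let ?H = "\<lambda>l m y. ennreal (norm (cv (kap k) (\<lambda>x. ?F l x * ?G m x) y))"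
  have pw: "ennreal (norm (cv (kap k) (\<lambda>x. f x * g x) y)) \<le> (csum (\<lambda>l. (csum (\<lambda>m. ?H l m y))))" for y
  proof -
    have "ennreal (norm (cv (kap k) (\<lambda>x. f x * g x) y)) \<le> (csum (\<lambda>l. ennreal (norm (cv (kap k) (\<lambda>x. ?F l x * g x) y))))"
      unfolding 1[of y] by (rule norm_integral_le_nn_integral)
    also have "\<dots> \<le> (csum (\<lambda>l. (csum (\<lambda>m. ?H l m y))))"
      unfolding 2 by (intro nn_integral_mono norm_integral_le_nn_integral)
    finally show ?thesis .
  qed
  have inner_meas: "(\<lambda>y. \<integral>\<^sup>+m. ?H l m y \<partial>count_space UNIV) \<in> borel_measurable lborel" for l
  proof -
    interpret J: sigma_finite_measure "count_space (UNIV :: (int^'n) set)" by (rule sigma_finite_count_space)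
    have "(\<lambda>(y, m). ?H l m y) \<in> borel_measurable (lborel \<Otimes>\<^sub>M count_space UNIV)"
      by (rule measurable_count_pair) simp
    then show ?thesis by measurable
  qed
  have piece: "Lnorm lborel p (?H l m) \<le> ?K * (of_bool (near k l m) * (?a l * ?b m))" for l m
  proof (cases "near k l m")
    case True
    have "Lnorm lborel p (?H l m) \<le> (\<integral>\<^sup>+z. ennreal (norm (kap k z)) \<partial>lborel) * Lpn p (\<lambda>x. ?F l x * ?G m x)"
      by (rule Lnorm_norm_cv_le[OF p(3) _ kap_integrable]) simp
    also have "\<dots> \<le> (\<integral>\<^sup>+z. ennreal (norm (kap k z)) \<partial>lborel) * (?a l * ?b m)"
      by (intro mult_left_mono Hoelder a_fin b_fin) simp_all
    also have "(\<integral>\<^sup>+z. ennreal (norm (kap k z)) \<partial>lborel) = ?K"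
      by (simp only: norm_kap[of k])
    finally show ?thesis using True by simp
  next
    case False
    then have "\<exists>i. 3 < \<bar>k $ i - l $ i - m $ i\<bar>" by (auto simp: near_def not_le)
    from cv_mult_eq_0[OF tf tg this] show ?thesis using p(3) by (simp add: Lnorm_zero)
  qed
  have "Lpn p (cv (kap k) (\<lambda>x. f x * g x))
      \<le> Lnorm lborel p (\<lambda>y. \<integral>\<^sup>+l. (csum (\<lambda>m. ?H l m y)) \<partial>count_space UNIV)"
    by (intro Lnorm_mono_AE p AE_I2 pw) simp
  also have "\<dots> \<le> (csum (\<lambda>l. Lnorm lborel p (\<lambda>y. \<integral>\<^sup>+m. ?H l m y \<partial>count_space UNIV)))"
    by (rule Lnorm_sum_le[OF lborel.sigma_finite_measure_axioms p(3) inner_meas])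
  also have "\<dots> \<le> (csum (\<lambda>l. (csum (\<lambda>m. Lnorm lborel p (?H l m)))))"
    by (intro nn_integral_mono Lnorm_sum_le lborel.sigma_finite_measure_axioms p) simp
  also have "\<dots> \<le> (csum (\<lambda>l. (csum (\<lambda>m. ?K * (of_bool (near k l m) * (?a l * ?b m))))))"
    by (intro nn_integral_mono piece)
  also have "\<dots> = ?K * (csum (\<lambda>l. (csum (\<lambda>m. of_bool (near k l m) * (?a l * ?b m)))))"
    by (simp add: nn_integral_cmult)
  finally show ?thesis .
qed

section \<open>The Gevrey-modulation norm\<close>

definition weighted_piece :: "real \<Rightarrow> ennreal \<Rightarrow> (real^'n \<Rightarrow> complex) \<Rightarrow> int^'n \<Rightarrow> ennreal" where
  "weighted_piece s p f k = ennreal (gevrey_weight s k) * Lpn p (cv (kap k) f)"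

text \<open>For finite \<open>q\<close> the weight in \<open>GM_norm\<close> is a
  \<open>q\<close>-th power, so the sum is that of the powers of \<open>weighted_piece\<close>;
  \<open>distr_Lp_norm_box_op\<close> replaces distributions by functions.\<close>

lemma GM_norm_eq:
  assumes p: "1 \<le> p" and q: "1 \<le> q" and f: "f \<in> borel_measurable lebesgue" and f': "f' \<in> borel_measurable borel"
    and ae: "AE x in lborel. f x = f' x" and fin: "Lpn p f' < \<infinity>"
  shows "GM_norm \<rho> s p q f = Lnorm (count_space UNIV) q (weighted_piece s p f')"
proof -
  have "ennreal (exp (r * norm (lattice_point k) powr (1 / s))) * ennreal_powr (distr_Lp_norm p (box_op \<rho> k f)) r
      = ennreal_powr (weighted_piece s p f' k) r" if "1 \<le> r" for k r
    using that
    by (simp add: weighted_piece_def gevrey_weight_def distr_Lp_norm_box_op[OF p f f' ae fin] ennreal_powr_mult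
        exp_powr_real mult.commute)
  then show ?thesis
    using enn2real_ge_1[OF q]
    by (auto simp: GM_norm_def Lnorm_def esssup_count_space infsum_eq_nn_integral_count_space
        weighted_piece_def gevrey_weight_def distr_Lp_norm_box_op[OF p f f' ae fin])
qed

text \<open>Each weighted piece is bounded by the whole norm, so the pieces decay like the
  reciprocal weight, which is summable over the lattice. Thus reconstruction is available for every
  \<open>q\<close>.\<close>

lemma sum_pieces_less_top:
  assumes q: "1 \<le> q" and s: "1 < s" and fin: "Lnorm (count_space UNIV) q (weighted_piece s p f) < \<infinity>"
  shows "(csum (\<lambda>l. Lpn p (cv (kap l) f))) < \<infinity>"
proof -
  let ?A = "Lnorm (count_space UNIV) q (weighted_piece s p f)"
  let ?e = "\<lambda>l::int^'n. ennreal (exp (- (1 * norm (lattice_point l) powr (1/s))))"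
  have "Lpn p (cv (kap l) f) \<le> ?e l * ?A" for l
  proof -
    have "?e l * weighted_piece s p f l \<le> ?e l * ?A"
      by (intro mult_left_mono Lnorm_count_space_upper q) simp
    moreover have "?e l * weighted_piece s p f l = Lpn p (cv (kap l) f)"
      by (simp add: weighted_piece_def gevrey_weight_def mult.assoc[symmetric] exp_minus flip: ennreal_mult)
    ultimately show ?thesis by simp
  qed
  then have "(csum (\<lambda>l. Lpn p (cv (kap l) f)))
      \<le> (csum (\<lambda>l. ?e l * ?A))"
    by (intro nn_integral_mono)
  also have "\<dots> = (csum (\<lambda>l. ?e l)) * ?A"
    by (rule nn_integral_multc) simp
  also have "\<dots> < \<infinity>"
    using nn_integral_exp_neg_lattice_less_top[of "1/s" 1, where 'n='n] s fin by (simp add: ennreal_mult_less_top)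
  finally show ?thesis .
qed

text \<open>The factors are the kernel norm from Young's inequality, the cost of the remainder
  \<open>k - l - m\<close>, a 2 for the two indices that may carry the gain, the sum of the gains,
  and the number of lattice points in the near cube.\<close>

definition GM_const :: "real \<Rightarrow> ennreal" where
  "GM_const s = (\<integral>\<^sup>+z. ennreal (norm (kap 0 z)) \<partial>lborel) * ennreal (exp ((3 * real CARD('n)) powr (1/s))) *
     (2 * ((csum (\<lambda>l. ennreal (gevrey_gain s (l :: int^'n)))) * of_nat (card {j :: int^'n. near j 0 0})))"

lemma gevrey_gain_summable:
  assumes "1 < s" shows "(csum (\<lambda>l. ennreal (gevrey_gain s (l :: int^'n)))) < \<infinity>"
proof -
  have "2 powr (1/s) < 2 powr 1" using assms by (intro powr_less_mono) auto
  then show ?thesis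
    unfolding gevrey_gain_def using assms by (intro nn_integral_exp_neg_lattice_less_top) auto
qed

lemma GM_const_less_top: "1 < s \<Longrightarrow> GM_const s < \<infinity>"
  using gevrey_gain_summable[of s] kap_integrable[of 0]
  by (simp add: GM_const_def integrable_iff_bounded ennreal_mult_less_top of_nat_less_top)

lemma Lnorm_weighted_piece_mult_le:
  assumes p: "1 \<le> p1" "1 \<le> p2" "1 \<le> p" "1 / p = 1 / p1 + 1 / p2" and q: "1 \<le> q" and s: "1 < s"
    and [measurable]: "f \<in> borel_measurable borel" "g \<in> borel_measurable borel"
    and f_fin: "Lpn p1 f < \<infinity>"
    and g_fin: "Lpn p2 g < \<infinity>"
    and f_GM: "Lnorm (count_space UNIV) q (weighted_piece s p1 f) < \<infinity>"
    and g_GM: "Lnorm (count_space UNIV) q (weighted_piece s p2 g) < \<infinity>"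
  shows "Lnorm (count_space UNIV) q (weighted_piece s p (\<lambda>x. f x * g x))
    \<le> GM_const s * (Lnorm (count_space UNIV) q (weighted_piece s p1 f) * Lnorm (count_space UNIV) q (weighted_piece s p2 g))"
proof -
  let ?A = "weighted_piece s p1 f" and ?B = "weighted_piece s p2 g"
  let ?a = "\<lambda>l. Lpn p1 (cv (kap l) f)"
  let ?b = "\<lambda>m. Lpn p2 (cv (kap m) g)"
  let ?K = "\<integral>\<^sup>+z. ennreal (norm (kap 0 z)) \<partial>lborel"
  let ?c = "ennreal (exp ((3 * real CARD('n)) powr (1/s)))"
  let ?w = "\<lambda>l::int^'n. ennreal (gevrey_gain s l)"
  let ?T = "\<lambda>X Y k. \<integral>\<^sup>+l. (csum (\<lambda>m. of_bool (near k l m) * (?w l * X l * Y m))) \<partial>count_space UNIV"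
  let ?W = "(csum (\<lambda>l. ?w l)) * of_nat (card {j :: int^'n. near j 0 0})"
  let ?n = "Lnorm (count_space UNIV) q"
  have nonneg: "0 \<le> gevrey_weight s k" "0 \<le> gevrey_gain s k" for k :: "int^'n"
    by (auto simp: gevrey_weight_def gevrey_gain_def)
  \<comment> \<open>The sum of the two gains splits the term. In the first part \<open>?A\<close>
    will be bounded by its supremum and \<open>?B\<close> measured in the sequence norm; in the
    second part the roles are exchanged.\<close>
  have summand_le: "ennreal (gevrey_weight s k) * (of_bool (near k l m) * (?a l * ?b m))
      \<le> ?c * (of_bool (near k l m) * (?w l * ?A l * ?B m) + of_bool (near k m l) * (?w m * ?B m * ?A l))" for k l m
  proof (cases "near k l m")
    case True
    have "ennreal (gevrey_weight s k) \<le> ennreal (exp ((3 * real CARD('n)) powr (1/s)) * (gevrey_weight s l * gevrey_weight s m * (gevrey_gain s l + gevrey_gain s m)))"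
      by (rule ennreal_leI[OF gevrey_weight_near[OF s True]])
    also have "\<dots> = ?c * (ennreal (gevrey_weight s l) * ennreal (gevrey_weight s m) * (?w l + ?w m))"
      using nonneg by (simp add: ennreal_mult ennreal_plus)
    finally have "ennreal (gevrey_weight s k) * (?a l * ?b m) \<le> ?c * (ennreal (gevrey_weight s l) * ennreal (gevrey_weight s m) * (?w l + ?w m)) * (?a l * ?b m)"
      by (rule mult_right_mono) simp
    also have "\<dots> = ?c * (?w l * ?A l * ?B m + ?w m * ?B m * ?A l)"
      by (simp add: weighted_piece_def ring_distribs mult_ac)
    finally show ?thesis using True by (simp add: near_swap[of k m l])
  qed simp
  have swap: "(csum (\<lambda>l. (csum (\<lambda>m. of_bool (near k m l) * (?w m * ?B m * ?A l))))) = ?T ?B ?A k" for k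
    using nn_integral_fst_count_space[of "\<lambda>(m, l). of_bool (near k m l) * (?w m * ?B m * ?A l)"]
      nn_integral_snd_count_space[of "\<lambda>(m, l). of_bool (near k m l) * (?w m * ?B m * ?A l)"] by simp
  have pw: "weighted_piece s p (\<lambda>x. f x * g x) k \<le> ?K * ?c * (?T ?A ?B k + ?T ?B ?A k)" for k
  proof -
    have "weighted_piece s p (\<lambda>x. f x * g x) k
        \<le> ennreal (gevrey_weight s k) * (?K * (csum (\<lambda>l. (csum (\<lambda>m. of_bool (near k l m) * (?a l * ?b m))))))"
      unfolding weighted_piece_def
      using sum_pieces_less_top[OF q s f_GM] sum_pieces_less_top[OF q s g_GM]
      by (intro mult_left_mono Lnorm_cv_mult_le p f_fin g_fin) simp_all
    also have "\<dots> = ?K * (csum (\<lambda>l. (csum (\<lambda>m. ennreal (gevrey_weight s k) * (of_bool (near k l m) * (?a l * ?b m))))))"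
      by (simp add: nn_integral_cmult mult.left_commute)
    also have "\<dots> \<le> ?K * (csum (\<lambda>l. (csum (\<lambda>m. ?c * (of_bool (near k l m) * (?w l * ?A l * ?B m) + of_bool (near k m l) * (?w m * ?B m * ?A l))))))"
      by (intro mult_left_mono nn_integral_mono summand_le) simp
    also have "\<dots> = ?K * (?c * (?T ?A ?B k + (csum (\<lambda>l. (csum (\<lambda>m. of_bool (near k m l) * (?w m * ?B m * ?A l)))))))"
      by (simp add: nn_integral_cmult nn_integral_add)
    finally show ?thesis unfolding swap by (simp only: mult.assoc)
  qed
  have T: "?n (?T X Y) \<le> ?W * (?n X * ?n Y)" for X Y
    by (rule Lnorm_near_sum_le[OF q gevrey_gain_summable[OF s] Lnorm_count_space_upper[OF q]])
  have "?n (weighted_piece s p (\<lambda>x. f x * g x)) \<le> ?n (\<lambda>k. ?K * ?c * (?T ?A ?B k + ?T ?B ?A k))"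
    by (intro Lnorm_mono_AE q AE_I2 pw) simp
  also have "\<dots> \<le> ?K * ?c * ?n (\<lambda>k. ?T ?A ?B k + ?T ?B ?A k)"
    by (rule Lnorm_cmult_le[OF q]) simp
  also have "\<dots> \<le> ?K * ?c * (?n (?T ?A ?B) + ?n (?T ?B ?A))"
    by (intro mult_left_mono Lnorm_add_le sigma_finite_count_space q) simp_all
  also have "\<dots> \<le> ?K * ?c * (?W * (?n ?A * ?n ?B) + ?W * (?n ?B * ?n ?A))"
    by (intro mult_left_mono add_mono T) simp
  also have "\<dots> = GM_const s * (?n ?A * ?n ?B)"
    unfolding GM_const_def by (simp add: mult_ac flip: mult_2)
  finally show ?thesis .
qed

end

theorem theorem2p15:
  fixes \<rho> :: "real^'n::finite \<Rightarrow> real" and s :: real and q :: ennreal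
  assumes "decomposition_window \<rho>" and "1 \<le> q" and "1 < s"
  shows "\<exists>C::real. C > 0 \<and>
    (\<forall>(p1::ennreal) (p2::ennreal) (p::ennreal) (f :: real^'n \<Rightarrow> complex) (g :: real^'n \<Rightarrow> complex).
       1 \<le> p1 \<longrightarrow> 1 \<le> p2 \<longrightarrow> 1 / p = 1 / p1 + 1 / p2 \<longrightarrow> 1 \<le> p \<longrightarrow>
       f \<in> GM_space \<rho> s p1 q \<longrightarrow> g \<in> GM_space \<rho> s p2 q \<longrightarrow>
         (\<lambda>x. f x * g x) \<in> GM_space \<rho> s p q \<and>
         GM_norm \<rho> s p q (\<lambda>x. f x * g x) \<le> ennreal C * GM_norm \<rho> s p1 q f * GM_norm \<rho> s p2 q g)"
proof -
  interpret freq_window \<rho> by standard (rule assms(1))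
  note q = assms(2) and s = assms(3)
  \<comment> \<open>Adding 1 makes \<open>C\<close> positive even if the bound were 0.\<close>
  define C where "C = enn2real (GM_const s) + 1"
  have C: "GM_const s \<le> ennreal C"
    using GM_const_less_top[OF s] by (cases "GM_const s" rule: ennreal_cases) (auto simp: C_def intro: ennreal_leI)
  show ?thesis
  proof (intro exI[of _ C] conjI allI impI)
    show "0 < C" by (simp add: C_def add_nonneg_pos)
    fix p1 p2 p :: ennreal and f g :: "real^'n \<Rightarrow> complex"
    assume p: "1 \<le> p1" "1 \<le> p2" "1 / p = 1 / p1 + 1 / p2" "1 \<le> p"
      and fGM: "f \<in> GM_space \<rho> s p1 q" and gGM: "g \<in> GM_space \<rho> s p2 q"
    have f: "f \<in> borel_measurable lebesgue" "Lp_norm p1 f < \<infinity>" "GM_norm \<rho> s p1 q f < \<infinity>"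
      and g: "g \<in> borel_measurable lebesgue" "Lp_norm p2 g < \<infinity>" "GM_norm \<rho> s p2 q g < \<infinity>"
      using fGM gGM by (auto simp: GM_space_def Lp_space_def)
    obtain f' where f'[measurable]: "f' \<in> borel_measurable borel" and ff': "AE x in lborel. f x = f' x"
      using completion_borel_representative[OF f(1)] by (auto elim!: bexE)
    obtain g' where g'[measurable]: "g' \<in> borel_measurable borel" and gg': "AE x in lborel. g x = g' x"
      using completion_borel_representative[OF g(1)] by (auto elim!: bexE)
    have f'_fin: "Lpn p1 f' < \<infinity>"
      using f(2) Lp_norm_cong_borel[OF f(1) f' ff'] by simp
    have g'_fin: "Lpn p2 g' < \<infinity>"
      using g(2) Lp_norm_cong_borel[OF g(1) g' gg'] by simp
    have fg: "(\<lambda>x. f x * g x) \<in> borel_measurable lebesgue" using f(1) g(1) by measurable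
    have fg': "(\<lambda>x. f' x * g' x) \<in> borel_measurable borel" by measurable
    have fgfg': "AE x in lborel. f x * g x = f' x * g' x" using ff' gg' by eventually_elim simp
    \<comment> \<open>Hoelder's inequality for the functions themselves: finite norm of the product
      is part of the claimed membership and also a hypothesis of \<open>GM_norm_eq\<close>.\<close>
    have "Lnorm lborel p (\<lambda>x. ennreal (norm (f' x)) * ennreal (norm (g' x)))
        \<le> Lpn p1 f' * Lpn p2 g'"
      using p f'_fin g'_fin by (intro Lnorm_Holder) auto
    also have "\<dots> < \<infinity>" using f'_fin g'_fin by (simp add: ennreal_mult_less_top)
    finally have fg'_fin: "Lpn p (\<lambda>x. f' x * g' x) < \<infinity>"
      by (simp add: norm_mult ennreal_mult)
    note GM_f = GM_norm_eq[OF p(1) q f(1) f' ff' f'_fin, of s]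
    note GM_g = GM_norm_eq[OF p(2) q g(1) g' gg' g'_fin, of s]
    note GM_fg = GM_norm_eq[OF p(4) q fg fg' fgfg' fg'_fin, of s]
    have "GM_norm \<rho> s p q (\<lambda>x. f x * g x) \<le> GM_const s * (GM_norm \<rho> s p1 q f * GM_norm \<rho> s p2 q g)"
      unfolding GM_f GM_g GM_fg
      using f(3) g(3) unfolding GM_f GM_g
      by (intro Lnorm_weighted_piece_mult_le p q s f' g' f'_fin g'_fin)
    also have "\<dots> \<le> ennreal C * (GM_norm \<rho> s p1 q f * GM_norm \<rho> s p2 q g)"
      by (rule mult_right_mono[OF C]) simp
    finally show le: "GM_norm \<rho> s p q (\<lambda>x. f x * g x) \<le> ennreal C * GM_norm \<rho> s p1 q f * GM_norm \<rho> s p2 q g"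
      by (simp only: mult.assoc)
    have "ennreal C * GM_norm \<rho> s p1 q f * GM_norm \<rho> s p2 q g < \<infinity>"
      using f(3) g(3) by (simp add: ennreal_mult_less_top)
    with le have "GM_norm \<rho> s p q (\<lambda>x. f x * g x) < \<infinity>" by (rule order.strict_trans1)
    moreover have "Lp_norm p (\<lambda>x. f x * g x) < \<infinity>"
      using fg'_fin Lp_norm_cong_borel[OF fg fg' fgfg'] by simp
    ultimately show "(\<lambda>x. f x * g x) \<in> GM_space \<rho> s p q"
      using fg by (simp add: GM_space_def Lp_space_def)
  qed
qed

end
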